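(* Let $d\ge 1$ and let $0<\alpha=\beta\le 1$. Let $u_0\in\mathcal{S}(\mathbb{R}^d)$ (the Schwartz space) with $u_0\neq0$, and let $u$ be the solution of the time-fractional Schrödinger equation $i^\alpha\partial_t^\alpha u=-\Delta u$ in $\mathbb{R}^d\times(0,\infty)$ with $u(\cdot,0)=u_0$. Then the mean square displacement $D_2(u_0,t)$ of $u$ satisfies $$D_2(u_0,t)=C_\alpha(u_0)\,t^2+O(t),\qquad t\to\infty,$$ where $C_\alpha(u_0)$ is the finite, positive constant $$C_\alpha(u_0)=\frac{4}{\alpha^4}\left\|\,|\xi|^{\frac{2-\alpha}{\alpha}}\hat u_0(\xi)\right\|^2 .$$
   Context: $\|\cdot\|$ is the norm of $L^2(\mathbb{R}^d)$ or $L^2(\mathbb{R}^d)^d$ (in the variable $\xi$). Fourier transform: $\hat v(\xi)=(\mathcal{F}v)(\xi)=(2\pi)^{-d/2}\int_{\mathbb{R}^d}e^{-ix\cdot\xi}v(x)\,dx$. Powers of complex numbers are principal, so $i^\alpha=e^{i\pi\alpha/2}$ and $(-i)^\alpha=e^{-i\pi\alpha/2}$. For $\alpha\in(0,1)$, $\partial_t^\alpha$ is the Caputo derivative $\partial_t^\alpha u(t)=\frac{1}{\Gamma(1-\alpha)}\int_0^t\frac{u'(s)}{(t-s)^\alpha}\,ds$; for $\alpha=1$ it is the usual derivative $\partial_t$. A solution of the initial-value problem is a function $u\in L^1_{\rm loc}((0,\infty),H^2(\mathbb{R}^d))\cap W^{1,1}_{\rm loc}((0,\infty),L^2(\mathbb{R}^d))$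 satisfying the equation for a.e. $(x,t)\in\mathbb{R}^d\times(0,\infty)$ and $\lim_{t\downarrow0}\|u(\cdot,t)-u_0\|=0$. The solution considered is given by $\hat u(\xi,t)=E_{\alpha,1}\big((-i)^\alpha|\xi|^2t^\alpha\big)\hat u_0(\xi)$, where $E_{\alpha,\gamma}(z)=\sum_{n\ge0}\frac{z^n}{\Gamma(\alpha n+\gamma)}$ is the Mittag-Leffler function and $\hat u(\cdot,t)$ is the Fourier transform in $x$. The mean square displacement is $D_2(u_0,t):=\|\nabla_\xi\hat u(\cdot,t)\|^2$ (which equals $\int_{\mathbb{R}^d}|x|^2|u(x,t)|^2\,dx$ when this makes sense). *)

theory Defs
  imports "HOL-Analysis.Analysis" "HOL-Library.Landau_Symbols"
begin

text \<open>\<open>ipd [b1, ..., bk] f\<close> is the iterated directional derivative of \<open>f\<close> along \<open>b1, ..., bk\<close>;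
  it is meaningful only where the inner derivatives exist, as demanded by \<open>smooth\<close>.\<close>

fun ipd :: "'a::euclidean_space list \<Rightarrow> ('a \<Rightarrow> complex) \<Rightarrow> 'a \<Rightarrow> complex" where
  "ipd [] f = f"
| "ipd (b # bs) f = (\<lambda>x. frechet_derivative (ipd bs f) (at x) b)"

definition smooth :: "('a::euclidean_space \<Rightarrow> complex) \<Rightarrow> bool" where
  "smooth f \<longleftrightarrow> (\<forall>bs\<in>lists Basis. \<forall>x. ipd bs f differentiable (at x))"

definition schwartz :: "('a::euclidean_space \<Rightarrow> complex) set" where
  "schwartz = {f. smooth f \<and>
     (\<forall>bs\<in>lists Basis. \<forall>k::nat. bounded (range (\<lambda>x. norm x ^ k * cmod (ipd bs f x))))}"

definition test_function :: "'a::euclidean_space set \<Rightarrow> ('a \<Rightarrow> complex) \<Rightarrow> bool" where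
  "test_function \<Omega> \<phi> \<longleftrightarrow>
     smooth \<phi> \<and> compact (closure {x. \<phi> x \<noteq> 0}) \<and> closure {x. \<phi> x \<noteq> 0} \<subseteq> \<Omega>"

definition fourier :: "('a::euclidean_space \<Rightarrow> complex) \<Rightarrow> 'a \<Rightarrow> complex" where
  "fourier v \<xi> = complex_of_real ((2 * pi) powr (- (real DIM('a) / 2))) *
     (\<integral>x. exp (- \<i> * complex_of_real (x \<bullet> \<xi>)) * v x \<partial>lborel)"

definition L2 :: "('a::euclidean_space \<Rightarrow> complex) set" where
  "L2 = {f \<in> borel_measurable lborel. integrable lborel (\<lambda>x. (cmod (f x))\<^sup>2)}"

definition L2norm :: "('a::euclidean_space \<Rightarrow> complex) \<Rightarrow> real" where
  "L2norm f = sqrt (\<integral>x. (cmod (f x))\<^sup>2 \<partial>lborel)"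

definition has_weak_pd ::
    "'a::euclidean_space list \<Rightarrow> ('a \<Rightarrow> complex) \<Rightarrow> ('a \<Rightarrow> complex) \<Rightarrow> bool" where
  "has_weak_pd bs f g \<longleftrightarrow> (\<forall>\<phi>. test_function UNIV \<phi> \<longrightarrow>
     (\<integral>x. f x * ipd bs \<phi> x \<partial>lborel) = (- 1) ^ length bs * (\<integral>x. g x * \<phi> x \<partial>lborel))"

definition H2 :: "('a::euclidean_space \<Rightarrow> complex) set" where
  "H2 = {f \<in> L2. \<forall>bs\<in>lists Basis. length bs \<le> 2 \<longrightarrow> (\<exists>g\<in>L2. has_weak_pd bs f g)}"

text \<open>The choice below is immaterial: a weak derivative is unique up to a null set. Summing over
  lists counts mixed second derivatives twice, which gives an equivalent norm.\<close>

definition H2norm :: "('a::euclidean_space \<Rightarrow> complex) \<Rightarrow> real" where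
  "H2norm f = sqrt (\<Sum>bs | bs \<in> lists Basis \<and> length bs \<le> 2.
     (L2norm (SOME g. g \<in> L2 \<and> has_weak_pd bs f g))\<^sup>2)"

text \<open>An element of \<open>L\<^sup>1\<^sub>l\<^sub>o\<^sub>c((0,\<infinity>), X)\<close>, for \<open>X\<close> a space with norm \<open>N\<close>, is represented by a
  function \<open>u t x\<close> that is Borel measurable in \<open>(t, x)\<close> jointly; as \<open>L\<^sup>2\<close> and \<open>H\<^sup>2\<close> are separable,
  this accounts for strong measurability, and Bochner integrals in \<open>t\<close> are computed pointwise
  for almost every \<open>x\<close>.\<close>

definition L1loc ::
    "('a::euclidean_space \<Rightarrow> complex) set \<Rightarrow> (('a \<Rightarrow> complex) \<Rightarrow> real) \<Rightarrow> (real \<Rightarrow> 'a \<Rightarrow> complex) set"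
  where
  "L1loc X N = {u.
     set_borel_measurable (lborel \<Otimes>\<^sub>M lborel) ({0<..} \<times> UNIV) (\<lambda>(t, x). u t x) \<and>
     (AE t in lborel. 0 < t \<longrightarrow> u t \<in> X) \<and>
     (\<forall>K. compact K \<and> K \<subseteq> {0<..} \<longrightarrow> set_integrable lborel K (\<lambda>t. N (u t)))}"

definition has_weak_time_deriv ::
    "(real \<Rightarrow> 'a::euclidean_space \<Rightarrow> complex) \<Rightarrow> (real \<Rightarrow> 'a \<Rightarrow> complex) \<Rightarrow> bool" where
  "has_weak_time_deriv u v \<longleftrightarrow> (\<forall>\<phi>. test_function {0<..} \<phi> \<longrightarrow>
     (AE x in lborel. (LINT t:{0<..}|lborel. vector_derivative \<phi> (at t) * u t x) =
                    - (LINT t:{0<..}|lborel. \<phi> t * v t x)))"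

text \<open>The Caputo derivative of \<open>u\<close>, in terms of the weak time derivative \<open>v\<close> of \<open>u\<close>; the predicate
  states that the defining integral exists.\<close>

definition caputo_exists :: "real \<Rightarrow> (real \<Rightarrow> 'a \<Rightarrow> complex) \<Rightarrow> real \<Rightarrow> 'a \<Rightarrow> bool" where
  "caputo_exists \<alpha> v t x \<longleftrightarrow>
     \<alpha> = 1 \<or> set_integrable lborel {0<..<t} (\<lambda>s. v s x / complex_of_real ((t - s) powr \<alpha>))"

definition caputo :: "real \<Rightarrow> (real \<Rightarrow> 'a \<Rightarrow> complex) \<Rightarrow> real \<Rightarrow> 'a \<Rightarrow> complex" where
  "caputo \<alpha> v t x =
     (if \<alpha> = 1 then v t x
      else 1 / complex_of_real (Gamma (1 - \<alpha>)) *
        (LINT s:{0<..<t}|lborel. v s x / complex_of_real ((t - s) powr \<alpha>)))"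

text \<open>Here \<open>v\<close> is the time derivative of \<open>u\<close>, and \<open>w b\<close> is the weak second spatial derivative of
  \<open>u\<close> in the coordinate direction \<open>b\<close>, so that the Laplacian of \<open>u\<close> is the sum of the \<open>w b\<close>.
  Naming jointly measurable representatives makes ``for a.e. \<open>(x, t)\<close>'' meaningful.\<close>

definition solves_ivp ::
    "real \<Rightarrow> ('a::euclidean_space \<Rightarrow> complex) \<Rightarrow> (real \<Rightarrow> 'a \<Rightarrow> complex) \<Rightarrow> bool" where
  "solves_ivp \<alpha> u0 u \<longleftrightarrow>
     u \<in> L1loc H2 H2norm \<and> u \<in> L1loc L2 L2norm \<and>
     (\<exists>v \<in> L1loc L2 L2norm. \<exists>w.
        has_weak_time_deriv u v \<and>
        (\<forall>b\<in>Basis. w b \<in> L1loc L2 L2norm \<and>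
           (AE t in lborel. 0 < t \<longrightarrow> has_weak_pd [b, b] (u t) (w b t))) \<and>
        (AE (t, x) in lborel \<Otimes>\<^sub>M lborel. 0 < t \<longrightarrow>
           caputo_exists \<alpha> v t x \<and>
           \<i> powr complex_of_real \<alpha> * caputo \<alpha> v t x = - (\<Sum>b\<in>Basis. w b t x))) \<and>
     (\<forall>\<^sub>F t in at_right 0. (\<lambda>x. u t x - u0 x) \<in> L2) \<and>
     ((\<lambda>t. L2norm (\<lambda>x. u t x - u0 x)) \<longlongrightarrow> 0) (at_right 0)"

definition mittag_leffler :: "real \<Rightarrow> real \<Rightarrow> complex \<Rightarrow> complex" where
  "mittag_leffler \<alpha> \<gamma> z = (\<Sum>n. z ^ n / complex_of_real (Gamma (\<alpha> * real n + \<gamma>)))"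

text \<open>For Schwartz \<open>u0\<close> the right-hand side of the formula is a Schwartz function of \<open>\<xi>\<close>, hence
  \<open>u t\<close> is integrable and its Fourier transform is given by the integral.\<close>

definition the_solution ::
    "real \<Rightarrow> ('a::euclidean_space \<Rightarrow> complex) \<Rightarrow> (real \<Rightarrow> 'a \<Rightarrow> complex) \<Rightarrow> bool" where
  "the_solution \<alpha> u0 u \<longleftrightarrow> solves_ivp \<alpha> u0 u \<and>
     (\<forall>t>0. integrable lborel (u t) \<and>
        (\<forall>\<xi>. fourier (u t) \<xi> =
           mittag_leffler \<alpha> 1
             ((- \<i>) powr complex_of_real \<alpha> * complex_of_real ((norm \<xi>)\<^sup>2 * t powr \<alpha>)) *
           fourier u0 \<xi>))"

definition finite_D2 :: "(real \<Rightarrow> 'a::euclidean_space \<Rightarrow> complex) \<Rightarrow> real \<Rightarrow> bool" where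
  "finite_D2 u t \<longleftrightarrow> (\<forall>\<xi>. fourier (u t) differentiable (at \<xi>)) \<and>
     (\<forall>b\<in>Basis. (\<lambda>\<xi>. frechet_derivative (fourier (u t)) (at \<xi>) b) \<in> L2)"

definition D2 :: "(real \<Rightarrow> 'a::euclidean_space \<Rightarrow> complex) \<Rightarrow> real \<Rightarrow> real" where
  "D2 u t = (\<Sum>b\<in>Basis. (L2norm (\<lambda>\<xi>. frechet_derivative (fourier (u t)) (at \<xi>) b))\<^sup>2)"

definition weighted_u0_hat ::
    "real \<Rightarrow> ('a::euclidean_space \<Rightarrow> complex) \<Rightarrow> 'a \<Rightarrow> complex" where
  "weighted_u0_hat \<alpha> u0 \<xi> = complex_of_real (norm \<xi> powr ((2 - \<alpha>) / \<alpha>)) * fourier u0 \<xi>"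

definition C_const :: "real \<Rightarrow> ('a::euclidean_space \<Rightarrow> complex) \<Rightarrow> real" where
  "C_const \<alpha> u0 = 4 / \<alpha> ^ 4 * (L2norm (weighted_u0_hat \<alpha> u0))\<^sup>2"

end

theory Submission
  imports Defs
    "HOL-Probability.Characteristic_Functions"
    "HOL-Probability.Sinc_Integral"
    "HOL-Complex_Analysis.Residue_Theorem"
    "HOL-Real_Asymp.Real_Asymp"
begin

text \<open>
  Write \<open>c = (-\<i>) powr \<alpha>\<close> and \<open>E = mittag_leffler \<alpha> 1\<close>. The argument of \<open>E\<close> in the solution
  lies on the ray \<open>arg z = - pi * \<alpha> / 2\<close>, the border of the sector in which \<open>E\<close> grows
  exponentially. On that ray the leading term of \<open>E\<close> is the bounded oscillation
  \<open>exp (-\<i> t) / \<alpha>\<close>, where \<open>z = c t powr \<alpha>\<close>. Hence the \<open>\<xi>\<close>-gradient of \<open>E z * fourier u0 \<xi>\<close>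
  is dominated by the derivative of this oscillation. With \<open>\<tau> = (norm \<xi>) powr (2 / \<alpha>) * t\<close> one
  has \<open>z = c \<tau> powr \<alpha>\<close>, and the dominant part has modulus
  \<open>2 / \<alpha>^2 * \<tau> / norm \<xi> * cmod (fourier u0 \<xi>)\<close>, which is \<open>2 t / \<alpha>^2\<close> times that of
  \<open>weighted_u0_hat\<close>. Its squared norm is \<open>C_const \<alpha> u0 * t^2\<close>.

  What makes this rigorous with an error \<open>O(t)\<close> is the exact formula
  \<open>E (c t powr \<alpha>) = exp (-\<i> t) / \<alpha> + ml_remainder \<alpha> t\<close> (\<open>mittag_leffler_decomposition\<close>), whose
  second term is an absolutely convergent superposition of decaying exponentials. Both sides are
  compared through their Laplace transforms, which agree by the residue theorem
  (\<open>stieltjes_identity\<close>) and determine a continuous function (\<open>laplace_unique\<close>). The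
  representation shows that the derivative \<open>R'\<close> of the remainder satisfies
  \<open>t * cmod (R' t) \<le> K * min 1 (t powr (\<alpha> / 2))\<close> (\<open>mittag_leffler_asymptotics\<close>). The first
  bound controls the product of the dominant part with the error by \<open>t\<close>, the second one the
  square of the error by \<open>t powr \<alpha>\<close>; both remain integrable at \<open>\<xi> = 0\<close> in every dimension
  (\<open>gradient_component_estimate\<close>).

  Integrability in \<open>\<xi>\<close> holds because the Fourier transform of a Schwartz function and its
  partial derivatives decay rapidly (\<open>fourier_rapidly_decreasing\<close>), and the constant is positive
  because the Fourier transform is injective on Schwartz functions (\<open>fourier_injective\<close>).
\<close>

section \<open>Rapidly decreasing functions\<close>

text \<open>Lebesgue measure on a Euclidean space is the image of the product measure over \<open>Basis\<close>, so
  a product of functions of single coordinates is integrated factor by factor.\<close>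

lemma
  fixes g :: "'a::euclidean_space \<Rightarrow> real \<Rightarrow> 'b::{real_normed_field,banach,second_countable_topology}"
  assumes g: "\<And>b. b \<in> Basis \<Longrightarrow> integrable lborel (g b)"
  shows integrable_prod_Basis: "integrable lborel (\<lambda>x::'a. \<Prod>b\<in>Basis. g b (x \<bullet> b))"
    and integral_prod_Basis:
      "(\<integral>x. (\<Prod>b\<in>Basis. g b (x \<bullet> b)) \<partial>(lborel::'a measure)) = (\<Prod>b\<in>Basis. \<integral>t. g b t \<partial>lborel)"
proof -
  interpret product_sigma_finite "\<lambda>_::'a. lborel::real measure" ..
  let ?P = "\<Pi>\<^sub>M b\<in>(Basis::'a set). (lborel::real measure)"
  let ?T = "\<lambda>f. \<Sum>b\<in>(Basis::'a set). f b *\<^sub>R b"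
  have D: "(lborel::'a measure) = distr ?P borel ?T"
    by (rule lborel_eq)
  have T: "?T \<in> measurable ?P borel" by measurable
  have [measurable]: "g b \<in> borel_measurable borel" if "b \<in> Basis" for b
    using borel_measurable_integrable[OF g[OF that]] by simp
  have m: "(\<lambda>x::'a. \<Prod>b\<in>Basis. g b (x \<bullet> b)) \<in> borel_measurable borel"
    by measurable
  have e: "(\<Prod>b\<in>Basis. g b (?T f \<bullet> b)) = (\<Prod>b\<in>Basis. g b (f b))" for f
    by (rule prod.cong) auto
  show "integrable lborel (\<lambda>x::'a. \<Prod>b\<in>Basis. g b (x \<bullet> b))"
    unfolding D integrable_distr_eq[OF T m] e
    by (rule product_integrable_prod) (auto intro: g)
  show "(\<integral>x. (\<Prod>b\<in>Basis. g b (x \<bullet> b)) \<partial>(lborel::'a measure)) = (\<Prod>b\<in>Basis. \<integral>t. g b t \<partial>lborel)"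
    unfolding D integral_distr[OF T m] e
    by (rule product_integral_prod) (auto intro: g)
qed

text \<open>This product replaces a negative power of \<open>1 + (norm x)^2\<close> as integrable majorant, since its
  integrability follows from the one-dimensional case.\<close>

definition decay_weight :: "'a::euclidean_space \<Rightarrow> real" where
  "decay_weight x = (\<Prod>b\<in>Basis. inverse (1 + (x \<bullet> b)\<^sup>2))"

lemma integrable_decay_weight: "integrable lborel (decay_weight :: 'a::euclidean_space \<Rightarrow> real)"
  unfolding decay_weight_def
  by (rule integrable_prod_Basis)
    (use integrable_inverse_1_plus_square in \<open>simp add: set_integrable_def\<close>)

lemma decay_weight_lower:
  "1 \<le> (1 + (norm x)\<^sup>2) ^ DIM('a) * decay_weight (x::'a::euclidean_space)"
proof -
  have "(\<Prod>b\<in>(Basis::'a set). 1) \<le> (\<Prod>b\<in>(Basis::'a set). (1 + (norm x)\<^sup>2) * inverse (1 + (x \<bullet> b)\<^sup>2))"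
  proof (intro prod_mono conjI)
    fix b :: 'a assume b: "b \<in> Basis"
    have "\<bar>x \<bullet> b\<bar> \<le> norm x" using Basis_le_norm[OF b] .
    then have "(x \<bullet> b)\<^sup>2 \<le> (norm x)\<^sup>2" by (metis abs_ge_zero power2_abs power_mono)
    moreover have "0 < 1 + (x \<bullet> b)\<^sup>2" by (smt (verit) zero_le_power2)
    ultimately show "1 \<le> (1 + (norm x)\<^sup>2) * inverse (1 + (x \<bullet> b)\<^sup>2)"
      by (simp add: field_simps)
  qed simp
  then show ?thesis by (simp add: prod.distrib decay_weight_def)
qed

lemma decay_weight_nonneg: "0 \<le> decay_weight x"
  unfolding decay_weight_def by (auto intro!: prod_nonneg)

definition rapidly_decreasing :: "('a::euclidean_space \<Rightarrow> complex) \<Rightarrow> bool" where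
  "rapidly_decreasing v \<longleftrightarrow> (\<forall>k. \<exists>C. \<forall>x. norm x ^ k * cmod (v x) \<le> C)"

lemma rapidly_decreasing_poly:
  assumes "rapidly_decreasing v"
  obtains C where "0 \<le> C" "\<And>x. (1 + (norm x)\<^sup>2) ^ n * cmod (v x) \<le> C"
proof -
  obtain C0 where C0: "\<And>x. norm x ^ 0 * cmod (v x) \<le> C0"
    using assms unfolding rapidly_decreasing_def by blast
  obtain C1 where C1: "\<And>x. norm x ^ (2 * n) * cmod (v x) \<le> C1"
    using assms unfolding rapidly_decreasing_def by blast
  have b: "(1 + (norm x)\<^sup>2) ^ n * cmod (v x) \<le> 2 ^ n * (C0 + C1)" for x
  proof -
    have "(1 + (norm x)\<^sup>2) ^ n \<le> (2 * max 1 ((norm x)\<^sup>2)) ^ n"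
      by (rule power_mono) auto
    also have "\<dots> \<le> 2 ^ n * (1 + norm x ^ (2 * n))"
      by (auto simp: power_mult_distrib power_mult max_def)
    finally have "(1 + (norm x)\<^sup>2) ^ n * cmod (v x) \<le> 2 ^ n * (1 + norm x ^ (2 * n)) * cmod (v x)"
      by (rule mult_right_mono) simp
    also have "\<dots> = 2 ^ n * (norm x ^ 0 * cmod (v x) + norm x ^ (2 * n) * cmod (v x))"
      by (simp add: algebra_simps)
    also have "\<dots> \<le> 2 ^ n * (C0 + C1)"
      using C0[of x] C1[of x] by (intro mult_left_mono add_mono) auto
    finally show ?thesis .
  qed
  have "0 \<le> 2 ^ n * (C0 + C1)"
    using b[of 0] by (smt (verit) norm_ge_zero zero_le_power2 zero_le_power mult_nonneg_nonneg)
  with b show ?thesis using that by blast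
qed

lemma rapidly_decreasing_le_weight:
  fixes v :: "'a::euclidean_space \<Rightarrow> complex"
  assumes "rapidly_decreasing v"
  obtains C where "0 \<le> C" "\<And>x. (1 + (norm x)\<^sup>2) ^ n * cmod (v x) \<le> C * decay_weight x"
proof -
  obtain C where C: "0 \<le> C" "\<And>x. (1 + (norm x)\<^sup>2) ^ (n + DIM('a)) * cmod (v x) \<le> C"
    using rapidly_decreasing_poly[OF assms] by metis
  have "(1 + (norm x)\<^sup>2) ^ n * cmod (v x) \<le> C * decay_weight x" for x
  proof -
    have "(1 + (norm x)\<^sup>2) ^ n * cmod (v x) * 1
        \<le> (1 + (norm x)\<^sup>2) ^ n * cmod (v x) * ((1 + (norm x)\<^sup>2) ^ DIM('a) * decay_weight x)"
      by (intro mult_left_mono decay_weight_lower) auto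
    also have "\<dots> = ((1 + (norm x)\<^sup>2) ^ (n + DIM('a)) * cmod (v x)) * decay_weight x"
      by (simp add: power_add algebra_simps)
    also have "\<dots> \<le> C * decay_weight x"
      by (intro mult_right_mono C decay_weight_nonneg)
    finally show ?thesis by simp
  qed
  with C(1) that show ?thesis by blast
qed

lemma powr_le_one_plus_square_power:
  fixes r p :: real
  assumes "0 \<le> r" "p \<le> 2 * real n" "0 \<le> p"
  shows "r powr p \<le> (1 + r\<^sup>2) ^ n"
proof (cases "r \<le> 1")
  case True
  then have "r powr p \<le> 1" using assms by (simp add: powr_le1)
  also have "1 \<le> (1 + r\<^sup>2) ^ n" by simp
  finally show ?thesis .
next
  case False
  then have "r powr p \<le> r powr (real (2 * n))" using assms by (intro powr_mono) auto
  also have "\<dots> = (r\<^sup>2) ^ n" using False by (subst powr_realpow) (auto simp: power_mult)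
  also have "\<dots> \<le> (1 + r\<^sup>2) ^ n" by (intro power_mono) auto
  finally show ?thesis .
qed

text \<open>The exponent is real because the weights \<open>2 / \<alpha> - 2\<close> and \<open>2 * (2 - \<alpha>) / \<alpha>\<close> occur below.\<close>

lemma rapidly_decreasing_integrable:
  fixes v :: "'a::euclidean_space \<Rightarrow> complex"
  assumes "rapidly_decreasing v" and [measurable]: "v \<in> borel_measurable borel" and "0 \<le> p"
  shows "integrable lborel (\<lambda>x. norm x powr p * cmod (v x))"
proof -
  obtain n :: nat where "p / 2 \<le> real n"
    using real_arch_simple by blast
  then have n: "p \<le> 2 * real n" by simp
  obtain C where C: "0 \<le> C" "\<And>x. (1 + (norm x)\<^sup>2) ^ n * cmod (v x) \<le> C * decay_weight x"
    using rapidly_decreasing_le_weight[OF assms(1)] by metis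
  show ?thesis
  proof (rule Bochner_Integration.integrable_bound)
    show "integrable lborel (\<lambda>x::'a. C * decay_weight x)"
      by (intro integrable_mult_right integrable_decay_weight)
    show "AE x in lborel. norm (norm x powr p * cmod (v x)) \<le> norm (C * decay_weight x)"
    proof (rule AE_I2)
      fix x :: 'a
      have "norm x powr p * cmod (v x) \<le> (1 + (norm x)\<^sup>2) ^ n * cmod (v x)"
        by (intro mult_right_mono powr_le_one_plus_square_power) (use n assms in auto)
      also have "\<dots> \<le> C * decay_weight x" by (rule C)
      finally show "norm (norm x powr p * cmod (v x)) \<le> norm (C * decay_weight x)"
        by (simp add: C decay_weight_nonneg)
    qed
  qed measurable
qed

text \<open>The case \<open>p = 0\<close>, restated because \<open>0 powr 0 = 0\<close> spoils the weight at the origin.\<close>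

lemma rapidly_decreasing_integrable_unweighted:
  fixes v :: "'a::euclidean_space \<Rightarrow> complex"
  assumes "rapidly_decreasing v" and [measurable]: "v \<in> borel_measurable borel"
  shows "integrable lborel (\<lambda>x. cmod (v x))"
proof -
  have "AE x::'a in lborel. norm x powr 0 * cmod (v x) = cmod (v x)"
    using AE_lborel_singleton[of "0::'a"] by eventually_elim simp
  then have "integrable lborel (\<lambda>x. norm x powr 0 * cmod (v x)) \<longleftrightarrow> integrable lborel (\<lambda>x. cmod (v x))"
    by (intro integrable_cong_AE) measurable
  then show ?thesis using rapidly_decreasing_integrable[OF assms, of 0] by simp
qed

lemma rapidly_decreasing_mult:
  assumes "rapidly_decreasing v" "rapidly_decreasing w"
  shows "rapidly_decreasing (\<lambda>x. v x * w x)"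
  unfolding rapidly_decreasing_def
proof
  fix k
  obtain C where C: "\<And>x. norm x ^ k * cmod (v x) \<le> C"
    using assms(1) unfolding rapidly_decreasing_def by blast
  obtain D where D: "\<And>x. norm x ^ 0 * cmod (w x) \<le> D"
    using assms(2) unfolding rapidly_decreasing_def by blast
  have "norm x ^ k * cmod (v x * w x) \<le> C * D" for x
  proof -
    have "(norm x ^ k * cmod (v x)) * cmod (w x) \<le> C * D"
      by (intro mult_mono C) (use D[of x] order_trans[OF _ C[of x]] in auto)
    then show ?thesis by (simp add: norm_mult mult.assoc)
  qed
  then show "\<exists>C. \<forall>x. norm x ^ k * cmod (v x * w x) \<le> C" by blast
qed

section \<open>Schwartz functions and their Fourier transforms\<close>

lemma ipd_append: "ipd (xs @ ys) f = ipd xs (ipd ys f)"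
  by (induction xs) auto

lemma ipd_schwartz:
  assumes "f \<in> schwartz" "bs \<in> lists Basis"
  shows "ipd bs f \<in> schwartz"
  using assms by (auto simp: schwartz_def smooth_def ipd_append[symmetric] simp del: in_lists_conv_set)

lemma schwartz_differentiable: "f \<in> schwartz \<Longrightarrow> f differentiable (at x)"
  unfolding schwartz_def smooth_def by (auto dest: bspec[where x="[]"])

lemma schwartz_continuous: "f \<in> schwartz \<Longrightarrow> continuous_on UNIV f"
  by (meson schwartz_differentiable differentiable_imp_continuous_within continuous_at_imp_continuous_on)

lemma schwartz_measurable: "f \<in> schwartz \<Longrightarrow> f \<in> borel_measurable borel"
  by (simp add: schwartz_continuous borel_measurable_continuous_onI)

lemma schwartz_rapidly_decreasing:
  assumes "f \<in> schwartz" shows "rapidly_decreasing f"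
  unfolding rapidly_decreasing_def
proof
  fix k
  have "bounded (range (\<lambda>x. norm x ^ k * cmod (ipd [] f x)))"
    using assms unfolding schwartz_def by blast
  then show "\<exists>C. \<forall>x. norm x ^ k * cmod (f x) \<le> C"
    unfolding bounded_iff by (auto simp: abs_mult)
qed

lemma schwartz_integrable_weighted:
  assumes "f \<in> schwartz" "0 \<le> p"
  shows "integrable lborel (\<lambda>x. norm x powr p * cmod (f x))"
  using assms by (intro rapidly_decreasing_integrable schwartz_rapidly_decreasing schwartz_measurable)

lemma schwartz_integrable:
  assumes "f \<in> schwartz" shows "integrable lborel f"
proof -
  have [measurable]: "f \<in> borel_measurable borel" by (rule schwartz_measurable[OF assms])
  have "integrable lborel (\<lambda>x. cmod (f x))"
    by (intro rapidly_decreasing_integrable_unweighted schwartz_rapidly_decreasing assms) measurable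
  then show ?thesis by (simp add: integrable_norm_iff)
qed

text \<open>Leibniz's rule. Only the shape of the lower-order terms is recorded: they are iterated
  derivatives of \<open>f\<close> without a factor \<open>x \<bullet> c\<close>, hence rapidly decreasing.\<close>

lemma ipd_coordinate_mult:
  assumes "smooth f" "bs \<in> lists Basis" "c \<in> Basis"
  shows "\<exists>S. set S \<subseteq> lists Basis \<and>
    ipd bs (\<lambda>x. complex_of_real (x \<bullet> c) * f x) =
      (\<lambda>x. complex_of_real (x \<bullet> c) * ipd bs f x + (\<Sum>cs\<leftarrow>S. ipd cs f x))"
  using assms(2)
proof (induction bs)
  case Nil
  show ?case by (rule exI[of _ "[]"]) auto
next
  case (Cons b bs)
  then obtain S where S: "set S \<subseteq> lists Basis"
    "ipd bs (\<lambda>x. complex_of_real (x \<bullet> c) * f x) =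
      (\<lambda>x. complex_of_real (x \<bullet> c) * ipd bs f x + (\<Sum>cs\<leftarrow>S. ipd cs f x))"
    by auto
  have D: "(ipd cs f has_derivative frechet_derivative (ipd cs f) (at x)) (at x)"
    if "cs \<in> lists Basis" for cs x
    using assms(1) that unfolding smooth_def by (auto simp: frechet_derivative_works[symmetric])
  have DS: "((\<lambda>x. \<Sum>cs\<leftarrow>S. ipd cs f x) has_derivative
      (\<lambda>h. \<Sum>cs\<leftarrow>S. frechet_derivative (ipd cs f) (at x) h)) (at x)" for x
    using S(1) by (induction S) (auto intro!: has_derivative_add D)
  have "((\<lambda>x. complex_of_real (x \<bullet> c) * ipd bs f x + (\<Sum>cs\<leftarrow>S. ipd cs f x)) has_derivative
      (\<lambda>h. (complex_of_real (x \<bullet> c) * frechet_derivative (ipd bs f) (at x) h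
         + complex_of_real (h \<bullet> c) * ipd bs f x)
         + (\<Sum>cs\<leftarrow>S. frechet_derivative (ipd cs f) (at x) h))) (at x)" for x
    using Cons.hyps
    by (intro has_derivative_add DS has_derivative_mult D has_derivative_of_real
        has_derivative_inner_left has_derivative_ident) auto
  then have F: "frechet_derivative (\<lambda>x. complex_of_real (x \<bullet> c) * ipd bs f x + (\<Sum>cs\<leftarrow>S. ipd cs f x)) (at x)
      = (\<lambda>h. (complex_of_real (x \<bullet> c) * frechet_derivative (ipd bs f) (at x) h
         + complex_of_real (h \<bullet> c) * ipd bs f x)
         + (\<Sum>cs\<leftarrow>S. frechet_derivative (ipd cs f) (at x) h))" for x
    by (rule frechet_derivative_at[symmetric])
  define S' where "S' = (if b = c then [bs] else []) @ map (Cons b) S"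
  have bc: "complex_of_real (b \<bullet> c) = (if b = c then 1 else 0)"
    using Cons.hyps assms(3) by (auto simp: inner_Basis)
  have "set S' \<subseteq> lists Basis" using S(1) Cons.hyps unfolding S'_def by (force simp: subset_iff)
  moreover have "ipd (b # bs) (\<lambda>x. complex_of_real (x \<bullet> c) * f x) =
      (\<lambda>x. complex_of_real (x \<bullet> c) * ipd (b # bs) f x + (\<Sum>cs\<leftarrow>S'. ipd cs f x))"
    by (auto simp: S(2) F bc S'_def fun_eq_iff o_def)
  ultimately show ?case by blast
qed

lemma schwartz_coordinate_mult:
  assumes f: "f \<in> schwartz" and c: "c \<in> Basis"
  shows "(\<lambda>x. complex_of_real (x \<bullet> c) * f x) \<in> schwartz"
proof -
  have sm: "smooth f" using f by (auto simp: schwartz_def)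
  show ?thesis
    unfolding schwartz_def smooth_def mem_Collect_eq
  proof (intro conjI ballI allI)
    fix bs :: "'a list" assume bs: "bs \<in> lists Basis"
    obtain S where S: "set S \<subseteq> lists Basis"
      "ipd bs (\<lambda>x. complex_of_real (x \<bullet> c) * f x) =
      (\<lambda>x. complex_of_real (x \<bullet> c) * ipd bs f x + (\<Sum>cs\<leftarrow>S. ipd cs f x))"
      using ipd_coordinate_mult[OF sm bs c] by blast
    have d: "ipd cs f differentiable (at x)" if "cs \<in> lists Basis" for cs x
      using sm that by (auto simp: smooth_def)
    have dS: "(\<lambda>x. \<Sum>cs\<leftarrow>S. ipd cs f x) differentiable (at x)" for x
      using S(1) by (induction S) (auto intro!: differentiable_add d)
    have dc: "(\<lambda>x. complex_of_real (x \<bullet> c)) differentiable (at x)" for x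
      unfolding differentiable_def
      by (rule exI, rule has_derivative_of_real, rule has_derivative_inner_left, rule has_derivative_ident)
    show "ipd bs (\<lambda>x. complex_of_real (x \<bullet> c) * f x) differentiable (at x)" for x
      unfolding S(2) by (intro differentiable_add differentiable_mult dS d bs dc)
    fix k
    have B: "\<exists>C. \<forall>x. norm x ^ k * cmod (ipd cs f x) \<le> C" if "cs \<in> lists Basis" for cs k
      using schwartz_rapidly_decreasing[OF ipd_schwartz[OF f that]]
      unfolding rapidly_decreasing_def by blast
    have BS: "\<exists>C. \<forall>x. norm x ^ k * cmod (\<Sum>cs\<leftarrow>S. ipd cs f x) \<le> C"
      using S(1)
    proof (induction S)
      case Nil show ?case by auto
    next
      case (Cons cs S)
      obtain C where C: "\<And>x. norm x ^ k * cmod (\<Sum>cs\<leftarrow>S. ipd cs f x) \<le> C" using Cons by auto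
      obtain D where D: "\<And>x. norm x ^ k * cmod (ipd cs f x) \<le> D" using Cons.prems B[of cs k] by auto
      have "norm x ^ k * cmod (ipd cs f x + (\<Sum>cs\<leftarrow>S. ipd cs f x)) \<le> D + C" for x
      proof -
        have "norm x ^ k * cmod (ipd cs f x + (\<Sum>cs\<leftarrow>S. ipd cs f x))
          \<le> norm x ^ k * (cmod (ipd cs f x) + cmod (\<Sum>cs\<leftarrow>S. ipd cs f x))"
          by (intro mult_left_mono norm_triangle_ineq) auto
        also have "\<dots> \<le> D + C" using C[of x] D[of x] by (simp add: algebra_simps)
        finally show ?thesis .
      qed
      then show ?case by auto
    qed
    obtain C where C: "\<And>x. norm x ^ k * cmod (\<Sum>cs\<leftarrow>S. ipd cs f x) \<le> C" using BS by blast
    obtain D where D: "\<And>x. norm x ^ Suc k * cmod (ipd bs f x) \<le> D" using B[OF bs, of "Suc k"] by blast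
    have "norm x ^ k * cmod (ipd bs (\<lambda>x. complex_of_real (x \<bullet> c) * f x) x) \<le> D + C" for x
    proof -
      have "cmod (ipd bs (\<lambda>x. complex_of_real (x \<bullet> c) * f x) x)
        \<le> cmod (complex_of_real (x \<bullet> c) * ipd bs f x) + cmod (\<Sum>cs\<leftarrow>S. ipd cs f x)"
        unfolding S(2) by (rule norm_triangle_ineq)
      also have "\<dots> \<le> norm x * cmod (ipd bs f x) + cmod (\<Sum>cs\<leftarrow>S. ipd cs f x)"
        using Basis_le_norm[OF c, of x] by (auto simp: norm_mult intro!: mult_right_mono)
      finally have "norm x ^ k * cmod (ipd bs (\<lambda>x. complex_of_real (x \<bullet> c) * f x) x)
         \<le> norm x ^ k * (norm x * cmod (ipd bs f x) + cmod (\<Sum>cs\<leftarrow>S. ipd cs f x))"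
        by (rule mult_left_mono) auto
      also have "\<dots> \<le> D + C" using C[of x] D[of x] by (simp add: algebra_simps)
      finally show ?thesis .
    qed
    then show "bounded (range (\<lambda>x. norm x ^ k * cmod (ipd bs (\<lambda>x. complex_of_real (x \<bullet> c) * f x) x)))"
      unfolding bounded_iff by (auto simp: abs_mult)
  qed
qed

lemma fourier_integrable:
  fixes f :: "'a::euclidean_space \<Rightarrow> complex"
  assumes "integrable lborel f"
  shows "integrable lborel (\<lambda>x. exp (- \<i> * complex_of_real (x \<bullet> \<xi>)) * f x)"
proof (rule Bochner_Integration.integrable_bound[OF assms])
  have [measurable]: "f \<in> borel_measurable borel"
    using borel_measurable_integrable[OF assms] by simp
  show "(\<lambda>x. exp (- \<i> * complex_of_real (x \<bullet> \<xi>)) * f x) \<in> borel_measurable lborel"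
    by measurable
qed (auto simp: norm_mult)

lemma exp_linear_remainder:
  "cmod (exp (- \<i> * complex_of_real s) - 1 + \<i> * complex_of_real s) \<le> s\<^sup>2 / 2"
proof -
  have "cmod (iexp (-s) - (\<Sum>k \<le> 1. (\<i> * (-s))^k / fact k)) \<le> \<bar>-s\<bar>^(Suc 1) / fact (Suc 1)"
    by (rule iexp_approx1)
  then show ?thesis by (simp add: power2_eq_square algebra_simps)
qed

text \<open>Differentiation under the integral sign: the remainder of the first-order expansion of the
  exponential is at most \<open>(norm x * norm h)^2 / 2\<close>, and \<open>f\<close> has a finite second moment.\<close>

lemma fourier_has_derivative:
  fixes f :: "'a::euclidean_space \<Rightarrow> complex"
  assumes f: "f \<in> schwartz"
  shows "(fourier f has_derivative
     (\<lambda>h. - \<i> * (\<Sum>b\<in>Basis. complex_of_real (h \<bullet> b) *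
         fourier (\<lambda>x. complex_of_real (x \<bullet> b) * f x) \<xi>))) (at \<xi>)"
proof -
  define N where "N = (2 * pi) powr (- (real DIM('a) / 2))"
  define M where "M = (\<integral>x. norm x powr 2 * cmod (f x) \<partial>lborel)"
  let ?e = "\<lambda>\<xi> x. exp (- \<i> * complex_of_real (x \<bullet> \<xi>))"
  have N: "0 \<le> N" by (simp add: N_def)
  have M: "0 \<le> M" by (simp add: M_def integral_nonneg_AE)
  have int_f: "integrable lborel (\<lambda>x. ?e \<xi> x * f x)" for \<xi>
    by (intro fourier_integrable schwartz_integrable f)
  have int_b: "integrable lborel (\<lambda>x. ?e \<xi> x * (complex_of_real (x \<bullet> b) * f x))" if "b \<in> Basis" for b
    by (intro fourier_integrable schwartz_integrable schwartz_coordinate_mult f that)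
  have int_M: "integrable lborel (\<lambda>x. norm x powr 2 * cmod (f x))"
    by (rule schwartz_integrable_weighted) (use f in auto)
  define L where "L = (\<lambda>h. - \<i> * (\<Sum>b\<in>Basis. complex_of_real (h \<bullet> b) *
         fourier (\<lambda>x. complex_of_real (x \<bullet> b) * f x) \<xi>))"
  define g where "g = (\<lambda>h x. (\<Sum>b\<in>Basis. complex_of_real (h \<bullet> b) * (?e \<xi> x * (complex_of_real (x \<bullet> b) * f x))))"
  have int_g: "integrable lborel (g h)" for h
    unfolding g_def by (intro Bochner_Integration.integrable_sum integrable_mult_right int_b)
  have g: "g h x = ?e \<xi> x * (complex_of_real (x \<bullet> h) * f x)" for h x
  proof -
    have "complex_of_real (x \<bullet> h) = (\<Sum>b\<in>Basis. complex_of_real (h \<bullet> b) * complex_of_real (x \<bullet> b))"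
      by (subst euclidean_inner) (simp add: mult.commute)
    then show ?thesis unfolding g_def by (simp add: sum_distrib_left sum_distrib_right algebra_simps)
  qed
  have int_g_eq: "(\<integral>x. g h x \<partial>lborel)
      = (\<Sum>b\<in>Basis. complex_of_real (h \<bullet> b) * (\<integral>x. ?e \<xi> x * (complex_of_real (x \<bullet> b) * f x) \<partial>lborel))" for h
    unfolding g_def
    by (subst Bochner_Integration.integral_sum)
      (auto intro!: integrable_mult_right int_b simp only: integral_mult_right_zero)
  have L: "L h = N * (- \<i> * (\<integral>x. g h x \<partial>lborel))" for h
    unfolding int_g_eq L_def fourier_def N_def[symmetric]
    by (simp add: sum_distrib_left mult_ac)
  have bound: "norm (fourier f (\<xi> + h) - fourier f \<xi> - L h) \<le> N * (M / 2) * (norm h)\<^sup>2" for h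
  proof -
    have e1: "fourier f (\<xi> + h) - fourier f \<xi> - L h
      = N * (\<integral>x. ?e (\<xi> + h) x * f x - ?e \<xi> x * f x - (- \<i>) * g h x \<partial>lborel)"
      unfolding L unfolding fourier_def N_def[symmetric]
      using int_f int_g by (simp add: Bochner_Integration.integral_diff right_diff_distrib distrib_left)
    have "cmod (fourier f (\<xi> + h) - fourier f \<xi> - L h) = N * cmod (\<integral>x. ?e (\<xi> + h) x * f x - ?e \<xi> x * f x - (- \<i>) * g h x \<partial>lborel)"
      using N unfolding e1 by (simp add: norm_mult)
    also have "\<dots> \<le> N * (\<integral>x. (norm h)\<^sup>2 / 2 * (norm x powr 2 * cmod (f x)) \<partial>lborel)"
    proof (intro mult_left_mono N Bochner_Integration.integral_norm_bound_integral)
      fix x :: 'a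
      have e2: "?e (\<xi> + h) x * f x - ?e \<xi> x * f x - (- \<i>) * g h x
        = ?e \<xi> x * f x * (exp (- \<i> * complex_of_real (x \<bullet> h)) - 1 + \<i> * complex_of_real (x \<bullet> h))"
        unfolding g by (simp add: inner_add_right exp_add[symmetric] algebra_simps)
      have "cmod (?e (\<xi> + h) x * f x - ?e \<xi> x * f x - (- \<i>) * g h x) = cmod (f x) * cmod (exp (- \<i> * complex_of_real (x \<bullet> h)) - 1 + \<i> * complex_of_real (x \<bullet> h))"
        unfolding e2 by (simp add: norm_mult)
      also have "\<dots> \<le> cmod (f x) * ((x \<bullet> h)\<^sup>2 / 2)"
        by (intro mult_left_mono exp_linear_remainder) auto
      also have "\<dots> \<le> cmod (f x) * ((norm x * norm h)\<^sup>2 / 2)"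
        using Cauchy_Schwarz_ineq2[of x h]
        by (intro mult_left_mono divide_right_mono power2_le_iff_abs_le[THEN iffD2]) auto
      also have "\<dots> = (norm h)\<^sup>2 / 2 * (norm x powr 2 * cmod (f x))"
        by (cases "x = 0") (auto simp: power_mult_distrib powr_numeral)
      finally show "norm (?e (\<xi> + h) x * f x - ?e \<xi> x * f x - (- \<i>) * g h x)
         \<le> (norm h)\<^sup>2 / 2 * (norm x powr 2 * cmod (f x))" .
    qed (use int_f int_g int_M in \<open>auto intro!: Bochner_Integration.integrable_diff\<close>)
    also have "\<dots> = N * (M / 2) * (norm h)\<^sup>2"
      by (simp only: M_def integral_mult_right_zero) simp
    finally show ?thesis .
  qed
  have "bounded_linear L" unfolding L_def
    by (intro bounded_linear_const_mult bounded_linear_sum bounded_linear_mult_const bounded_linear_of_real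
        bounded_linear_compose[OF bounded_linear_of_real] bounded_linear_inner_left)
  moreover have "(\<lambda>y. norm (fourier f y - fourier f \<xi> - L (y - \<xi>)) / norm (y - \<xi>)) \<midarrow>\<xi>\<rightarrow> 0"
  proof (rule tendsto_sandwich[where f="\<lambda>_. 0" and h="\<lambda>y. N * (M / 2) * norm (y - \<xi>)"])
    show "\<forall>\<^sub>F y in at \<xi>. norm (fourier f y - fourier f \<xi> - L (y - \<xi>)) / norm (y - \<xi>) \<le> N * (M / 2) * norm (y - \<xi>)"
    proof (rule always_eventually, rule allI)
      fix y
      show "norm (fourier f y - fourier f \<xi> - L (y - \<xi>)) / norm (y - \<xi>) \<le> N * (M / 2) * norm (y - \<xi>)"
        using bound[of "y - \<xi>"] N M
        by (cases "y = \<xi>") (auto simp: field_simps power2_eq_square)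
    qed
    show "(\<lambda>y. N * (M / 2) * norm (y - \<xi>)) \<midarrow>\<xi>\<rightarrow> 0"
      by (rule tendsto_eq_intros refl | simp)+
  qed auto
  ultimately have "(fourier f has_derivative L) (at \<xi>)"
    unfolding has_derivative_iff_norm by blast
  then show ?thesis unfolding L_def .
qed

lemma fourier_differentiable: "f \<in> schwartz \<Longrightarrow> fourier f differentiable (at \<xi>)"
  using fourier_has_derivative differentiable_def by blast

lemma fourier_continuous: "f \<in> schwartz \<Longrightarrow> continuous_on UNIV (fourier f)"
  by (meson fourier_differentiable differentiable_imp_continuous_within continuous_at_imp_continuous_on)

lemma frechet_derivative_fourier:
  assumes "f \<in> schwartz" "b \<in> Basis"
  shows "frechet_derivative (fourier f) (at \<xi>) b = - \<i> * fourier (\<lambda>x. complex_of_real (x \<bullet> b) * f x) \<xi>"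
proof -
  have "frechet_derivative (fourier f) (at \<xi>) b =
    - \<i> * (\<Sum>c\<in>Basis. complex_of_real (b \<bullet> c) * fourier (\<lambda>x. complex_of_real (x \<bullet> c) * f x) \<xi>)"
    by (rule arg_cong[where f="\<lambda>D. D b", OF frechet_derivative_at[OF fourier_has_derivative[OF assms(1), of \<xi>], symmetric]])
  also have "\<dots> = - \<i> * (\<Sum>c\<in>Basis. if c = b then fourier (\<lambda>x. complex_of_real (x \<bullet> c) * f x) \<xi> else 0)"
    using assms(2) by (intro arg_cong2[where f="(*)"] refl sum.cong) (auto simp: inner_Basis)
  also have "\<dots> = - \<i> * fourier (\<lambda>x. complex_of_real (x \<bullet> b) * f x) \<xi>"
    using assms(2) by simp
  finally show ?thesis .
qed

lemma vector_derivative_difference_quotient: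
  fixes f :: "real \<Rightarrow> complex"
  assumes f: "(f has_vector_derivative D) (at t)" and h0: "h \<longlonglongrightarrow> 0" and h: "\<And>n. 0 < h n"
  shows "(\<lambda>n. (f (t + h n) - f t) / complex_of_real (h n)) \<longlonglongrightarrow> D"
proof -
  have "filterlim (\<lambda>n. t + h n) (at t) sequentially"
  proof (rule filterlim_atI)
    show "(\<lambda>n. t + h n) \<longlonglongrightarrow> t" using tendsto_add[OF tendsto_const h0, of t] by simp
    show "\<forall>\<^sub>F n in sequentially. t + h n \<noteq> t" using h by (auto intro!: always_eventually simp: less_imp_neq[THEN not_sym])
  qed
  moreover have "((\<lambda>s. norm (f s - f t - (s - t) *\<^sub>R D) / norm (s - t)) \<longlongrightarrow> 0) (at t)"
    using f by (simp add: has_vector_derivative_def has_derivative_iff_norm)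
  ultimately have "(\<lambda>n. norm (f (t + h n) - f t - (t + h n - t) *\<^sub>R D) / norm (t + h n - t)) \<longlonglongrightarrow> 0"
    by (rule filterlim_compose[rotated])
  moreover have "norm (f (t + h n) - f t - (t + h n - t) *\<^sub>R D) / norm (t + h n - t)
      = norm ((f (t + h n) - f t) / complex_of_real (h n) - D)" for n
  proof -
    have "(f (t + h n) - f t) / complex_of_real (h n) - D = (f (t + h n) - f t - h n *\<^sub>R D) / complex_of_real (h n)"
      using h[of n] by (simp add: diff_divide_distrib scaleR_conv_of_real)
    then show ?thesis by (simp only: norm_divide norm_of_real real_norm_def add_diff_cancel_left')
  qed
  ultimately have "(\<lambda>n. (f (t + h n) - f t) / complex_of_real (h n) - D) \<longlonglongrightarrow> 0"
    by (simp add: tendsto_norm_zero_iff)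
  then show ?thesis by (rule LIM_zero_cancel)
qed

lemma integrable_pair_product:
  fixes f :: "'a::euclidean_space \<Rightarrow> complex" and g :: "'b::euclidean_space \<Rightarrow> complex"
  assumes f: "integrable lborel f" and g: "integrable lborel g"
  shows "integrable (lborel \<Otimes>\<^sub>M lborel) (\<lambda>(x, y). f x * g y)"
proof (rule lborel_pair.Fubini_integrable)
  have [measurable]: "f \<in> borel_measurable borel" "g \<in> borel_measurable borel"
    using f g by (auto dest: borel_measurable_integrable)
  show "(\<lambda>(x, y). f x * g y) \<in> borel_measurable (lborel \<Otimes>\<^sub>M lborel)" by measurable
  show "integrable lborel (\<lambda>x. \<integral>y. norm (case (x, y) of (x, y) \<Rightarrow> f x * g y) \<partial>lborel)"
    using f by (simp add: norm_mult)
  show "AE x in lborel. integrable lborel (\<lambda>y. case (x, y) of (x, y) \<Rightarrow> f x * g y)"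
    using g by auto
qed

lemma integral_translate:
  fixes f :: "'a::euclidean_space \<Rightarrow> 'b::{banach,second_countable_topology}"
  assumes "f \<in> borel_measurable borel"
  shows "(\<integral>x. f (x + c) \<partial>lborel) = (\<integral>x. f x \<partial>lborel)"
proof -
  have "(\<integral>x. f x \<partial>lborel) = (\<integral>x. f x \<partial>(distr lborel borel ((+) c)))"
    by (simp add: lborel_distr_plus)
  also have "\<dots> = (\<integral>x. f (c + x) \<partial>lborel)"
    by (rule integral_distr) (use assms in auto)
  finally show ?thesis by (simp add: add.commute)
qed

lemma schwartz_directional_derivative:
  assumes "f \<in> schwartz"
  shows "((\<lambda>s. f (x + s *\<^sub>R b)) has_derivative (\<lambda>k. k *\<^sub>R ipd [b] f (x + s *\<^sub>R b))) (at s within S)"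
proof -
  have 1: "(f has_derivative frechet_derivative f (at (x + s *\<^sub>R b))) (at (x + s *\<^sub>R b))"
    using schwartz_differentiable[OF assms] frechet_derivative_works by blast
  have 2: "((\<lambda>s. x + s *\<^sub>R b) has_derivative (\<lambda>k. k *\<^sub>R b)) (at s)"
    by (auto intro!: derivative_eq_intros)
  have 3: "frechet_derivative f (at y) (k *\<^sub>R b) = k *\<^sub>R frechet_derivative f (at y) b" for y k
    using linear_frechet_derivative[OF schwartz_differentiable[OF assms]] linear_cmul by blast
  from has_derivative_compose[OF 2 1] have "((\<lambda>s. f (x + s *\<^sub>R b)) has_derivative (\<lambda>k. k *\<^sub>R ipd [b] f (x + s *\<^sub>R b))) (at s)"
    by (simp add: 3)
  then show ?thesis by (rule has_derivative_at_withinI)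
qed

text \<open>An integrable majorant, uniform in the step \<open>h\<close>, for the difference quotients of \<open>f\<close>.\<close>

lemma schwartz_difference_dominated:
  fixes f :: "'a::euclidean_space \<Rightarrow> complex"
  assumes f: "f \<in> schwartz" and b: "b \<in> Basis"
  obtains C where "\<And>x h. \<bar>h\<bar> \<le> 1 \<Longrightarrow> cmod (f (x + h *\<^sub>R b) - f x) \<le> \<bar>h\<bar> * (C * decay_weight x)"
proof -
  let ?g = "ipd [b] f"
  have "?g \<in> schwartz" using ipd_schwartz[OF f, of "[b]"] b by simp
  then obtain C where C: "0 \<le> C" "\<And>y. (1 + (norm y)\<^sup>2) ^ DIM('a) * cmod (?g y) \<le> C"
    using rapidly_decreasing_poly[OF schwartz_rapidly_decreasing] by metis
  have g: "cmod (?g (x + s *\<^sub>R b)) \<le> 3 ^ DIM('a) * C * decay_weight x" if "\<bar>s\<bar> \<le> 1" for x s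
  proof -
    define y where "y = x + s *\<^sub>R b"
    have "norm x \<le> norm y + norm (s *\<^sub>R b)" unfolding y_def by (metis add_diff_cancel_right' norm_triangle_ineq4)
    then have "norm x \<le> norm y + 1" using that b by simp
    then have "(norm x)\<^sup>2 \<le> (norm y + 1)\<^sup>2" by (rule power_mono) simp
    also have "\<dots> \<le> 2 * (norm y)\<^sup>2 + 2" 
      using sum_squares_bound[of "norm y" 1] by (simp add: power2_eq_square algebra_simps)
    finally have "(norm x)\<^sup>2 \<le> 2 * (norm y)\<^sup>2 + 2" .
    moreover have "0 \<le> (norm y)\<^sup>2" by (rule zero_le_power2)
    ultimately have xy: "1 + (norm x)\<^sup>2 \<le> 3 * (1 + (norm y)\<^sup>2)" by argo
    have "cmod (?g y) \<le> cmod (?g y) * ((1 + (norm x)\<^sup>2) ^ DIM('a) * decay_weight x)"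
      using mult_left_mono[OF decay_weight_lower[of x], of "cmod (?g y)"] by simp
    also have "\<dots> \<le> cmod (?g y) * ((3 * (1 + (norm y)\<^sup>2)) ^ DIM('a) * decay_weight x)"
      by (intro mult_left_mono mult_right_mono power_mono xy decay_weight_nonneg) auto
    also have "\<dots> = 3 ^ DIM('a) * ((1 + (norm y)\<^sup>2) ^ DIM('a) * cmod (?g y)) * decay_weight x"
      by (simp only: power_mult_distrib mult_ac)
    also have "\<dots> \<le> 3 ^ DIM('a) * C * decay_weight x"
      by (intro mult_left_mono mult_right_mono C(2) decay_weight_nonneg) auto
    finally show ?thesis unfolding y_def .
  qed
  have "cmod (f (x + h *\<^sub>R b) - f x) \<le> \<bar>h\<bar> * (3 ^ DIM('a) * C * decay_weight x)" if h: "\<bar>h\<bar> \<le> 1" for x h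
  proof -
    have "norm (f (x + h *\<^sub>R b) - f (x + 0 *\<^sub>R b)) \<le> (3 ^ DIM('a) * C * decay_weight x) * norm (h - 0)"
    proof (rule differentiable_bound[where S="{-1..1}" and f="\<lambda>s. f (x + s *\<^sub>R b)"])
      show "((\<lambda>s. f (x + s *\<^sub>R b)) has_derivative (\<lambda>k. k *\<^sub>R ?g (x + s *\<^sub>R b))) (at s within {-1..1})" for s
        by (rule schwartz_directional_derivative[OF f])
      show "onorm (\<lambda>k. k *\<^sub>R ?g (x + s *\<^sub>R b)) \<le> 3 ^ DIM('a) * C * decay_weight x" if "s \<in> {-1..1}" for s
      proof (rule onorm_le)
        fix k :: real
        have "cmod (?g (x + s *\<^sub>R b)) \<le> 3 ^ DIM('a) * C * decay_weight x" using that by (intro g) auto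
        from mult_left_mono[OF this, of "\<bar>k\<bar>"]
        show "norm (k *\<^sub>R ?g (x + s *\<^sub>R b)) \<le> (3 ^ DIM('a) * C * decay_weight x) * norm k"
          by (simp add: mult.commute)
      qed
    qed (use h in auto)
    then show ?thesis by (simp add: mult.commute)
  qed
  then show ?thesis using that by blast
qed

text \<open>Translation invariance replaces integration by parts. The integral of the difference
  quotient of \<open>f\<close> against the exponential equals the Fourier integral of \<open>f\<close> times a difference
  quotient of the exponential; then let the step tend to zero.\<close>

lemma fourier_ipd:
  fixes f :: "'a::euclidean_space \<Rightarrow> complex"
  assumes f: "f \<in> schwartz" and b: "b \<in> Basis"
  shows "fourier (ipd [b] f) \<xi> = \<i> * complex_of_real (\<xi> \<bullet> b) * fourier f \<xi>"
proof -
  let ?e = "\<lambda>x. exp (- \<i> * complex_of_real (x \<bullet> \<xi>))"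
  define h where "h = (\<lambda>n. 1 / real (Suc n))"
  let ?p = "\<lambda>n. exp (\<i> * complex_of_real (h n * (\<xi> \<bullet> b)))"
  define q where "q = (\<lambda>n x. ?e x * ((f (x + h n *\<^sub>R b) - f x) / complex_of_real (h n)))"
  have h: "0 < h n" "h n \<le> 1" for n by (auto simp: h_def)
  have h0: "h \<longlonglongrightarrow> 0" unfolding h_def by real_asymp
  have hne: "\<forall>\<^sub>F n in sequentially. h n \<noteq> 0" using h(1) by (auto intro!: always_eventually simp: less_imp_neq[THEN not_sym])
  have [measurable]: "f \<in> borel_measurable borel" by (rule schwartz_measurable[OF f])
  have f': "ipd [b] f \<in> schwartz" using ipd_schwartz[OF f, of "[b]"] b by simp
  have [measurable]: "ipd [b] f \<in> borel_measurable borel" by (rule schwartz_measurable[OF f'])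
  obtain C where C: "\<And>x h. \<bar>h\<bar> \<le> 1 \<Longrightarrow> cmod (f (x + h *\<^sub>R b) - f x) \<le> \<bar>h\<bar> * (C * decay_weight x)"
    using schwartz_difference_dominated[OF f b] by metis
  have lim1: "(\<lambda>n. \<integral>x. q n x \<partial>lborel) \<longlonglongrightarrow> (\<integral>x. ?e x * ipd [b] f x \<partial>lborel)"
  proof (rule integral_dominated_convergence[where w="\<lambda>x. C * decay_weight x"])
    show "integrable lborel (\<lambda>x. C * decay_weight x)"
      by (intro integrable_mult_right integrable_decay_weight)
    show "AE x in lborel. (\<lambda>n. q n x) \<longlonglongrightarrow> ?e x * ipd [b] f x"
    proof (rule AE_I2)
      fix x
      have "((\<lambda>s. f (x + s *\<^sub>R b)) has_vector_derivative ipd [b] f (x + 0 *\<^sub>R b)) (at 0)"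
        unfolding has_vector_derivative_def by (rule schwartz_directional_derivative[OF f])
      from vector_derivative_difference_quotient[OF this h0 h(1)]
      have "(\<lambda>n. (f (x + h n *\<^sub>R b) - f x) / complex_of_real (h n)) \<longlonglongrightarrow> ipd [b] f x"
        by (simp del: ipd.simps)
      then show "(\<lambda>n. q n x) \<longlonglongrightarrow> ?e x * ipd [b] f x"
        unfolding q_def by (rule tendsto_mult_left)
    qed
    show "AE x in lborel. norm (q n x) \<le> C * decay_weight x" for n
    proof (rule AE_I2)
      fix x
      show "norm (q n x) \<le> C * decay_weight x"
      proof -
        have "norm (q n x) = cmod (f (x + h n *\<^sub>R b) - f x) / h n"
          using h(1)[of n] by (simp add: q_def norm_mult norm_divide)
        also have "\<dots> \<le> C * decay_weight x"
          using C[of "h n" x] h[of n] by (simp add: pos_divide_le_eq mult.commute)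
        finally show ?thesis .
      qed
    qed
  qed (auto simp: q_def simp del: ipd.simps)
  have int: "integrable lborel (\<lambda>x. ?e x * f x)"
    by (intro fourier_integrable schwartz_integrable f)
  have sh: "?e x * f (x + h n *\<^sub>R b) = ?p n * (?e (x + h n *\<^sub>R b) * f (x + h n *\<^sub>R b))" for n x
    by (simp add: inner_add_left inner_commute[of b] exp_add[symmetric] algebra_simps)
  have tr: "(\<integral>x. ?e (x + h n *\<^sub>R b) * f (x + h n *\<^sub>R b) \<partial>lborel) = (\<integral>x. ?e x * f x \<partial>lborel)" for n
    by (rule integral_translate[where f="\<lambda>x. ?e x * f x"]) measurable
  have ints: "integrable lborel (\<lambda>x. ?e (x + h n *\<^sub>R b) * f (x + h n *\<^sub>R b))" for n
  proof -
    have "integrable (distr lborel borel ((+) (h n *\<^sub>R b))) (\<lambda>x. ?e x * f x)"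
      using int by (simp add: lborel_distr_plus)
    then show ?thesis by (subst (asm) integrable_distr_eq) (auto simp: add.commute)
  qed
  have "(\<integral>x. q n x \<partial>lborel) = (?p n - 1) / complex_of_real (h n) * (\<integral>x. ?e x * f x \<partial>lborel)" for n
  proof -
    have "(\<integral>x. q n x \<partial>lborel) = (\<integral>x. (?p n * (?e (x + h n *\<^sub>R b) * f (x + h n *\<^sub>R b)) - ?e x * f x) / complex_of_real (h n) \<partial>lborel)"
      unfolding q_def sh[symmetric] by (simp add: right_diff_distrib)
    also have "\<dots> = (?p n * (\<integral>x. ?e x * f x \<partial>lborel) - (\<integral>x. ?e x * f x \<partial>lborel)) / complex_of_real (h n)"
      by (simp only: integral_divide_zero Bochner_Integration.integral_diff[OF integrable_mult_right[OF ints] int] integral_mult_right_zero tr)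
    finally show ?thesis by (simp add: left_diff_distrib)
  qed
  moreover have "(\<lambda>n. (?p n - 1) / complex_of_real (h n)) \<longlonglongrightarrow> \<i> * complex_of_real (\<xi> \<bullet> b)"
  proof -
    have "((\<lambda>z. exp (\<i> * (z * complex_of_real (\<xi> \<bullet> b)))) has_field_derivative \<i> * complex_of_real (\<xi> \<bullet> b)) (at 0)"
      by (auto intro!: derivative_eq_intros)
    then have "(\<lambda>z. (exp (\<i> * (z * complex_of_real (\<xi> \<bullet> b))) - 1) / z) \<midarrow>0\<rightarrow> \<i> * complex_of_real (\<xi> \<bullet> b)"
      by (simp add: has_field_derivative_iff)
    moreover have "filterlim (\<lambda>n. complex_of_real (h n)) (at 0) sequentially"
      using tendsto_of_real[OF h0, where 'a=complex] hne by (simp add: filterlim_at)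
    ultimately show ?thesis using filterlim_compose by force
  qed
  ultimately have "(\<lambda>n. \<integral>x. q n x \<partial>lborel) \<longlonglongrightarrow> \<i> * complex_of_real (\<xi> \<bullet> b) * (\<integral>x. ?e x * f x \<partial>lborel)"
    by (simp only: tendsto_mult_right)
  then have "(\<integral>x. ?e x * ipd [b] f x \<partial>lborel) = \<i> * complex_of_real (\<xi> \<bullet> b) * (\<integral>x. ?e x * f x \<partial>lborel)"
    using lim1 LIMSEQ_unique by blast
  then show ?thesis unfolding fourier_def by simp
qed

lemma fourier_bounded:
  fixes f :: "'a::euclidean_space \<Rightarrow> complex"
  shows "cmod (fourier f \<xi>) \<le> (2 * pi) powr (- (real DIM('a) / 2)) * (\<integral>x. cmod (f x) \<partial>lborel)"
proof -
  have "cmod (\<integral>x. exp (- \<i> * complex_of_real (x \<bullet> \<xi>)) * f x \<partial>lborel)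
      \<le> (\<integral>x. cmod (exp (- \<i> * complex_of_real (x \<bullet> \<xi>)) * f x) \<partial>lborel)"
    by (rule integral_norm_bound)
  also have "\<dots> = (\<integral>x. cmod (f x) \<partial>lborel)" by (simp add: norm_mult)
  finally show ?thesis unfolding fourier_def norm_mult norm_of_real by (simp add: mult_left_mono)
qed

text \<open>Each factor \<open>norm \<xi>\<close> is traded for one derivative of \<open>f\<close>, which is again a Schwartz
  function.\<close>

lemma fourier_rapidly_decreasing:
  fixes f :: "'a::euclidean_space \<Rightarrow> complex"
  assumes "f \<in> schwartz"
  shows "rapidly_decreasing (fourier f)"
  unfolding rapidly_decreasing_def
proof
  fix k
  show "\<exists>C. \<forall>\<xi>. norm \<xi> ^ k * cmod (fourier f \<xi>) \<le> C"
    using assms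
  proof (induction k arbitrary: f)
    case 0
    then show ?case using fourier_bounded[of f] by auto
  next
    case (Suc k)
    have "\<exists>C. \<forall>\<xi>. norm \<xi> ^ k * cmod (fourier (ipd [b] f) \<xi>) \<le> C" if "b \<in> Basis" for b
      using Suc.IH[OF ipd_schwartz[OF Suc.prems, of "[b]"]] that by simp
    then obtain C where C: "\<And>b \<xi>. b \<in> Basis \<Longrightarrow> norm \<xi> ^ k * cmod (fourier (ipd [b] f) \<xi>) \<le> C b" by metis
    have "norm \<xi> ^ Suc k * cmod (fourier f \<xi>) \<le> (\<Sum>b\<in>Basis. C b)" for \<xi>
    proof -
      have "norm \<xi> ^ Suc k * cmod (fourier f \<xi>) \<le> norm \<xi> ^ k * ((\<Sum>b\<in>Basis. \<bar>\<xi> \<bullet> b\<bar>) * cmod (fourier f \<xi>))"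
      proof -
        have "norm \<xi> * cmod (fourier f \<xi>) \<le> (\<Sum>b\<in>Basis. \<bar>\<xi> \<bullet> b\<bar>) * cmod (fourier f \<xi>)"
          by (intro mult_right_mono norm_le_l1) simp
        from mult_left_mono[OF this, of "norm \<xi> ^ k"] show ?thesis by (simp add: mult_ac)
      qed
      also have "\<dots> = (\<Sum>b\<in>Basis. norm \<xi> ^ k * cmod (fourier (ipd [b] f) \<xi>))"
        unfolding sum_distrib_left sum_distrib_right
        by (rule sum.cong) (auto simp del: ipd.simps simp: fourier_ipd[OF Suc.prems] norm_mult)
      also have "\<dots> \<le> (\<Sum>b\<in>Basis. C b)" by (rule sum_mono) (rule C)
      finally show ?thesis .
    qed
    then show ?case by blast
  qed
qed

section \<open>Injectivity of the Fourier transform\<close>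

lemma gaussian_fourier:
  "(\<integral>x. exp (- \<i> * complex_of_real (t * x)) * complex_of_real (exp (- x\<^sup>2 / 2)) \<partial>lborel)
    = complex_of_real (sqrt (2 * pi) * exp (- t\<^sup>2 / 2))"
  and gaussian_integrable:
  "integrable lborel (\<lambda>x. exp (- \<i> * complex_of_real (t * x)) * complex_of_real (exp (- x\<^sup>2 / 2)))"
  and gaussian_integrable_real: "integrable lborel (\<lambda>x::real. exp (- x\<^sup>2 / 2))"
proof -
  have i0: "integrable lborel std_normal_density"
    using integrable_std_normal_moment[of 0] by simp
  have d: "exp (- x\<^sup>2 / 2) = sqrt (2 * pi) * std_normal_density x" for x
    by (simp add: std_normal_density_def)
  show i1: "integrable lborel (\<lambda>x::real. exp (- x\<^sup>2 / 2))"
    unfolding d by (rule integrable_mult_right[OF i0])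
  show "integrable lborel (\<lambda>x. exp (- \<i> * complex_of_real (t * x)) * complex_of_real (exp (- x\<^sup>2 / 2)))"
    by (rule Bochner_Integration.integrable_bound[OF i1]) (auto simp: norm_mult)
  have "(\<integral>x. iexp ((-t) * x) \<partial>std_normal_distribution) = complex_of_real (exp (- (-t)\<^sup>2 / 2))"
    using fun_cong[OF char_std_normal_distribution, of "-t"] by (simp add: char_def)
  then have "(\<integral>x. std_normal_density x *\<^sub>R iexp ((-t) * x) \<partial>lborel) = complex_of_real (exp (- t\<^sup>2 / 2))"
    by (subst (asm) integral_density) auto
  then have "complex_of_real (sqrt (2 * pi)) * (\<integral>x. std_normal_density x *\<^sub>R iexp ((-t) * x) \<partial>lborel)
     = complex_of_real (sqrt (2 * pi) * exp (- t\<^sup>2 / 2))" by simp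
  then have "(\<integral>x. complex_of_real (sqrt (2 * pi)) * (std_normal_density x *\<^sub>R iexp ((-t) * x)) \<partial>lborel)
     = complex_of_real (sqrt (2 * pi) * exp (- t\<^sup>2 / 2))" by (simp only: integral_mult_right_zero)
  then show "(\<integral>x. exp (- \<i> * complex_of_real (t * x)) * complex_of_real (exp (- x\<^sup>2 / 2)) \<partial>lborel)
    = complex_of_real (sqrt (2 * pi) * exp (- t\<^sup>2 / 2))"
    unfolding d by (simp add: scaleR_conv_of_real mult_ac)
qed

lemma norm_sq_Basis: "(norm (x::'a::euclidean_space))\<^sup>2 = (\<Sum>b\<in>Basis. (x \<bullet> b)\<^sup>2)"
  by (subst power2_norm_eq_inner, subst euclidean_inner) (simp add: power2_eq_square)

lemma exp_norm_sq_Basis: "exp (- (norm (x::'a::euclidean_space))\<^sup>2 / 2) = (\<Prod>b\<in>Basis. exp (- (x \<bullet> b)\<^sup>2 / 2))"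
  by (simp add: norm_sq_Basis exp_sum[symmetric] sum_negf sum_divide_distrib)

lemma gaussian_integrable_euclidean:
  "integrable lborel (\<lambda>x::'a::euclidean_space. exp (- (norm x)\<^sup>2 / 2))"
  unfolding exp_norm_sq_Basis by (rule integrable_prod_Basis) (rule gaussian_integrable_real)

lemma gaussian_fourier_euclidean:
  fixes \<xi> :: "'a::euclidean_space"
  shows "(\<integral>x. exp (- \<i> * complex_of_real (\<xi> \<bullet> x)) * complex_of_real (exp (- (norm x)\<^sup>2 / 2)) \<partial>lborel)
    = complex_of_real (sqrt (2 * pi) ^ DIM('a) * exp (- (norm \<xi>)\<^sup>2 / 2))"
proof -
  have "exp (- \<i> * complex_of_real (\<xi> \<bullet> x)) * complex_of_real (exp (- (norm x)\<^sup>2 / 2))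
    = (\<Prod>b\<in>Basis. exp (- \<i> * complex_of_real ((\<xi> \<bullet> b) * (x \<bullet> b))) * complex_of_real (exp (- (x \<bullet> b)\<^sup>2 / 2)))" for x
  proof -
    have "exp (- \<i> * complex_of_real (\<xi> \<bullet> x)) = (\<Prod>b\<in>Basis. exp (- \<i> * complex_of_real ((\<xi> \<bullet> b) * (x \<bullet> b))))"
      by (subst euclidean_inner) (simp add: exp_sum[symmetric] sum_distrib_left sum_negf)
    then show ?thesis by (simp only: exp_norm_sq_Basis prod.distrib of_real_prod)
  qed
  then have "(\<integral>x. exp (- \<i> * complex_of_real (\<xi> \<bullet> x)) * complex_of_real (exp (- (norm x)\<^sup>2 / 2)) \<partial>lborel)
    = (\<Prod>b\<in>Basis. complex_of_real (sqrt (2 * pi) * exp (- (\<xi> \<bullet> b)\<^sup>2 / 2)))"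
    by (simp only: integral_prod_Basis[OF gaussian_integrable] gaussian_fourier)
  also have "\<dots> = complex_of_real (\<Prod>b\<in>(Basis::'a set). sqrt (2 * pi) * exp (- (\<xi> \<bullet> b)\<^sup>2 / 2))"
    by (simp only: of_real_prod)
  finally show ?thesis unfolding prod.distrib exp_norm_sq_Basis by simp
qed

text \<open>The Gaussian is, up to a constant, its own Fourier transform, so the transform can be moved
  from the Gaussian to \<open>f\<close> by Fubini's theorem.\<close>

lemma fourier_zero_gaussian:
  fixes f :: "'a::euclidean_space \<Rightarrow> complex"
  assumes f: "integrable lborel f"
    and z: "\<And>\<xi>. (\<integral>x. exp (- \<i> * complex_of_real (x \<bullet> \<xi>)) * f x \<partial>lborel) = 0"
  shows "(\<integral>x. f x * complex_of_real (exp (- (norm x)\<^sup>2 / 2)) \<partial>lborel) = 0"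
proof -
  let ?G = "\<lambda>x::'a. exp (- (norm x)\<^sup>2 / 2)"
  have [measurable]: "f \<in> borel_measurable borel" using borel_measurable_integrable[OF f] by simp
  let ?F = "\<lambda>x \<xi>. exp (- \<i> * complex_of_real (x \<bullet> \<xi>)) * f x * complex_of_real (?G \<xi>)"
  have "integrable (lborel \<Otimes>\<^sub>M lborel) (\<lambda>(x, \<xi>). f x * complex_of_real (?G \<xi>))"
    by (intro integrable_pair_product f integrable_of_real gaussian_integrable_euclidean)
  then have int: "integrable (lborel \<Otimes>\<^sub>M lborel) (\<lambda>(x, \<xi>). ?F x \<xi>)"
    by (rule Bochner_Integration.integrable_bound) (auto simp: norm_mult)
  have "0 = (\<integral>\<xi>. (\<integral>x. ?F x \<xi> \<partial>lborel) \<partial>lborel)"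
    using z by simp
  also have "\<dots> = (\<integral>x. (\<integral>\<xi>. ?F x \<xi> \<partial>lborel) \<partial>lborel)"
    by (rule lborel_pair.Fubini_integral[OF int])
  also have "\<dots> = (\<integral>x. f x * complex_of_real (sqrt (2 * pi) ^ DIM('a) * ?G x) \<partial>lborel)"
  proof (rule Bochner_Integration.integral_cong[OF refl])
    fix x
    have "(\<integral>\<xi>. ?F x \<xi> \<partial>lborel) = (\<integral>\<xi>. f x * (exp (- \<i> * complex_of_real (x \<bullet> \<xi>)) * complex_of_real (?G \<xi>)) \<partial>lborel)"
      by (simp add: mult_ac)
    then show "(\<integral>\<xi>. ?F x \<xi> \<partial>lborel) = f x * complex_of_real (sqrt (2 * pi) ^ DIM('a) * ?G x)"
      by (simp only: integral_mult_right_zero gaussian_fourier_euclidean)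
  qed
  also have "\<dots> = (\<integral>x. complex_of_real (sqrt (2 * pi) ^ DIM('a)) * (f x * complex_of_real (?G x)) \<partial>lborel)"
    by (simp add: mult_ac)
  finally have "complex_of_real (sqrt (2 * pi) ^ DIM('a)) * (\<integral>x. f x * complex_of_real (?G x) \<partial>lborel) = 0"
    by (simp only: integral_mult_right_zero)
  then show ?thesis by simp
qed

lemma lborel_scale_shift:
  fixes f :: "'a::euclidean_space \<Rightarrow> complex"
  assumes "integrable lborel f" "0 < c"
  shows "integrable lborel (\<lambda>x. f (t + c *\<^sub>R x))"
    and "(\<integral>x. f x \<partial>lborel) = c ^ DIM('a) *\<^sub>R (\<integral>x. f (t + c *\<^sub>R x) \<partial>lborel)"
proof -
  have [measurable]: "f \<in> borel_measurable borel" using borel_measurable_integrable[OF assms(1)] by simp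
  have D: "lborel = density (distr lborel borel (\<lambda>x. t + c *\<^sub>R x)) (\<lambda>_. ennreal (c ^ DIM('a)))"
    using lborel_affine[of c t] assms(2) by (simp add: ennreal_power)
  have "integrable (density (distr lborel borel (\<lambda>x. t + c *\<^sub>R x)) (\<lambda>_. ennreal (c ^ DIM('a)))) f"
    using assms(1) D by simp
  then have "integrable (distr lborel borel (\<lambda>x. t + c *\<^sub>R x)) (\<lambda>x. c ^ DIM('a) *\<^sub>R f x)"
    using assms(2) by (subst (asm) integrable_density) auto
  then have "integrable lborel (\<lambda>x. c ^ DIM('a) *\<^sub>R f (t + c *\<^sub>R x))"
    by (subst (asm) integrable_distr_eq) auto
  from integrable_scaleR_right[OF this, of "inverse (c ^ DIM('a))"]
  show "integrable lborel (\<lambda>x. f (t + c *\<^sub>R x))"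
    using assms(2) by simp
  have "(\<integral>x. f x \<partial>lborel) = (\<integral>x. f x \<partial>(density (distr lborel borel (\<lambda>x. t + c *\<^sub>R x)) (\<lambda>_. ennreal (c ^ DIM('a)))))"
    using D by simp
  also have "\<dots> = (\<integral>x. c ^ DIM('a) *\<^sub>R f x \<partial>(distr lborel borel (\<lambda>x. t + c *\<^sub>R x)))"
    using assms(2) by (subst integral_density) auto
  also have "\<dots> = (\<integral>x. c ^ DIM('a) *\<^sub>R f (t + c *\<^sub>R x) \<partial>lborel)"
    by (subst integral_distr) auto
  finally show "(\<integral>x. f x \<partial>lborel) = c ^ DIM('a) *\<^sub>R (\<integral>x. f (t + c *\<^sub>R x) \<partial>lborel)" by simp
qed

text \<open>The rescaled functions \<open>f (y + c x)\<close> have vanishing Fourier transforms too, so their Gaussian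
  means are zero. As \<open>c\<close> tends to zero these means tend to \<open>f y\<close> times the mass of the Gaussian.\<close>

lemma fourier_injective:
  fixes f :: "'a::euclidean_space \<Rightarrow> complex"
  assumes f: "f \<in> schwartz" and z: "\<And>\<xi>. fourier f \<xi> = 0"
  shows "f y = 0"
proof -
  let ?G = "\<lambda>x::'a. exp (- (norm x)\<^sup>2 / 2)"
  have int: "integrable lborel f" by (rule schwartz_integrable[OF f])
  have [measurable]: "f \<in> borel_measurable borel" by (rule schwartz_measurable[OF f])
  have z': "(\<integral>x. exp (- \<i> * complex_of_real (x \<bullet> \<xi>)) * f x \<partial>lborel) = 0" for \<xi>
    using z[of \<xi>] unfolding fourier_def by simp
  have zero: "(\<integral>x. f (y + c *\<^sub>R x) * complex_of_real (?G x) \<partial>lborel) = 0" if c: "0 < c" for c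
  proof (rule fourier_zero_gaussian)
    show "integrable lborel (\<lambda>x. f (y + c *\<^sub>R x))" by (rule lborel_scale_shift[OF int c])
    fix \<xi> :: 'a
    let ?\<eta> = "(1 / c) *\<^sub>R \<xi>"
    have "0 = (\<integral>x. exp (- \<i> * complex_of_real (x \<bullet> ?\<eta>)) * f x \<partial>lborel)" by (simp only: z')
    also have "\<dots> = c ^ DIM('a) *\<^sub>R (\<integral>x. exp (- \<i> * complex_of_real ((y + c *\<^sub>R x) \<bullet> ?\<eta>)) * f (y + c *\<^sub>R x) \<partial>lborel)"
      by (rule lborel_scale_shift(2)[OF fourier_integrable[OF int] c])
    also have "\<dots> = c ^ DIM('a) *\<^sub>R (\<integral>x. exp (- \<i> * complex_of_real (y \<bullet> ?\<eta>)) * (exp (- \<i> * complex_of_real (x \<bullet> \<xi>)) * f (y + c *\<^sub>R x)) \<partial>lborel)"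
      using c by (simp add: inner_add_left exp_add[symmetric] algebra_simps)
    also have "\<dots> = c ^ DIM('a) *\<^sub>R (exp (- \<i> * complex_of_real (y \<bullet> ?\<eta>)) * (\<integral>x. exp (- \<i> * complex_of_real (x \<bullet> \<xi>)) * f (y + c *\<^sub>R x) \<partial>lborel))"
      by (simp only: integral_mult_right_zero)
    finally show "(\<integral>x. exp (- \<i> * complex_of_real (x \<bullet> \<xi>)) * f (y + c *\<^sub>R x) \<partial>lborel) = 0"
      using c by simp
  qed
  obtain C where C: "\<And>x. norm x ^ 0 * cmod (f x) \<le> C"
    using schwartz_rapidly_decreasing[OF f] unfolding rapidly_decreasing_def by blast
  have "(\<lambda>n. \<integral>x. f (y + (1 / real (Suc n)) *\<^sub>R x) * complex_of_real (?G x) \<partial>lborel)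
     \<longlonglongrightarrow> (\<integral>x. f (y + 0 *\<^sub>R x) * complex_of_real (?G x) \<partial>lborel)"
  proof (rule integral_dominated_convergence[where w="\<lambda>x. C * ?G x"])
    show "integrable lborel (\<lambda>x. C * ?G x)"
      by (intro integrable_mult_right gaussian_integrable_euclidean)
    show "AE x in lborel. (\<lambda>n. f (y + (1 / real (Suc n)) *\<^sub>R x) * complex_of_real (?G x))
        \<longlonglongrightarrow> f (y + 0 *\<^sub>R x) * complex_of_real (?G x)"
    proof (rule AE_I2)
      fix x
      have "isCont f (y + 0 *\<^sub>R x)"
        using schwartz_differentiable[OF f] differentiable_imp_continuous_within by blast
      moreover have "(\<lambda>n. y + (1 / real (Suc n)) *\<^sub>R x) \<longlonglongrightarrow> y + 0 *\<^sub>R x"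
        by (intro tendsto_intros) real_asymp
      ultimately have "(\<lambda>n. f (y + (1 / real (Suc n)) *\<^sub>R x)) \<longlonglongrightarrow> f (y + 0 *\<^sub>R x)"
        by (rule isCont_tendsto_compose)
      then show "(\<lambda>n. f (y + (1 / real (Suc n)) *\<^sub>R x) * complex_of_real (?G x)) \<longlonglongrightarrow> f (y + 0 *\<^sub>R x) * complex_of_real (?G x)"
        by (rule tendsto_mult_right)
    qed
    show "AE x in lborel. norm (f (y + (1 / real (Suc n)) *\<^sub>R x) * complex_of_real (?G x)) \<le> C * ?G x" for n
      using C by (auto simp: norm_mult)
  qed measurable
  then have "(\<integral>x. f y * complex_of_real (?G x) \<partial>lborel) = 0"
    using zero by (simp add: LIMSEQ_const_iff)
  then have "f y * (\<integral>x. complex_of_real (?G x) \<partial>lborel) = 0" by (simp only: integral_mult_right_zero)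
  moreover have "(\<integral>x. complex_of_real (?G x) \<partial>lborel) = complex_of_real (sqrt (2 * pi) ^ DIM('a))"
    using gaussian_fourier_euclidean[of "0::'a"] by simp
  moreover have "complex_of_real (sqrt (2 * pi) ^ DIM('a)) \<noteq> 0" by simp
  ultimately show ?thesis by (metis mult_eq_0_iff)
qed

section \<open>The Mittag-Leffler function and its Laplace transform\<close>

text \<open>Restrict Euler's integral to \<open>t \<ge> A\<close>, where \<open>t powr x \<ge> A powr x\<close>. As \<open>A\<close> is arbitrary,
  \<open>Gamma (\<alpha> * n + 1)\<close> outgrows every geometric sequence.\<close>

lemma Gamma_lower_bound:
  fixes A x :: real
  assumes "0 < A" "0 \<le> x"
  shows "A powr x * exp (- A) \<le> Gamma (x + 1)"
proof -
  have G: "((\<lambda>t. t powr x / exp t) has_integral Gamma (x + 1)) {0..}"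
    using Gamma_integral_real[of "x + 1"] assms by simp
  have "((\<lambda>t. exp (- 1 * t)) has_integral exp (- 1 * A) / 1) {A..}"
    by (rule has_integral_exp_minus_to_infinity) simp
  from has_integral_mult_right[OF this, of "A powr x"]
  have "((\<lambda>t. A powr x * exp (- t)) has_integral A powr x * exp (- A)) {A..}" by simp
  then have E: "((\<lambda>t. if t \<in> {A..} then A powr x * exp (- t) else 0) has_integral A powr x * exp (- A)) {0..}"
    using assms by (subst has_integral_restrict) auto
  show ?thesis
    by (rule has_integral_le[OF E G])
      (use assms in \<open>auto simp: exp_minus field_simps intro!: powr_mono2\<close>)
qed

lemma mittag_leffler_summable:
  fixes z :: complex
  assumes "0 < \<alpha>"
  shows "summable (\<lambda>n. z ^ n / complex_of_real (Gamma (\<alpha> * real n + 1)))"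
proof -
  define r where "r = norm z"
  \<comment> \<open>Chosen so that the ratio of the geometric majorant is below one half.\<close>
  define A where "A = (2 * (r + 1)) powr (1 / \<alpha>)"
  have r: "0 \<le> r" by (simp add: r_def)
  have A: "0 < A" using r by (simp add: A_def)
  have AA: "A powr (\<alpha> * real n) = (2 * (r + 1)) ^ n" for n
    using assms r by (simp add: A_def powr_powr powr_realpow)
  show ?thesis
  proof (rule summable_comparison_test)
    show "summable (\<lambda>n. exp A * (r / (2 * (r + 1))) ^ n)"
      using r by (intro summable_mult summable_geometric) (auto simp: field_simps)
    show "\<exists>N. \<forall>n\<ge>N. norm (z ^ n / complex_of_real (Gamma (\<alpha> * real n + 1))) \<le> exp A * (r / (2 * (r + 1))) ^ n"
    proof (intro exI allI impI)
      fix n :: nat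
      have B: "(2 * (r + 1)) ^ n * exp (- A) \<le> Gamma (\<alpha> * real n + 1)"
        using Gamma_lower_bound[OF A, of "\<alpha> * real n"] assms by (simp add: AA)
      have P: "0 < (2 * (r + 1)) ^ n * exp (- A)" using r by simp
      have GP: "0 < Gamma (\<alpha> * real n + 1)" using B P by linarith
      have "norm (z ^ n / complex_of_real (Gamma (\<alpha> * real n + 1))) = r ^ n / Gamma (\<alpha> * real n + 1)"
        using GP by (simp add: norm_divide norm_power r_def)
      also have "\<dots> \<le> r ^ n / ((2 * (r + 1)) ^ n * exp (- A))"
        using B P GP r by (intro divide_left_mono mult_pos_pos) auto
      also have "\<dots> = exp A * (r / (2 * (r + 1))) ^ n"
        by (simp add: power_divide exp_minus field_simps)
      finally show "norm (z ^ n / complex_of_real (Gamma (\<alpha> * real n + 1))) \<le> exp A * (r / (2 * (r + 1))) ^ n" .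
    qed
  qed
qed

lemma mittag_leffler_holomorphic:
  assumes "0 < \<alpha>"
  shows "mittag_leffler \<alpha> 1 holomorphic_on UNIV"
proof -
  let ?c = "\<lambda>n. 1 / complex_of_real (Gamma (\<alpha> * real n + 1))"
  have "summable (\<lambda>n. ?c n * z ^ n)" for z
    using mittag_leffler_summable[OF assms, of z] by simp
  then have "((\<lambda>z. \<Sum>n. ?c n * z ^ n) has_field_derivative (\<Sum>n. diffs ?c n * z ^ n)) (at z)" for z
    by (rule termdiffs_strong_converges_everywhere)
  moreover have "mittag_leffler \<alpha> 1 = (\<lambda>z. \<Sum>n. ?c n * z ^ n)"
    by (simp add: mittag_leffler_def fun_eq_iff)
  ultimately show ?thesis
    unfolding holomorphic_on_def field_differentiable_def by (metis has_field_derivative_at_within)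
qed

lemma mittag_leffler_deriv:
  assumes "0 < \<alpha>"
  shows "(mittag_leffler \<alpha> 1 has_field_derivative deriv (mittag_leffler \<alpha> 1) z) (at z)"
  using mittag_leffler_holomorphic[OF assms] holomorphic_derivI by blast

lemma mittag_leffler_continuous:
  assumes "0 < \<alpha>"
  shows "continuous_on S (mittag_leffler \<alpha> 1)" "continuous_on S (deriv (mittag_leffler \<alpha> 1))"
  using mittag_leffler_holomorphic[OF assms] holomorphic_deriv[OF mittag_leffler_holomorphic[OF assms] open_UNIV]
  by (auto intro: holomorphic_on_imp_continuous_on continuous_on_subset)

lemma mittag_leffler_one: "mittag_leffler 1 1 z = exp z"
proof -
  have "Gamma (real n + 1) = fact n" for n
    using Gamma_fact[of n, where 'a=real] by (simp add: add.commute)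
  then show ?thesis by (simp add: mittag_leffler_def exp_def scaleR_conv_of_real divide_inverse mult.commute)
qed

lemma has_bochner_integral_Gamma:
  fixes a s :: real
  assumes "0 \<le> a" "0 < s"
  shows "has_bochner_integral lborel (\<lambda>t. indicator {0<..} t *\<^sub>R (t powr a * exp (- (s * t)))) (Gamma (a + 1) / s powr (a + 1))"
proof -
  have "has_bochner_integral lborel (\<lambda>t. indicator {0..} t * t powr a / exp t) (Gamma (a + 1))"
  proof (rule has_bochner_integral_nn_integral)
    show "integral\<^sup>N lborel (\<lambda>t. ennreal (indicator {0..} t * t powr a / exp t)) = ennreal (Gamma (a + 1))"
      using Gamma_conv_nn_integral_real[of "a + 1"] assms by simp
    show "0 \<le> Gamma (a + 1)" using Gamma_real_pos[of "a+1"] assms by simp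
  qed (auto simp: indicator_def)
  then have 0: "has_bochner_integral lborel (\<lambda>t. indicator {0..} (0 + s * t) * (0 + s * t) powr a / exp (0 + s * t)) (Gamma (a + 1) /\<^sub>R \<bar>s\<bar>)"
    using assms by (subst (asm) lborel_has_bochner_integral_real_affine_iff[of s _ _ 0]) auto
  have 1: "has_bochner_integral lborel (\<lambda>t. 1 / s powr a * (indicator {0..} (0 + s * t) * (0 + s * t) powr a / exp (0 + s * t)))
      (1 / s powr a * (Gamma (a + 1) /\<^sub>R \<bar>s\<bar>))"
    by (rule has_bochner_integral_mult_right) (rule 0)
  have 2: "1 / s powr a * (Gamma (a + 1) /\<^sub>R \<bar>s\<bar>) = Gamma (a + 1) / s powr (a + 1)"
    using assms by (simp add: powr_add divide_inverse)
  have 3: "AE t in lborel. 1 / s powr a * (indicator {0..} (0 + s * t) * (0 + s * t) powr a / exp (0 + s * t))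
     = indicator {0<..} t *\<^sub>R (t powr a * exp (- (s * t)))"
    using AE_lborel_singleton[of "0::real"]
  proof eventually_elim
    case (elim t)
    then show ?case
      using assms by (auto simp: indicator_def powr_mult exp_minus divide_inverse zero_le_mult_iff)
  qed
  show ?thesis
    using 1 unfolding 2 by (subst (asm) has_bochner_integral_cong_AE[OF _ _ 3]) auto
qed

text \<open>Termwise integration turns the Mittag-Leffler series into a geometric series, which converges
  because \<open>cmod c < s powr \<alpha>\<close>.\<close>

lemma mittag_leffler_laplace:
  fixes c :: complex
  assumes a: "0 < \<alpha>" and s: "1 < s" and c: "cmod c \<le> 1"
  shows "has_bochner_integral lborel
     (\<lambda>t. indicator {0<..} t *\<^sub>R (exp (- complex_of_real (s * t)) * mittag_leffler \<alpha> 1 (c * complex_of_real (t powr \<alpha>))))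
     (complex_of_real (s powr (\<alpha> - 1)) / (complex_of_real (s powr \<alpha>) - c))"
proof -
  let ?G = "\<lambda>n. complex_of_real (Gamma (\<alpha> * real n + 1))"
  define f where "f = (\<lambda>n t. indicator {0<..} t *\<^sub>R (exp (- complex_of_real (s * t)) *
     ((c * complex_of_real (t powr \<alpha>)) ^ n / ?G n)))"
  have Gp: "0 < Gamma (\<alpha> * real n + 1)" for n using a by (intro Gamma_real_pos) (simp add: add_nonneg_pos)
  have f: "f n t = (c ^ n / ?G n) *
      complex_of_real (indicator {0<..} t *\<^sub>R (t powr (\<alpha> * real n) * exp (- (s * t))))" for n t
  proof (cases "0 < t")
    case True
    have e: "exp (- complex_of_real (s * t)) = complex_of_real (exp (- (s * t)))"
      by (metis exp_of_real of_real_minus)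
    have p: "(t powr \<alpha>) ^ n = t powr (\<alpha> * real n)"
      using True by (simp add: powr_powr[symmetric] powr_realpow)
    show ?thesis using True
      unfolding f_def e power_mult_distrib of_real_power[symmetric] p by simp
  qed (simp add: f_def)
  have g: "has_bochner_integral lborel (\<lambda>t. indicator {0<..} t *\<^sub>R (t powr (\<alpha> * real n) * exp (- (s * t))))
     (Gamma (\<alpha> * real n + 1) / s powr (\<alpha> * real n + 1))" for n
    using has_bochner_integral_Gamma[of "\<alpha> * real n" s] a s by simp
  have sp: "s powr (\<alpha> * real n + 1) = (s powr \<alpha>) ^ n * s" for n
    using s by (simp add: powr_add powr_powr[symmetric] powr_realpow)
  have hf: "has_bochner_integral lborel (f n) ((c / complex_of_real (s powr \<alpha>)) ^ n / complex_of_real s)" for n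
  proof -
    have "has_bochner_integral lborel (f n) ((c ^ n / ?G n) * complex_of_real (Gamma (\<alpha> * real n + 1) / s powr (\<alpha> * real n + 1)))"
      unfolding f by (intro has_bochner_integral_mult_right has_bochner_integral_of_real g)
    also have "(c ^ n / ?G n) * complex_of_real (Gamma (\<alpha> * real n + 1) / s powr (\<alpha> * real n + 1))
      = (c / complex_of_real (s powr \<alpha>)) ^ n / complex_of_real s"
      using Gp[of n] s by (simp add: sp power_divide)
    finally show ?thesis .
  qed
  have sa: "1 < s powr \<alpha>" using a s by simp
  have nf: "(\<integral>t. norm (f n t) \<partial>lborel) \<le> (1 / s powr \<alpha>) ^ n" for n
  proof -
    have "norm (f n t) = (cmod c ^ n / Gamma (\<alpha> * real n + 1)) * (indicator {0<..} t *\<^sub>R (t powr (\<alpha> * real n) * exp (- (s * t))))" for t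
      unfolding f using Gp[of n] by (auto simp: norm_mult norm_divide norm_power indicator_def)
    then have "(\<integral>t. norm (f n t) \<partial>lborel) = (cmod c ^ n / Gamma (\<alpha> * real n + 1)) * (Gamma (\<alpha> * real n + 1) / s powr (\<alpha> * real n + 1))"
      using has_bochner_integral_integral_eq[OF g[of n]] by (simp only: integral_mult_right_zero)
    also have "\<dots> = cmod c ^ n * ((1 / s powr \<alpha>) ^ n / s)"
      using Gp[of n] by (simp add: sp power_divide)
    also have "\<dots> \<le> 1 * ((1 / s powr \<alpha>) ^ n / 1)"
      using s c by (intro mult_mono divide_left_mono power_le_one) auto
    finally show ?thesis by simp
  qed
  have i: "integrable lborel (f n)" for n using hf has_bochner_integral_iff by blast
  have sm: "AE t in lborel. summable (\<lambda>n. norm (f n t))"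
  proof (rule AE_I2)
    fix t :: real
    have "summable (\<lambda>n. norm (complex_of_real (cmod c * t powr \<alpha>) ^ n / ?G n))"
    proof (rule summable_cong[THEN iffD1, OF always_eventually])
      show "summable (\<lambda>n. Re (complex_of_real (cmod c * t powr \<alpha>) ^ n / ?G n))"
        by (rule summable_Re[OF mittag_leffler_summable[OF a]])
      show "\<forall>n. Re (complex_of_real (cmod c * t powr \<alpha>) ^ n / ?G n)
         = norm (complex_of_real (cmod c * t powr \<alpha>) ^ n / ?G n)"
        using Gp by (simp add: norm_divide norm_power norm_mult less_imp_le flip: of_real_power of_real_divide of_real_mult)
    qed
    then have "summable (\<lambda>n. indicator {0<..} t * exp (- (s * t)) * norm (complex_of_real (cmod c * t powr \<alpha>) ^ n / ?G n))"
      by (rule summable_mult)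
    moreover have "norm (f n t) = indicator {0<..} t * exp (- (s * t)) * norm (complex_of_real (cmod c * t powr \<alpha>) ^ n / ?G n)" for n
      using Gp[of n] by (simp add: f_def norm_mult norm_divide norm_power power_mult_distrib)
    ultimately show "summable (\<lambda>n. norm (f n t))" by simp
  qed
  have ss: "summable (\<lambda>n. \<integral>t. norm (f n t) \<partial>lborel)"
  proof (rule summable_comparison_test)
    show "summable (\<lambda>n. (1 / s powr \<alpha>) ^ n)" using sa by (intro summable_geometric) (auto simp: divide_less_eq)
    show "\<exists>N. \<forall>n\<ge>N. norm (\<integral>t. norm (f n t) \<partial>lborel) \<le> (1 / s powr \<alpha>) ^ n"
      using nf by (auto simp: abs_of_nonneg integral_nonneg_AE)
  qed
  have S: "(\<Sum>n. f n t) = indicator {0<..} t *\<^sub>R (exp (- complex_of_real (s * t)) * mittag_leffler \<alpha> 1 (c * complex_of_real (t powr \<alpha>)))" for t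
    unfolding f_def mittag_leffler_def
    by (subst suminf_scaleR_right[symmetric], (intro summable_mult mittag_leffler_summable a)?,
        subst suminf_mult[symmetric], (intro mittag_leffler_summable a)?, simp)
  have "(\<lambda>n. integral\<^sup>L lborel (f n)) sums (\<integral>t. (\<Sum>n. f n t) \<partial>lborel)"
    by (rule sums_integral[OF i sm ss])
  moreover have "integral\<^sup>L lborel (f n) = (c / complex_of_real (s powr \<alpha>)) ^ n / complex_of_real s" for n
    by (rule has_bochner_integral_integral_eq[OF hf])
  moreover have "(\<lambda>n. (c / complex_of_real (s powr \<alpha>)) ^ n / complex_of_real s) sums (1 / (1 - c / complex_of_real (s powr \<alpha>)) / complex_of_real s)"
    using c sa by (intro sums_divide geometric_sums) (auto simp: norm_divide divide_less_eq)
  ultimately have "(\<integral>t. (\<Sum>n. f n t) \<partial>lborel) = 1 / (1 - c / complex_of_real (s powr \<alpha>)) / complex_of_real s"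
    using sums_unique2 by auto
  also have "\<dots> = complex_of_real (s powr (\<alpha> - 1)) / (complex_of_real (s powr \<alpha>) - c)"
  proof -
    have "complex_of_real (s powr \<alpha>) - c \<noteq> 0"
    proof
      assume "complex_of_real (s powr \<alpha>) - c = 0"
      then have "norm c = s powr \<alpha>" by (metis abs_of_nonneg eq_iff_diff_eq_0 norm_of_real powr_ge_zero)
      then show False using sa c by simp
    qed
    then show ?thesis using s sa by (simp add: powr_diff field_simps)
  qed
  finally show ?thesis
    unfolding has_bochner_integral_iff S[symmetric] using integrable_suminf[OF i sm ss] by simp
qed

section \<open>Uniqueness for the Laplace transform\<close>

text \<open>Integer points suffice: under \<open>x = exp (-t)\<close> the transforms at integers are moments on the
  unit interval, so by Weierstrass' theorem \<open>exp (-2 t) g t\<close> integrates to zero against every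
  continuous function of \<open>exp (-t)\<close>, in particular against a tent around a given point.\<close>

lemma laplace_unique:
  fixes g :: "real \<Rightarrow> complex"
  assumes cont: "continuous_on {0<..} g"
    and L: "\<And>n::nat. 2 \<le> n \<Longrightarrow> has_bochner_integral lborel (\<lambda>t. indicator {0<..} t *\<^sub>R (exp (- complex_of_real (real n * t)) * g t)) 0"
    and t0: "0 < t0"
  shows "g t0 = 0"
proof (rule ccontr)
  assume g0: "g t0 \<noteq> 0"
  define h where "h = (\<lambda>t. indicator {0<..} t *\<^sub>R (exp (- complex_of_real (real 2 * t)) * g t))"
  have h: "integrable lborel h" using L[of 2] unfolding h_def has_bochner_integral_iff by simp
  then have [measurable]: "h \<in> borel_measurable borel" using borel_measurable_integrable[OF h] by simp
  have hn: "has_bochner_integral lborel (\<lambda>t. complex_of_real (exp (-t) ^ n) * h t) 0" for n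
  proof -
    have "complex_of_real (exp (-t) ^ n) * h t = indicator {0<..} t *\<^sub>R (exp (- complex_of_real (real (n + 2) * t)) * g t)" for t
      by (simp add: h_def exp_of_nat_mult[symmetric] exp_of_real[symmetric] exp_add[symmetric] algebra_simps
          flip: of_real_power)
    then show ?thesis using L[of "n + 2"] by simp
  qed
  let ?I = "\<lambda>p t. complex_of_real (p (exp (-t))) * h t"
  have hp: "has_bochner_integral lborel (\<lambda>t. ?I p t) 0" if p: "real_polynomial_function p" for p :: "real \<Rightarrow> real"
  proof -
    obtain a n where a: "p = (\<lambda>x. \<Sum>i\<le>n. a i * x ^ i)"
      using p real_polynomial_function_iff_sum by blast
    have "has_bochner_integral lborel (\<lambda>t. \<Sum>i\<le>n. complex_of_real (a i) * (complex_of_real (exp (-t) ^ i) * h t)) (\<Sum>i\<le>n. complex_of_real (a i) * 0)"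
      by (intro has_bochner_integral_sum has_bochner_integral_mult_right hn)
    then show ?thesis by (simp add: a sum_distrib_right mult.assoc)
  qed
  have hc: "(\<integral>t. ?I \<phi> t \<partial>lborel) = 0 \<and> integrable lborel (\<lambda>t. ?I \<phi> t)"
    if \<phi>: "continuous_on UNIV \<phi>" for \<phi> :: "real \<Rightarrow> real"
  proof -
    have [measurable]: "\<phi> \<in> borel_measurable borel" using \<phi> by (rule borel_measurable_continuous_onI)
    have "bounded (\<phi> ` {0..1})"
      by (intro compact_imp_bounded compact_continuous_image continuous_on_subset[OF \<phi>]) auto
    then obtain B where "\<forall>y\<in>\<phi> ` {0..1}. norm y \<le> B" unfolding bounded_iff by blast
    then have B: "\<And>x. x \<in> {0..1} \<Longrightarrow> \<bar>\<phi> x\<bar> \<le> B" by simp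
    have i: "integrable lborel (\<lambda>t. ?I \<phi> t)"
    proof (rule Bochner_Integration.integrable_bound)
      show "integrable lborel (\<lambda>t. B * cmod (h t))" using h by simp
      show "AE t in lborel. norm (?I \<phi> t) \<le> norm (B * cmod (h t))"
      proof (rule AE_I2)
        fix t
        show "norm (?I \<phi> t) \<le> norm (B * cmod (h t))"
        proof (cases "0 < t")
          case True
          then have "\<bar>\<phi> (exp (-t))\<bar> \<le> \<bar>B\<bar>" using B[of "exp (-t)"] by simp
          then show ?thesis by (simp add: norm_mult abs_mult mult_right_mono)
        qed (simp add: h_def)
      qed
    qed measurable
    define K where "K = (\<integral>t. cmod (h t) \<partial>lborel)"
    have K: "0 \<le> K" by (simp add: K_def)
    have "cmod (\<integral>t. ?I \<phi> t \<partial>lborel) \<le> 0 + e" if e: "0 < e" for e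
    proof -
      obtain p where p: "real_polynomial_function p" "\<And>x. x \<in> {0..1} \<Longrightarrow> \<bar>\<phi> x - p x\<bar> < e / (K + 1)"
        using Stone_Weierstrass_real_polynomial_function[of "{0..1}" \<phi> "e / (K + 1)"] \<phi> e K
        by (auto intro: continuous_on_subset)
      have ip: "integrable lborel (\<lambda>t. ?I p t)"
        and zp: "(\<integral>t. ?I p t \<partial>lborel) = 0"
        using hp[OF p(1)] unfolding has_bochner_integral_iff by auto
      have "(\<integral>t. ?I \<phi> t \<partial>lborel) = (\<integral>t. ?I \<phi> t - ?I p t \<partial>lborel)"
        using i ip zp by simp
      also have "cmod \<dots> \<le> (\<integral>t. e / (K + 1) * cmod (h t) \<partial>lborel)"
      proof (rule Bochner_Integration.integral_norm_bound_integral)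
        fix t
        show "cmod (?I \<phi> t - ?I p t) \<le> e / (K + 1) * cmod (h t)"
        proof (cases "0 < t")
          case True
          then have "\<bar>\<phi> (exp (-t)) - p (exp (-t))\<bar> \<le> e / (K + 1)" using p(2)[of "exp (-t)"] by simp
          from mult_right_mono[OF this, of "cmod (h t)"] show ?thesis
            by (simp add: norm_mult left_diff_distrib[symmetric] flip: of_real_diff)
        qed (simp add: h_def)
      qed (use i ip h in auto)
      also have "\<dots> = e / (K + 1) * K" by (simp add: K_def)
      also have "\<dots> \<le> e" using K e by (simp add: field_simps)
      finally show ?thesis by simp
    qed
    then have "cmod (\<integral>t. ?I \<phi> t \<partial>lborel) \<le> 0" by (rule field_le_epsilon)
    with i show ?thesis by simp
  qed
  have "isCont g t0" using cont t0 by (simp add: continuous_on_eq_continuous_at)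
  then obtain \<delta>0 where \<delta>0: "0 < \<delta>0" "\<And>t. \<bar>t - t0\<bar> < \<delta>0 \<Longrightarrow> cmod (g t - g t0) < cmod (g t0) / 2"
    using g0 unfolding continuous_at_eps_delta by (metis dist_norm half_gt_zero real_norm_def zero_less_norm_iff)
  define \<delta> where "\<delta> = min \<delta>0 t0"
  have \<delta>: "0 < \<delta>" "\<delta> \<le> \<delta>0" "\<delta> \<le> t0" using \<delta>0 t0 by (auto simp: \<delta>_def)
  \<comment> \<open>A tent that is positive exactly on the image of the \<open>\<delta>\<close>-neighbourhood of \<open>t0\<close> under \<open>exp (-t)\<close>.\<close>
  define \<phi> where "\<phi> = (\<lambda>x::real. max 0 (min (x - exp (- (t0 + \<delta>))) (exp (- (t0 - \<delta>)) - x)))"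
  have \<phi>c: "continuous_on UNIV \<phi>" unfolding \<phi>_def by (intro continuous_intros)
  have \<phi>0: "0 \<le> \<phi> x" for x by (simp add: \<phi>_def)
  have \<phi>p: "0 < \<phi> (exp (-t)) \<longleftrightarrow> \<bar>t - t0\<bar> < \<delta>" for t
  proof -
    have "0 < \<phi> (exp (-t)) \<longleftrightarrow> exp (- (t0 + \<delta>)) < exp (-t) \<and> exp (-t) < exp (- (t0 - \<delta>))"
      by (auto simp: \<phi>_def less_max_iff_disj)
    then show ?thesis by (simp only: exp_less_cancel_iff) linarith
  qed
  have pos: "0 < Re (cnj (g t0) * g t)" if "\<bar>t - t0\<bar> < \<delta>" for t
  proof -
    have "cmod (g t - g t0) < cmod (g t0)"
      using \<delta>0(2)[of t] that \<delta> norm_ge_zero[of "g t - g t0"] by linarith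
    then have "cmod (cnj (g t0) * (g t - g t0)) < cmod (g t0) * cmod (g t0)"
      using g0 by (simp add: norm_mult)
    then have "\<bar>Re (cnj (g t0) * (g t - g t0))\<bar> < cmod (g t0) * cmod (g t0)"
      using abs_Re_le_cmod order_le_less_trans by blast
    moreover have "Re (cnj (g t0) * g t0) = cmod (g t0) * cmod (g t0)"
      by (simp add: cmod_power2 power2_eq_square[symmetric])
    ultimately show ?thesis by (simp add: algebra_simps)
  qed
  define q where "q = (\<lambda>t. Re (cnj (g t0) * (?I \<phi> t)))"
  have iq: "integrable lborel q" unfolding q_def
    using hc[OF \<phi>c] by (intro integrable_Re integrable_mult_right) auto
  have "(\<integral>t. cnj (g t0) * (?I \<phi> t) \<partial>lborel) = 0"
    using hc[OF \<phi>c] by (simp only: integral_mult_right_zero) simp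
  then have zq: "(\<integral>t. q t \<partial>lborel) = 0" unfolding q_def
    using hc[OF \<phi>c] by (subst integral_Re) auto
  have qe: "q t = \<phi> (exp (-t)) * indicator {0<..} t * exp (- (2 * t)) * Re (cnj (g t0) * g t)" for t
  proof -
    have "cnj (g t0) * (?I \<phi> t) = complex_of_real (\<phi> (exp (-t)) * indicator {0<..} t * exp (- (2 * t))) * (cnj (g t0) * g t)"
      by (simp add: h_def scaleR_conv_of_real mult_ac exp_of_real[symmetric])
    then show ?thesis unfolding q_def by (simp only: Re_complex_of_real Im_complex_of_real times_complex.sel)
  qed
  have q0: "0 \<le> q t" for t
  proof (cases "\<bar>t - t0\<bar> < \<delta>")
    case True
    then show ?thesis unfolding qe using \<phi>0 pos[OF True] by (intro mult_nonneg_nonneg) auto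
  next
    case False
    then have "\<phi> (exp (-t)) = 0" using \<phi>0[of "exp (-t)"] \<phi>p[of t] by linarith
    then show ?thesis unfolding qe by simp
  qed
  have "AE t in lborel. q t = 0"
    using zq integral_nonneg_eq_0_iff_AE[OF iq] q0 by auto
  then have "AE t in lborel. t \<notin> {t0 - \<delta><..<t0 + \<delta>}"
  proof eventually_elim
    case (elim t)
    show ?case
    proof
      assume t: "t \<in> {t0 - \<delta><..<t0 + \<delta>}"
      then have t': "\<bar>t - t0\<bar> < \<delta>" "0 < t" using \<delta> by auto
      then have "0 < q t" unfolding qe using \<phi>p[of t] pos[OF t'(1)] by (intro mult_pos_pos) auto
      with elim show False by simp
    qed
  qed
  then have "emeasure lborel {t0 - \<delta><..<t0 + \<delta>} = 0"
    by (subst (asm) AE_iff_measurable[where N="{t0 - \<delta><..<t0 + \<delta>}"]) auto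
  then show False using \<delta> by simp
qed

section \<open>A Stieltjes representation by residues\<close>

text \<open>On the lines \<open>Im w = \<plusminus>pi\<close> the denominator \<open>exp (\<alpha> w) - c\<close> is, up to a factor of modulus one, of
  this form with \<open>u \<noteq> 1\<close>; the bound keeps it away from zero.\<close>

lemma dist_ray_unit_circle:
  fixes u :: complex
  assumes u: "cmod u = 1" and r: "0 \<le> r"
  shows "cmod (u - 1) / 2 * max 1 r \<le> cmod (complex_of_real r * u - 1)"
proof -
  let ?D = "cmod (complex_of_real r * u - 1)"
  have 1: "\<bar>r - 1\<bar> \<le> ?D"
    using norm_triangle_ineq3[of "complex_of_real r * u" 1] u r by (simp add: norm_mult)
  have "cmod (u - 1) \<le> cmod (complex_of_real (1 - r) * u) + ?D"
    using norm_triangle_ineq[of "complex_of_real (1 - r) * u" "complex_of_real r * u - 1"] by (simp add: algebra_simps)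
  then have a: "cmod (u - 1) \<le> 2 * ?D" using 1 u by (simp add: norm_mult flip: of_real_diff)
  have "complex_of_real r * (u - 1) = (complex_of_real r * u - 1) + complex_of_real (1 - r)"
    by (simp add: algebra_simps)
  then have "cmod (complex_of_real r * (u - 1)) \<le> ?D + cmod (complex_of_real (1 - r))"
    by (metis norm_triangle_ineq)
  then have b: "r * cmod (u - 1) \<le> 2 * ?D" using 1 r by (simp add: norm_mult flip: of_real_diff)
  show ?thesis using a b by (cases "r \<le> 1") (auto simp: max_def mult.commute)
qed

text \<open>With \<open>\<zeta> = exp w\<close> the Laplace transform \<open>s powr (\<alpha> - 1) / (s powr \<alpha> - c)\<close> is
  \<open>ml_symbol \<alpha> (ln s) / s\<close>. In the logarithmic variable the plane cut along the negative axis
  becomes the strip of half-width \<open>pi\<close>, the function becomes meromorphic on the whole plane, and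
  a contour around the cut becomes a rectangle.\<close>

definition ml_symbol :: "real \<Rightarrow> complex \<Rightarrow> complex" where
  "ml_symbol \<alpha> w = exp (of_real \<alpha> * w) / (exp (of_real \<alpha> * w) - (- \<i>) powr of_real \<alpha>)"

text \<open>The jump of the symbol across the cut over \<open>2 pi \<i>\<close>, that is, the density of its Stieltjes representation
  in the variable \<open>x = ln r\<close>.\<close>

definition ml_density :: "real \<Rightarrow> real \<Rightarrow> complex" where
  "ml_density \<alpha> x = (ml_symbol \<alpha> (of_real x + \<i> * of_real pi) - ml_symbol \<alpha> (of_real x - \<i> * of_real pi)) / (2 * of_real pi * \<i>)"

lemma minus_i_powr: "(- \<i>) powr of_real \<alpha> = exp (of_real \<alpha> * (- \<i> * of_real pi / 2))"
  by (simp add: powr_def)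

lemma norm_minus_i_powr [simp]: "cmod ((- \<i>) powr of_real \<alpha>) = 1"
  unfolding minus_i_powr by (simp add: norm_exp_eq_Re)

text \<open>The zeros of \<open>exp (\<alpha> w) - c\<close> are spaced vertically by \<open>2 pi / \<alpha> \<ge> 2 pi\<close>. One of them is at
  height \<open>- pi / 2\<close>, so the next ones have height at least \<open>3 pi / 2\<close> or at most \<open>- 5 pi / 2\<close>.\<close>

lemma exp_eq_minus_i_powr_iff:
  assumes a: "0 < \<alpha>" "\<alpha> \<le> 1" and w: "\<bar>Im w\<bar> < 3 * pi / 2"
  shows "exp (of_real \<alpha> * w) = (- \<i>) powr of_real \<alpha> \<longleftrightarrow> w = - \<i> * of_real pi / 2"
proof
  assume "exp (of_real \<alpha> * w) = (- \<i>) powr of_real \<alpha>"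
  then obtain k :: int where k: "of_real \<alpha> * w = of_real \<alpha> * (- \<i> * of_real pi / 2) + (of_int (2 * k) * pi) * \<i>"
    unfolding minus_i_powr exp_eq by auto
  from arg_cong[OF this, of Im] have im: "\<alpha> * Im w = - \<alpha> * pi / 2 + 2 * real_of_int k * pi" by simp
  have "k = 0"
  proof (rule ccontr)
    assume "k \<noteq> 0"
    then have "1 \<le> \<bar>real_of_int k\<bar>" by linarith
    then have "2 * pi \<le> \<bar>2 * real_of_int k * pi\<bar>" by (simp add: abs_mult)
    also have "2 * real_of_int k * pi = \<alpha> * (Im w + pi / 2)" using im by (simp add: algebra_simps)
    also have "\<bar>\<dots>\<bar> = \<alpha> * \<bar>Im w + pi / 2\<bar>" using a by (simp add: abs_mult)
    also have "\<dots> \<le> 1 * \<bar>Im w + pi / 2\<bar>" using a by (intro mult_right_mono) auto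
    also have "\<dots> < 2 * pi"
      using w pi_gt_zero unfolding abs_less_iff mult_1 by (intro conjI; argo)
    finally show False by simp
  qed
  then have "of_real \<alpha> * w = of_real \<alpha> * (- \<i> * of_real pi / 2)" using k by simp
  then show "w = - \<i> * of_real pi / 2" unfolding mult_cancel_left using a by simp
qed (simp add: minus_i_powr)

lemma exp_eq_of_real_iff:
  assumes s: "0 < s" and w: "\<bar>Im w\<bar> < 3 * pi / 2"
  shows "exp w = complex_of_real s \<longleftrightarrow> w = complex_of_real (ln s)"
proof
  assume "exp w = complex_of_real s"
  then have "exp w = exp (complex_of_real (ln s))" using s by (simp add: exp_of_real)
  then obtain k :: int where k: "w = complex_of_real (ln s) + (of_int (2 * k) * pi) * \<i>"
    unfolding exp_eq by auto
  from arg_cong[OF this, of Im] have im: "Im w = 2 * real_of_int k * pi" by simp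
  have "k = 0"
  proof (rule ccontr)
    assume "k \<noteq> 0"
    then have "1 \<le> \<bar>real_of_int k\<bar>" by linarith
    then have "2 * pi \<le> \<bar>2 * real_of_int k * pi\<bar>" by (simp add: abs_mult)
    then show False using w im by linarith
  qed
  then show "w = complex_of_real (ln s)" using k by simp
qed (use s in \<open>simp add: exp_of_real\<close>)

text \<open>On the lines \<open>Im w = \<plusminus>pi\<close> the number \<open>exp (\<alpha> w) / c\<close> has argument \<open>3 pi \<alpha> / 2\<close> or
  \<open>- pi \<alpha> / 2\<close>, neither of which is a multiple of \<open>2 pi\<close> as \<open>0 < \<alpha> \<le> 1\<close>.\<close>

lemma ml_symbol_line:
  assumes a: "0 < \<alpha>" "\<alpha> \<le> 1" and \<theta>: "\<theta> = pi \<or> \<theta> = - pi"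
  obtains c where "0 < c" "\<And>x. c * max 1 (exp (\<alpha> * x)) \<le>
    cmod (exp (of_real \<alpha> * (of_real x + \<i> * of_real \<theta>)) - (- \<i>) powr of_real \<alpha>)"
proof -
  define \<delta> where "\<delta> = \<alpha> * \<theta> + \<alpha> * pi / 2"
  define u where "u = exp (\<i> * complex_of_real \<delta>)"
  have nu: "cmod u = 1" by (simp add: u_def)
  have "u \<noteq> 1"
  proof
    assume "u = 1"
    then have "Im (exp (\<i> * complex_of_real \<delta>)) = 0" "Re (exp (\<i> * complex_of_real \<delta>)) = 1" by (auto simp: u_def)
    then have c: "cos \<delta> = 1" by (simp add: Re_exp)
    then obtain k :: int where k: "\<delta> = of_int k * (2 * pi)" by (auto simp: cos_one_2pi_int mult.assoc)
    have "\<bar>\<delta>\<bar> < 2 * pi" "\<delta> \<noteq> 0"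
    proof -
      have "\<delta> = \<alpha> * (3 * pi / 2) \<or> \<delta> = \<alpha> * (- pi / 2)" using \<theta> by (auto simp: \<delta>_def algebra_simps)
      moreover have "\<alpha> * (3 * pi / 2) \<le> 1 * (3 * pi / 2)" "\<alpha> * (pi / 2) \<le> 1 * (pi / 2)"
        using a by (auto intro!: mult_right_mono)
      moreover have "0 < \<alpha> * pi" using a by simp
      ultimately show "\<bar>\<delta>\<bar> < 2 * pi" "\<delta> \<noteq> 0" unfolding abs_less_iff using pi_gt_zero by argo+
    qed
    moreover have "\<bar>\<delta>\<bar> = \<bar>real_of_int k\<bar> * (2 * pi)" by (simp add: k abs_mult)
    ultimately have "\<bar>real_of_int k\<bar> < 1" by simp
    then have "k = 0" by linarith
    then show False using k \<open>\<delta> \<noteq> 0\<close> by simp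
  qed
  then have c: "0 < cmod (u - 1) / 2" by simp
  show ?thesis
  proof (rule that[OF c])
    fix x
    have "exp (of_real \<alpha> * (of_real x + \<i> * of_real \<theta>)) = (- \<i>) powr of_real \<alpha> * (complex_of_real (exp (\<alpha> * x)) * u)"
      unfolding minus_i_powr u_def \<delta>_def by (simp add: exp_of_real[symmetric] exp_add[symmetric] algebra_simps)
    then have "exp (of_real \<alpha> * (of_real x + \<i> * of_real \<theta>)) - (- \<i>) powr of_real \<alpha> = (- \<i>) powr of_real \<alpha> * (complex_of_real (exp (\<alpha> * x)) * u - 1)"
      by (simp add: algebra_simps)
    then have "cmod (exp (of_real \<alpha> * (of_real x + \<i> * of_real \<theta>)) - (- \<i>) powr of_real \<alpha>) = cmod (complex_of_real (exp (\<alpha> * x)) * u - 1)"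
      by (simp only: norm_mult norm_minus_i_powr)
    then show "cmod (u - 1) / 2 * max 1 (exp (\<alpha> * x)) \<le> cmod (exp (of_real \<alpha> * (of_real x + \<i> * of_real \<theta>)) - (- \<i>) powr of_real \<alpha>)"
      using dist_ray_unit_circle[OF nu, of "exp (\<alpha> * x)"] by simp
  qed
qed

text \<open>Far to the left the symbol is small, far to the right it is close to \<open>1\<close>; the \<open>1\<close> cancels in
  the jump, which therefore decays exponentially in both directions.\<close>

lemma ml_symbol_bound:
  assumes a: "0 < \<alpha>" "\<alpha> \<le> 1" and \<theta>: "\<theta> = pi \<or> \<theta> = - pi"
  obtains C where "0 < C"
    "\<And>x. x \<le> 0 \<Longrightarrow> cmod (ml_symbol \<alpha> (of_real x + \<i> * of_real \<theta>)) \<le> C * exp (- \<alpha> * \<bar>x\<bar>)"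
    "\<And>x. 0 \<le> x \<Longrightarrow> cmod (ml_symbol \<alpha> (of_real x + \<i> * of_real \<theta>) - 1) \<le> C * exp (- \<alpha> * \<bar>x\<bar>)"
    "\<And>x. cmod (ml_symbol \<alpha> (of_real x + \<i> * of_real \<theta>)) \<le> C"
    "continuous_on UNIV (\<lambda>x. ml_symbol \<alpha> (of_real x + \<i> * of_real \<theta>))"
proof -
  obtain c where c: "0 < c" "\<And>x. c * max 1 (exp (\<alpha> * x)) \<le>
    cmod (exp (of_real \<alpha> * (of_real x + \<i> * of_real \<theta>)) - (- \<i>) powr of_real \<alpha>)"
    using ml_symbol_line[OF assms] by metis
  let ?e = "\<lambda>x. exp (of_real \<alpha> * (of_real x + \<i> * of_real \<theta>))" let ?l = "(- \<i>) powr of_real \<alpha>"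
  have ne: "?e x - ?l \<noteq> 0" for x
  proof
    assume "?e x - ?l = 0"
    then have "c * max 1 (exp (\<alpha> * x)) \<le> 0" using c(2)[of x] by (metis norm_zero)
    moreover have "0 < c * max 1 (exp (\<alpha> * x))" using c(1) by simp
    ultimately show False by simp
  qed
  have ex: "cmod (?e x) = exp (\<alpha> * x)" for x by (simp add: norm_exp_eq_Re)
  have pos: "0 < c * max 1 (exp (\<alpha> * x))" for x using c(1) by simp
  have cp: "0 < cmod (?e x - ?l)" for x using ne by simp
  have G: "cmod (ml_symbol \<alpha> (of_real x + \<i> * of_real \<theta>)) \<le> exp (\<alpha> * x) / (c * max 1 (exp (\<alpha> * x)))" for x
    unfolding ml_symbol_def norm_divide ex using c(2)[of x] pos[of x] by (intro divide_left_mono) (auto intro!: mult_pos_pos cp)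
  show ?thesis
  proof (rule that[of "1 / c"])
    fix x :: real
    show "cmod (ml_symbol \<alpha> (of_real x + \<i> * of_real \<theta>)) \<le> 1 / c * exp (- \<alpha> * \<bar>x\<bar>)" if "x \<le> 0"
    proof -
      have "exp (\<alpha> * x) / (c * max 1 (exp (\<alpha> * x))) \<le> exp (\<alpha> * x) / (c * 1)"
        using c(1) by (intro divide_left_mono mult_left_mono mult_pos_pos) auto
      then show ?thesis using G[of x] that by simp
    qed
    show "cmod (ml_symbol \<alpha> (of_real x + \<i> * of_real \<theta>)) \<le> 1 / c"
    proof -
      have "exp (\<alpha> * x) / (c * max 1 (exp (\<alpha> * x))) \<le> exp (\<alpha> * x) / (c * exp (\<alpha> * x))"
        using c(1) by (intro divide_left_mono mult_left_mono mult_pos_pos) auto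
      then show ?thesis using G[of x] by simp
    qed
    show "cmod (ml_symbol \<alpha> (of_real x + \<i> * of_real \<theta>) - 1) \<le> 1 / c * exp (- \<alpha> * \<bar>x\<bar>)" if "0 \<le> x"
    proof -
      have "ml_symbol \<alpha> (of_real x + \<i> * of_real \<theta>) - 1 = ?l / (?e x - ?l)"
      proof -
        have "e / (e - l) - 1 = l / (e - l)" if "e - l \<noteq> 0" for e l :: complex
          using that by (simp add: field_simps)
        then show ?thesis unfolding ml_symbol_def using ne[of x] by blast
      qed
      then have "cmod (ml_symbol \<alpha> (of_real x + \<i> * of_real \<theta>) - 1) = 1 / cmod (?e x - ?l)"
        by (simp only: norm_divide norm_minus_i_powr)
      also have "\<dots> \<le> 1 / (c * exp (\<alpha> * x))"
        using c(1) c(2)[of x] by (intro divide_left_mono mult_pos_pos cp order_trans[OF _ c(2)[of x]] mult_left_mono) auto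
      also have "\<dots> = 1 / c * exp (- \<alpha> * \<bar>x\<bar>)" using that by (simp add: exp_minus divide_inverse)
      finally show ?thesis .
    qed
  next
    show "continuous_on UNIV (\<lambda>x. ml_symbol \<alpha> (of_real x + \<i> * of_real \<theta>))"
      unfolding ml_symbol_def using ne by (intro continuous_intros) auto
  qed (use c in simp)
qed

lemma integrable_exp_abs:
  assumes "0 < (a::real)"
  shows "integrable lborel (\<lambda>x. exp (- a * \<bar>x\<bar>))"
proof -
  have "((\<lambda>x. exp (- a * x)) has_integral exp (- a * 0) / a) {0..}"
    by (rule has_integral_exp_minus_to_infinity[OF assms])
  then have "(\<lambda>x. exp (- a * x)) absolutely_integrable_on {0..}"
    by (intro nonnegative_absolutely_integrable_1) (auto simp: integrable_on_def)
  then have s: "set_integrable lborel {0..} (\<lambda>x. exp (- a * x))"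
    unfolding set_integrable_def by (subst (asm) integrable_completion) auto
  then have 1: "integrable lborel (\<lambda>x. indicator {0..} x *\<^sub>R exp (- a * x))"
    unfolding set_integrable_def .
  then have 2: "integrable lborel (\<lambda>x. indicator {0..} (0 + (-1) * x) *\<^sub>R exp (- a * (0 + (-1) * x)))"
    by (intro lborel_integrable_real_affine) auto
  show ?thesis
    by (rule Bochner_Integration.integrable_bound[OF Bochner_Integration.integrable_add[OF 1 2]])
      (auto simp: indicator_def)
qed

lemma ml_density_bound:
  assumes a: "0 < \<alpha>" "\<alpha> \<le> 1"
  obtains C where "0 < C" "\<And>x. cmod (ml_density \<alpha> x) \<le> C * exp (- \<alpha> * \<bar>x\<bar>)"
proof -
  obtain C where C: "0 < C"
    "\<And>x. x \<le> 0 \<Longrightarrow> cmod (ml_symbol \<alpha> (of_real x + \<i> * of_real pi)) \<le> C * exp (- \<alpha> * \<bar>x\<bar>)"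
    "\<And>x. 0 \<le> x \<Longrightarrow> cmod (ml_symbol \<alpha> (of_real x + \<i> * of_real pi) - 1) \<le> C * exp (- \<alpha> * \<bar>x\<bar>)"
    using ml_symbol_bound[OF a, of pi] by (metis)
  obtain D where D: "0 < D"
    "\<And>x. x \<le> 0 \<Longrightarrow> cmod (ml_symbol \<alpha> (of_real x + \<i> * of_real (-pi))) \<le> D * exp (- \<alpha> * \<bar>x\<bar>)"
    "\<And>x. 0 \<le> x \<Longrightarrow> cmod (ml_symbol \<alpha> (of_real x + \<i> * of_real (-pi)) - 1) \<le> D * exp (- \<alpha> * \<bar>x\<bar>)"
    using ml_symbol_bound[OF a, of "-pi"] by (metis)
  have "cmod (ml_density \<alpha> x) \<le> ((C + D) / (2 * pi)) * exp (- \<alpha> * \<bar>x\<bar>)" for x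
  proof -
    let ?p = "ml_symbol \<alpha> (of_real x + \<i> * of_real pi)" let ?m = "ml_symbol \<alpha> (of_real x + \<i> * of_real (-pi))"
    have "cmod (?p - ?m) \<le> (C + D) * exp (- \<alpha> * \<bar>x\<bar>)"
    proof (cases "x \<le> 0")
      case True
      then show ?thesis using norm_triangle_ineq4[of ?p ?m] C(2)[of x] D(2)[of x] by (simp add: distrib_right)
    next
      case False
      then show ?thesis using norm_triangle_ineq4[of "?p - 1" "?m - 1"] C(3)[of x] D(3)[of x] by (simp add: distrib_right)
    qed
    then have "cmod (?p - ?m) / (2 * pi) \<le> (C + D) * exp (- \<alpha> * \<bar>x\<bar>) / (2 * pi)"
      by (rule divide_right_mono) simp
    then show ?thesis by (simp add: ml_density_def norm_divide norm_mult)
  qed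
  then show ?thesis using that[of "(C + D) / (2 * pi)"] C(1) D(1) by simp
qed

lemma ml_density_measurable:
  assumes a: "0 < \<alpha>" "\<alpha> \<le> 1"
  shows "ml_density \<alpha> \<in> borel_measurable borel"
proof -
  have "continuous_on UNIV (\<lambda>x. ml_symbol \<alpha> (of_real x + \<i> * of_real pi))"
    using ml_symbol_bound[OF a, of pi] by metis
  moreover have "continuous_on UNIV (\<lambda>x. ml_symbol \<alpha> (of_real x + \<i> * of_real (-pi)))"
    using ml_symbol_bound[OF a, of "-pi"] by metis
  ultimately have "continuous_on UNIV (ml_density \<alpha>)"
    unfolding ml_density_def by (intro continuous_intros) auto
  then show ?thesis by (rule borel_measurable_continuous_onI)
qed

lemma contour_integral_linepath_horizontal:
  assumes "a < b"
  shows "contour_integral (linepath (Complex a c) (Complex b c)) f = integral {a..b} (\<lambda>x. f (Complex x c))"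
proof -
  have 1: "Complex b c - Complex a c = complex_of_real b - complex_of_real a"
    by (simp add: complex_eq_iff)
  have 2: "linepath (Complex a c) (Complex b c) t = linepath (of_real a) (of_real b) t + Complex 0 c" for t
    by (simp add: linepath_def complex_eq_iff algebra_simps)
  have "contour_integral (linepath (Complex a c) (Complex b c)) f
     = contour_integral (linepath (of_real a) (of_real b)) (\<lambda>w. f (w + Complex 0 c))"
    by (simp add: contour_integral_integral 1 2)
  also have "\<dots> = integral {Re (of_real a)..Re (of_real b)} (\<lambda>x. f (of_real x + Complex 0 c))"
    by (rule contour_integral_linepath_Reals_eq) (use assms in auto)
  also have "(\<lambda>x. f (complex_of_real x + Complex 0 c)) = (\<lambda>x. f (Complex x c))"
    by (rule ext, rule arg_cong[of _ _ f]) (simp add: complex_eq_iff)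
  finally show ?thesis by simp
qed

lemma integral_symmetric_limit:
  fixes \<phi> :: "real \<Rightarrow> complex"
  assumes "integrable lborel \<phi>"
  shows "(\<lambda>n. integral {- real n..real n} \<phi>) \<longlonglongrightarrow> (\<integral>x. \<phi> x \<partial>lborel)"
proof -
  have [measurable]: "\<phi> \<in> borel_measurable borel" using borel_measurable_integrable[OF assms] by simp
  have "set_integrable lborel {- real n..real n} \<phi>" for n
    unfolding set_integrable_def using assms by (intro integrable_mult_indicator) auto
  then have e: "integral {- real n..real n} \<phi> = (\<integral>x. indicator {- real n..real n} x *\<^sub>R \<phi> x \<partial>lborel)" for n
    using set_borel_integral_eq_integral(2) unfolding set_lebesgue_integral_def by metis
  show ?thesis unfolding e
  proof (rule integral_dominated_convergence[where w="\<lambda>x. norm (\<phi> x)"])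
    show "AE x in lborel. (\<lambda>n. indicator {- real n..real n} x *\<^sub>R \<phi> x) \<longlonglongrightarrow> \<phi> x"
    proof (rule AE_I2)
      fix x
      obtain N :: nat where "\<bar>x\<bar> \<le> real N" using real_arch_simple by blast
      then have "\<forall>\<^sub>F n in sequentially. indicator {- real n..real n} x *\<^sub>R \<phi> x = \<phi> x"
        by (intro eventually_sequentiallyI[of N]) (auto simp: indicator_def)
      then show "(\<lambda>n. indicator {- real n..real n} x *\<^sub>R \<phi> x) \<longlonglongrightarrow> \<phi> x"
        by (rule tendsto_eventually)
    qed
  qed (use assms in \<open>auto simp: indicator_def\<close>)
qed

text \<open>Up to \<open>2 pi \<i>\<close>, this is the integrand of Cauchy's formula at \<open>s\<close> after the substitution
  \<open>\<zeta> = exp w\<close>.\<close>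

definition cauchy_kernel :: "real \<Rightarrow> real \<Rightarrow> complex \<Rightarrow> complex" where
  "cauchy_kernel \<alpha> s w = ml_symbol \<alpha> w / (exp w - of_real s)"

lemma cauchy_kernel_holomorphic:
  assumes a: "0 < \<alpha>" "\<alpha> \<le> 1" and s: "0 < s"
  shows "cauchy_kernel \<alpha> s holomorphic_on {w. \<bar>Im w\<bar> < 3 * pi / 2} - {- \<i> * of_real pi / 2, of_real (ln s)}"
  unfolding cauchy_kernel_def ml_symbol_def
  by (intro holomorphic_intros) (auto simp: exp_eq_of_real_iff[OF s] exp_eq_minus_i_powr_iff[OF a])

lemma strip_open_connected:
  shows "open ({w. Im w < b} \<inter> {w. a < Im w})" "connected ({w. Im w < b} \<inter> {w. a < Im w})"
  by (intro open_Int open_halfspace_Im_lt open_halfspace_Im_gt)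
    (intro convex_connected convex_Int convex_halfspace_Im_lt convex_halfspace_Im_gt)

lemma residue_cauchy_kernel_minus_i:
  assumes a: "0 < \<alpha>" "\<alpha> \<le> 1" and s: "1 < s"
  shows "residue (cauchy_kernel \<alpha> s) (- \<i> * of_real pi / 2) = - (1 / (of_real \<alpha> * (of_real s + \<i>)))"
proof -
  let ?w = "- \<i> * complex_of_real pi / 2"
  let ?l = "(- \<i>) powr of_real \<alpha>"
  define S where "S = {w. Im w < 0} \<inter> {w. - (3 * pi / 2) < Im w}"
  have S: "open S" "connected S" "?w \<in> S"
    unfolding S_def by (rule strip_open_connected, rule strip_open_connected, simp)
  have e1: "exp ?w = - \<i>" by (simp add: exp_eq_polar exp_Euler[symmetric]) 
  have e2: "exp (of_real \<alpha> * ?w) = ?l" by (simp add: minus_i_powr)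
  have K: "cauchy_kernel \<alpha> s = (\<lambda>w. (exp (of_real \<alpha> * w) / (exp w - of_real s)) / (exp (of_real \<alpha> * w) - ?l))"
    by (simp add: cauchy_kernel_def ml_symbol_def fun_eq_iff mult.commute)
  have "- \<i> - complex_of_real s \<noteq> 0" using s by (auto simp: complex_eq_iff)
  have l0: "?l \<noteq> 0" by simp
  have "residue (cauchy_kernel \<alpha> s) ?w = (exp (of_real \<alpha> * ?w) / (exp ?w - of_real s)) / (of_real \<alpha> * ?l)"
    unfolding K
  proof (rule residue_simple_pole_deriv[where s=S])
    have "exp w \<noteq> of_real s" if "w \<in> S" for w
      using that s exp_eq_of_real_iff[of s w] by (auto simp: S_def)
    then show "(\<lambda>w. exp (of_real \<alpha> * w) / (exp w - of_real s)) holomorphic_on S"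
      by (intro holomorphic_intros) auto
    show "(\<lambda>w. exp (of_real \<alpha> * w) - ?l) holomorphic_on S" by (intro holomorphic_intros)
    show "((\<lambda>w. exp (of_real \<alpha> * w) - ?l) has_field_derivative of_real \<alpha> * ?l) (at ?w)"
      unfolding e2[symmetric] by (auto intro!: derivative_eq_intros)
    show "exp (of_real \<alpha> * ?w) / (exp ?w - of_real s) \<noteq> 0"
      unfolding e1 using \<open>- \<i> - complex_of_real s \<noteq> 0\<close> by simp
    show "exp (of_real \<alpha> * ?w) - ?l = 0" by (simp only: e2) simp
    show "of_real \<alpha> * ?l \<noteq> 0" using a by simp
  qed (use S in auto)
  also have "\<dots> = - (1 / (of_real \<alpha> * (of_real s + \<i>)))"
  proof -
    have "x / (- y) / (c * x) = - (1 / (c * y))" if "x \<noteq> 0" for x y c :: complex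
      using that by simp
    moreover have "- \<i> - complex_of_real s = - (of_real s + \<i>)" by simp
    ultimately show ?thesis unfolding e1 e2 using l0 by metis
  qed
  finally show ?thesis .
qed

lemma residue_cauchy_kernel_ln:
  assumes a: "0 < \<alpha>" "\<alpha> \<le> 1" and s: "1 < s"
  shows "residue (cauchy_kernel \<alpha> s) (of_real (ln s)) = of_real (s powr (\<alpha> - 1)) / (of_real (s powr \<alpha>) - (- \<i>) powr of_real \<alpha>)"
proof -
  let ?w = "complex_of_real (ln s)"
  let ?l = "(- \<i>) powr of_real \<alpha>"
  define S where "S = {w. Im w < 3 * pi / 2} \<inter> {w. - (pi / 2) < Im w}"
  have S: "open S" "connected S" "?w \<in> S"
    unfolding S_def by (rule strip_open_connected, rule strip_open_connected, simp)
  have e1: "exp ?w = of_real s" using s by (simp add: exp_of_real)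
  have e2: "exp (of_real \<alpha> * ?w) = of_real (s powr \<alpha>)" using s by (simp add: powr_def exp_of_real[symmetric])
  have K: "cauchy_kernel \<alpha> s = (\<lambda>w. (exp (of_real \<alpha> * w) / (exp (of_real \<alpha> * w) - ?l)) / (exp w - of_real s))"
    by (simp add: cauchy_kernel_def ml_symbol_def fun_eq_iff)
  have ne: "exp (of_real \<alpha> * w) \<noteq> ?l" if "w \<in> S" for w
  proof -
    have "\<bar>Im w\<bar> < 3 * pi / 2"
      using that pi_gt_zero unfolding S_def Int_iff mem_Collect_eq abs_less_iff by argo
    moreover have "w \<noteq> - \<i> * of_real pi / 2" using that by (auto simp: S_def)
    ultimately show ?thesis using exp_eq_minus_i_powr_iff[OF a] by blast
  qed
  have "residue (cauchy_kernel \<alpha> s) ?w = (exp (of_real \<alpha> * ?w) / (exp (of_real \<alpha> * ?w) - ?l)) / of_real s"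
    unfolding K
  proof (rule residue_simple_pole_deriv[where s=S])
    show "(\<lambda>w. exp (of_real \<alpha> * w) / (exp (of_real \<alpha> * w) - ?l)) holomorphic_on S"
      using ne by (intro holomorphic_intros) auto
    show "(\<lambda>w. exp w - of_real s) holomorphic_on S" by (intro holomorphic_intros)
    show "((\<lambda>w. exp w - of_real s) has_field_derivative of_real s) (at ?w)"
      unfolding e1[symmetric] by (auto intro!: derivative_eq_intros)
    show "exp (of_real \<alpha> * ?w) / (exp (of_real \<alpha> * ?w) - ?l) \<noteq> 0"
      using ne[OF S(3)] by simp
    show "exp ?w - of_real s = 0" by (simp only: e1) simp
  qed (use S s in auto)
  also have "\<dots> = of_real (s powr (\<alpha> - 1)) / (of_real (s powr \<alpha>) - ?l)"
    unfolding e2 using s by (simp add: powr_diff mult.commute)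
  finally show ?thesis .
qed

text \<open>The second claim, that the contour avoids both poles, gives the continuity needed to split the
  integral into the four sides.\<close>

lemma contour_integral_rectangle:
  assumes a: "0 < \<alpha>" "\<alpha> \<le> 1" and s: "1 < s" and L: "ln s < L"
  shows "contour_integral (rectpath (Complex (-L) (-pi)) (Complex L pi)) (cauchy_kernel \<alpha> s)
    = 2 * of_real pi * \<i> * (of_real (s powr (\<alpha> - 1)) / (of_real (s powr \<alpha>) - (- \<i>) powr of_real \<alpha>) - 1 / (of_real \<alpha> * (of_real s + \<i>)))"
    and "w \<in> path_image (rectpath (Complex (-L) (-pi)) (Complex L pi)) \<Longrightarrow>
      w \<in> {w. \<bar>Im w\<bar> < 3 * pi / 2} - {- \<i> * of_real pi / 2, of_real (ln s)}"
proof -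
  let ?g = "rectpath (Complex (-L) (-pi)) (Complex L pi)"
  let ?p = "Complex (-L) (-pi)" and ?q = "Complex L pi"
  let ?S = "{w. \<bar>Im w\<bar> < 3 * pi / 2}"
  let ?w1 = "- \<i> * complex_of_real pi / 2" and ?w2 = "complex_of_real (ln s)"
  have L0: "0 < L" using L s by (smt (verit) ln_gt_zero)
  have ls: "0 < ln s" using s by simp
  have S: "?S = {w. Im w < 3 * pi / 2} \<inter> {w. - (3 * pi / 2) < Im w}" by (auto simp: abs_less_iff)
  have "open ?S" "connected ?S"
    unfolding S by (rule strip_open_connected)+
  have b1: "?w1 \<in> box ?p ?q"
  proof -
    have "- (pi / 2) < pi" using pi_gt_zero by argo
    then show ?thesis using L0 by (simp add: in_box_complex_iff)
  qed
  have b2: "?w2 \<in> box ?p ?q"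
    using L ls by (simp add: in_box_complex_iff)
  have pi_img: "path_image ?g = cbox ?p ?q - box ?p ?q"
    using L0 by (intro path_image_rectpath_cbox_minus_box) auto
  have sub: "cbox ?p ?q \<subseteq> ?S"
  proof
    fix z assume "z \<in> cbox ?p ?q"
    then have "- pi \<le> Im z" "Im z \<le> pi" by (auto simp: in_cbox_complex_iff)
    then show "z \<in> ?S" using pi_gt_zero unfolding mem_Collect_eq abs_less_iff by argo
  qed
  have img: "path_image ?g \<subseteq> ?S - {?w1, ?w2}" using pi_img sub b1 b2 by auto
  then show "w \<in> path_image ?g \<Longrightarrow> w \<in> ?S - {?w1, ?w2}" by blast
  have out: "\<forall>z. z \<notin> ?S \<longrightarrow> winding_number ?g z = 0"
  proof (intro allI impI)
    fix z assume "z \<notin> ?S"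
    then have "z \<notin> cbox ?p ?q" using sub by blast
    then show "winding_number ?g z = 0"
      using L0 by (intro winding_number_rectpath_outside) auto
  qed
  have ne: "?w1 \<noteq> ?w2" by (auto simp: complex_eq_iff)
  have "contour_integral ?g (cauchy_kernel \<alpha> s) = 2 * pi * \<i> * (\<Sum>p\<in>{?w1, ?w2}. winding_number ?g p * residue (cauchy_kernel \<alpha> s) p)"
  proof (rule Residue_theorem[OF \<open>open ?S\<close> \<open>connected ?S\<close>])
    show "cauchy_kernel \<alpha> s holomorphic_on ?S - {?w1, ?w2}"
      by (rule cauchy_kernel_holomorphic) (use a s in auto)
    show "path_image ?g \<subseteq> ?S - {?w1, ?w2}" by (rule img)
  qed (use out in auto)
  also have "(\<Sum>p\<in>{?w1, ?w2}. winding_number ?g p * residue (cauchy_kernel \<alpha> s) p)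
     = residue (cauchy_kernel \<alpha> s) ?w1 + residue (cauchy_kernel \<alpha> s) ?w2"
    using ne winding_number_rectpath[OF b1] winding_number_rectpath[OF b2] by simp
  also have "\<dots> = of_real (s powr (\<alpha> - 1)) / (of_real (s powr \<alpha>) - (- \<i>) powr of_real \<alpha>) - 1 / (of_real \<alpha> * (of_real s + \<i>))"
    by (simp only: residue_cauchy_kernel_minus_i[OF a s] residue_cauchy_kernel_ln[OF a s]) simp
  finally show "contour_integral ?g (cauchy_kernel \<alpha> s)
    = 2 * of_real pi * \<i> * (of_real (s powr (\<alpha> - 1)) / (of_real (s powr \<alpha>) - (- \<i>) powr of_real \<alpha>) - 1 / (of_real \<alpha> * (of_real s + \<i>)))"
    by simp
qed

text \<open>On both lines \<open>exp w = - exp x\<close>, so the denominator stays away from zero and the two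
  horizontal sides differ only through the symbol.\<close>

lemma cauchy_kernel_horizontal_integrable:
  assumes a: "0 < \<alpha>" "\<alpha> \<le> 1" and s: "1 < s" and \<theta>: "\<theta> = pi \<or> \<theta> = - pi"
  shows "integrable lborel (\<lambda>x. cauchy_kernel \<alpha> s (Complex x \<theta>))"
    and "cauchy_kernel \<alpha> s (Complex x \<theta>) = - (ml_symbol \<alpha> (of_real x + \<i> * of_real \<theta>) / of_real (exp x + s))"
proof -
  obtain C where C: "0 < C"
    "\<And>x. x \<le> 0 \<Longrightarrow> cmod (ml_symbol \<alpha> (of_real x + \<i> * of_real \<theta>)) \<le> C * exp (- \<alpha> * \<bar>x\<bar>)"
    "\<And>x. cmod (ml_symbol \<alpha> (of_real x + \<i> * of_real \<theta>)) \<le> C"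
    "continuous_on UNIV (\<lambda>x. ml_symbol \<alpha> (of_real x + \<i> * of_real \<theta>))"
    using ml_symbol_bound[OF a \<theta>] by metis
  have e: "exp (Complex x \<theta>) = - complex_of_real (exp x)" for x
    using \<theta> by (auto simp: complex_eq_iff Re_exp Im_exp)
  show k: "cauchy_kernel \<alpha> s (Complex x \<theta>) = - (ml_symbol \<alpha> (of_real x + \<i> * of_real \<theta>) / of_real (exp x + s))" for x
  proof -
    have "exp (Complex x \<theta>) - of_real s = - of_real (exp x + s)" by (simp add: e)
    then show ?thesis unfolding cauchy_kernel_def by (simp only: Complex_eq divide_minus_right)
  qed
  have ex: "0 < exp x + s" for x using s by (simp add: add_pos_pos)
  have [measurable]: "(\<lambda>x. ml_symbol \<alpha> (of_real x + \<i> * of_real \<theta>)) \<in> borel_measurable borel"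
    using C(4) by (rule borel_measurable_continuous_onI)
  show "integrable lborel (\<lambda>x. cauchy_kernel \<alpha> s (Complex x \<theta>))"
  proof (rule Bochner_Integration.integrable_bound)
    show "integrable lborel (\<lambda>x. C * exp (- \<alpha> * \<bar>x\<bar>))" using integrable_exp_abs[OF a(1)] by simp
    show "AE x in lborel. norm (cauchy_kernel \<alpha> s (Complex x \<theta>)) \<le> norm (C * exp (- \<alpha> * \<bar>x\<bar>))"
    proof (rule AE_I2)
      fix x :: real
      have n: "norm (cauchy_kernel \<alpha> s (Complex x \<theta>)) = cmod (ml_symbol \<alpha> (of_real x + \<i> * of_real \<theta>)) / (exp x + s)"
        unfolding k norm_minus_cancel norm_divide norm_of_real using ex[of x] by simp
      show "norm (cauchy_kernel \<alpha> s (Complex x \<theta>)) \<le> norm (C * exp (- \<alpha> * \<bar>x\<bar>))"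
      proof (cases "x \<le> 0")
        case True
        have "cmod (ml_symbol \<alpha> (of_real x + \<i> * of_real \<theta>)) / (exp x + s) \<le> cmod (ml_symbol \<alpha> (of_real x + \<i> * of_real \<theta>)) / 1"
          using s by (intro divide_left_mono) (auto simp: add_pos_pos intro: order_trans[of _ s])
        then show ?thesis using C(2)[OF True] C(1) n by simp
      next
        case False
        have "cmod (ml_symbol \<alpha> (of_real x + \<i> * of_real \<theta>)) / (exp x + s) \<le> C / exp x"
          using s C(1,3) by (intro frac_le) auto
        also have "\<dots> = C * exp (- 1 * x)" by (simp add: exp_minus divide_inverse)
        also have "\<dots> \<le> C * exp (- \<alpha> * x)" using C(1) a False by simp
        finally show ?thesis using C(1) n False by simp
      qed
    qed
  qed (unfold k, measurable)
qed

lemma cauchy_kernel_vertical_bound: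
  assumes a: "0 < \<alpha>" "\<alpha> \<le> 1" and s: "1 < s" and L: "ln s < L"
  shows "Re w = L \<Longrightarrow> cmod (cauchy_kernel \<alpha> s w) \<le> exp (\<alpha> * L) / (exp (\<alpha> * L) - 1) / (exp L - s)"
    and "Re w = - L \<Longrightarrow> cmod (cauchy_kernel \<alpha> s w) \<le> exp (- \<alpha> * L) / (1 - exp (- \<alpha> * L)) / (s - exp (- L))"
proof -
  let ?l = "(- \<i>) powr of_real \<alpha>"
  have L0: "0 < L" using L s by (smt (verit) ln_gt_zero)
  have sL: "s < exp L" using L s by (metis exp_less_mono exp_ln less_trans zero_less_one)
  have sL': "exp (-L) < s" using L0 s by (smt (verit) exp_less_one_iff)
  have aL: "1 < exp (\<alpha> * L)" "exp (- \<alpha> * L) < 1" using a L0 by auto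
  have n1: "cmod (exp (of_real \<alpha> * w)) = exp (\<alpha> * Re w)" for w by (simp add: norm_exp_eq_Re)
  have n2: "cmod (exp w) = exp (Re w)" for w by (simp add: norm_exp_eq_Re)
  have n: "cmod (cauchy_kernel \<alpha> s w) = exp (\<alpha> * Re w) / cmod (exp (of_real \<alpha> * w) - ?l) / cmod (exp w - of_real s)" for w
    by (simp add: cauchy_kernel_def ml_symbol_def norm_divide norm_mult n1)
  { assume w: "Re w = L"
    have "exp (\<alpha> * L) - 1 \<le> cmod (exp (of_real \<alpha> * w) - ?l)"
      using norm_triangle_ineq2[of "exp (of_real \<alpha> * w)" ?l] w by (simp add: n1)
    moreover have "exp L - s \<le> cmod (exp w - of_real s)"
      using norm_triangle_ineq2[of "exp w" "of_real s"] w s by (simp add: n2)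
    ultimately show "cmod (cauchy_kernel \<alpha> s w) \<le> exp (\<alpha> * L) / (exp (\<alpha> * L) - 1) / (exp L - s)"
      unfolding n w using aL sL by (intro frac_le) auto }
  { assume w: "Re w = - L"
    have "1 - exp (- \<alpha> * L) \<le> cmod (exp (of_real \<alpha> * w) - ?l)"
      using norm_triangle_ineq2[of ?l "exp (of_real \<alpha> * w)"] w by (simp add: n1 norm_minus_commute)
    moreover have "s - exp (- L) \<le> cmod (exp w - of_real s)"
      using norm_triangle_ineq2[of "of_real s" "exp w"] w s by (simp add: n2 norm_minus_commute)
    ultimately show "cmod (cauchy_kernel \<alpha> s w) \<le> exp (- \<alpha> * L) / (1 - exp (- \<alpha> * L)) / (s - exp (- L))"
      unfolding n w using aL sL' by (intro frac_le) auto }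
qed

text \<open>Letting the width of the rectangle tend to infinity, the vertical sides vanish and the
  horizontal ones combine to the integral of the jump. The pole at \<open>ln s\<close> produces the
  left-hand side and the one at height \<open>- pi / 2\<close> the transform of the oscillation.\<close>

lemma stieltjes_identity:
  assumes a: "0 < \<alpha>" "\<alpha> \<le> 1" and s: "1 < s"
  shows "of_real (s powr (\<alpha> - 1)) / (of_real (s powr \<alpha>) - (- \<i>) powr of_real \<alpha>)
    = 1 / (of_real \<alpha> * (of_real s + \<i>)) + (\<integral>x. ml_density \<alpha> x / of_real (exp x + s) \<partial>lborel)"
proof -
  let ?K = "cauchy_kernel \<alpha> s"
  let ?R = "of_real (s powr (\<alpha> - 1)) / (of_real (s powr \<alpha>) - (- \<i>) powr of_real \<alpha>) - 1 / (of_real \<alpha> * (of_real s + \<i>))"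
  let ?b = "\<lambda>n. integral {- real n..real n} (\<lambda>x. ?K (Complex x (-pi)))"
  let ?t = "\<lambda>n. integral {- real n..real n} (\<lambda>x. ?K (Complex x pi))"
  define r where "r = (\<lambda>n. contour_integral (linepath (Complex (real n) (-pi)) (Complex (real n) pi)) ?K)"
  define l where "l = (\<lambda>n. contour_integral (linepath (Complex (- real n) pi) (Complex (- real n) (-pi))) ?K)"
  have split: "2 * of_real pi * \<i> * ?R = ?b n + r n - ?t n + l n
     \<and> cmod (r n) \<le> exp (\<alpha> * real n) / (exp (\<alpha> * real n) - 1) / (exp (real n) - s) * (2 * pi)
     \<and> cmod (l n) \<le> exp (- \<alpha> * real n) / (1 - exp (- \<alpha> * real n)) / (s - exp (- real n)) * (2 * pi)"
    if n: "ln s < real n" for n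
  proof -
    let ?L = "real n"
    let ?g = "rectpath (Complex (-?L) (-pi)) (Complex ?L pi)"
    have L0: "0 < ?L" using n s by (smt (verit) ln_gt_zero)
    have cont: "continuous_on (path_image ?g) ?K"
      by (rule holomorphic_on_imp_continuous_on, rule holomorphic_on_subset[OF cauchy_kernel_holomorphic[OF a, of s]])
        (use s contour_integral_rectangle(2)[OF a s n] in auto)
    have img: "path_image ?g = closed_segment (Complex (-?L) (-pi)) (Complex ?L (-pi)) \<union> closed_segment (Complex ?L (-pi)) (Complex ?L pi)
       \<union> closed_segment (Complex ?L pi) (Complex (-?L) pi) \<union> closed_segment (Complex (-?L) pi) (Complex (-?L) (-pi))"
      by (simp add: rectpath_def Let_def path_image_join Un_assoc)
    have i1: "?K contour_integrable_on linepath (Complex (-?L) (-pi)) (Complex ?L (-pi))"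
      and i2: "?K contour_integrable_on linepath (Complex ?L (-pi)) (Complex ?L pi)"
      and i3: "?K contour_integrable_on linepath (Complex ?L pi) (Complex (-?L) pi)"
      and i4: "?K contour_integrable_on linepath (Complex (-?L) pi) (Complex (-?L) (-pi))"
      by (auto intro!: contour_integrable_continuous_linepath continuous_on_subset[OF cont] simp: img)
    have "contour_integral ?g ?K = contour_integral (linepath (Complex (-?L) (-pi)) (Complex ?L (-pi))) ?K
      + (r n + (contour_integral (linepath (Complex ?L pi) (Complex (-?L) pi)) ?K + l n))"
      unfolding rectpath_def Let_def r_def l_def using i1 i2 i3 i4
      by (simp add: contour_integrable_joinI)
    also have "contour_integral (linepath (Complex ?L pi) (Complex (-?L) pi)) ?K = - contour_integral (linepath (Complex (-?L) pi) (Complex ?L pi)) ?K"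
      using contour_integral_reversepath[of "linepath (Complex (-?L) pi) (Complex ?L pi)" ?K] by simp
    also have "contour_integral (linepath (Complex (-?L) pi) (Complex ?L pi)) ?K = ?t n"
      by (rule contour_integral_linepath_horizontal) (use L0 in simp)
    also have "contour_integral (linepath (Complex (-?L) (-pi)) (Complex ?L (-pi))) ?K = ?b n"
      by (rule contour_integral_linepath_horizontal) (use L0 in simp)
    finally have 1: "2 * of_real pi * \<i> * ?R = ?b n + r n - ?t n + l n"
      unfolding contour_integral_rectangle(1)[OF a s n] by (simp add: algebra_simps)
    have sL: "s < exp ?L" using n s by (metis exp_less_mono exp_ln less_trans zero_less_one)
    have sL': "exp (-?L) < s" using L0 s by (smt (verit) exp_less_one_iff)
    have aL: "1 < exp (\<alpha> * ?L)" "exp (- \<alpha> * ?L) < 1" using a L0 by auto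
    have d1: "cmod (Complex ?L pi - Complex ?L (-pi)) = 2 * pi" by (simp add: cmod_def real_sqrt_mult)
    have d2: "cmod (Complex (-?L) (-pi) - Complex (-?L) pi) = 2 * pi" by (simp add: cmod_def real_sqrt_mult)
    have 2: "cmod (r n) \<le> exp (\<alpha> * ?L) / (exp (\<alpha> * ?L) - 1) / (exp ?L - s) * (2 * pi)"
      unfolding r_def d1[symmetric]
    proof (rule contour_integral_bound_linepath[OF i2])
      show "0 \<le> exp (\<alpha> * ?L) / (exp (\<alpha> * ?L) - 1) / (exp ?L - s)" using aL sL by simp
      show "cmod (?K w) \<le> exp (\<alpha> * ?L) / (exp (\<alpha> * ?L) - 1) / (exp ?L - s)" if "w \<in> closed_segment (Complex ?L (-pi)) (Complex ?L pi)" for w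
        using that by (intro cauchy_kernel_vertical_bound[OF a s n]) (simp add: closed_segment_same_Re)
    qed
    have 3: "cmod (l n) \<le> exp (- \<alpha> * ?L) / (1 - exp (- \<alpha> * ?L)) / (s - exp (- ?L)) * (2 * pi)"
      unfolding l_def d2[symmetric]
    proof (rule contour_integral_bound_linepath[OF i4])
      show "0 \<le> exp (- \<alpha> * ?L) / (1 - exp (- \<alpha> * ?L)) / (s - exp (- ?L))" using aL sL' by simp
      show "cmod (?K w) \<le> exp (- \<alpha> * ?L) / (1 - exp (- \<alpha> * ?L)) / (s - exp (- ?L))" if "w \<in> closed_segment (Complex (-?L) pi) (Complex (-?L) (-pi))" for w
        using that by (intro cauchy_kernel_vertical_bound[OF a s n]) (simp add: closed_segment_same_Re)
    qed
    show ?thesis using 1 2 3 by blast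
  qed
  have ev: "\<forall>\<^sub>F n in sequentially. ln s < real n"
    using filterlim_real_sequentially by (simp add: filterlim_at_top_dense)
  have r0: "r \<longlonglongrightarrow> 0"
  proof (rule Lim_null_comparison)
    show "\<forall>\<^sub>F n in sequentially. norm (r n) \<le> exp (\<alpha> * real n) / (exp (\<alpha> * real n) - 1) / (exp (real n) - s) * (2 * pi)"
      using ev by eventually_elim (use split in blast)
    show "(\<lambda>n. exp (\<alpha> * real n) / (exp (\<alpha> * real n) - 1) / (exp (real n) - s) * (2 * pi)) \<longlonglongrightarrow> 0"
      using a s by real_asymp
  qed
  have l0: "l \<longlonglongrightarrow> 0"
  proof (rule Lim_null_comparison)
    show "\<forall>\<^sub>F n in sequentially. norm (l n) \<le> exp (- \<alpha> * real n) / (1 - exp (- \<alpha> * real n)) / (s - exp (- real n)) * (2 * pi)"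
      using ev by eventually_elim (use split in blast)
    show "(\<lambda>n. exp (- \<alpha> * real n) / (1 - exp (- \<alpha> * real n)) / (s - exp (- real n)) * (2 * pi)) \<longlonglongrightarrow> 0"
      using a s by real_asymp
  qed
  note hm = cauchy_kernel_horizontal_integrable[OF a s disjI2[OF refl]] and hp = cauchy_kernel_horizontal_integrable[OF a s disjI1[OF refl]]
  have hm1: "integrable lborel (\<lambda>x. ?K (Complex x (-pi)))" and hp1: "integrable lborel (\<lambda>x. ?K (Complex x pi))"
    using hm hp by auto
  have "(\<lambda>n. ?b n + r n - ?t n + l n) \<longlonglongrightarrow> (\<integral>x. ?K (Complex x (-pi)) \<partial>lborel) + 0 - (\<integral>x. ?K (Complex x pi) \<partial>lborel) + 0"
    by (intro tendsto_intros integral_symmetric_limit hm1 hp1 r0 l0)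
  moreover have "(\<lambda>n. ?b n + r n - ?t n + l n) \<longlonglongrightarrow> 2 * of_real pi * \<i> * ?R"
    by (rule tendsto_eventually) (use ev split in \<open>auto elim!: eventually_mono\<close>)
  ultimately have "2 * of_real pi * \<i> * ?R = (\<integral>x. ?K (Complex x (-pi)) \<partial>lborel) - (\<integral>x. ?K (Complex x pi) \<partial>lborel)"
    using LIMSEQ_unique by force
  also have "\<dots> = (\<integral>x. ?K (Complex x (-pi)) - ?K (Complex x pi) \<partial>lborel)"
    using hm1 hp1 by simp
  also have "\<dots> = (\<integral>x. 2 * of_real pi * \<i> * (ml_density \<alpha> x / of_real (exp x + s)) \<partial>lborel)"
  proof (rule Bochner_Integration.integral_cong[OF refl])
    fix x
    show "?K (Complex x (-pi)) - ?K (Complex x pi) = 2 * of_real pi * \<i> * (ml_density \<alpha> x / of_real (exp x + s))"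
    proof -
      have gen: "- (m / X) - - (p / X) = c * ((p - m) / c / X)" if "c \<noteq> 0" for m p X c :: complex
      proof -
        have e1: "c * ((p - m) / c / X) = (p - m) / X" using that by simp
        have e2: "- (m / X) - - (p / X) = (p - m) / X" by (simp add: diff_divide_distrib)
        show ?thesis by (simp only: e1 e2)
      qed
      have m: "complex_of_real x + \<i> * complex_of_real (-pi) = of_real x - \<i> * of_real pi" by simp
      show ?thesis unfolding hm(2) hp(2) ml_density_def m by (rule gen) simp
    qed
  qed
  also have "\<dots> = 2 * of_real pi * \<i> * (\<integral>x. ml_density \<alpha> x / of_real (exp x + s) \<partial>lborel)"
    by (rule integral_mult_right_zero)
  finally have "?R = (\<integral>x. ml_density \<alpha> x / of_real (exp x + s) \<partial>lborel)"
    by simp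
  then show ?thesis by (simp add: algebra_simps)
qed

section \<open>The Mittag-Leffler function on the border of the growth sector\<close>

definition ml_remainder :: "real \<Rightarrow> real \<Rightarrow> complex" where
  "ml_remainder \<alpha> t = (\<integral>x. ml_density \<alpha> x * of_real (exp (- (t * exp x))) \<partial>lborel)"

lemma ml_density_weighted_integrable:
  assumes a: "0 < \<alpha>" "\<alpha> \<le> 1" and p: "0 \<le> p" "p < \<alpha>"
  shows "integrable lborel (\<lambda>x. cmod (ml_density \<alpha> x) * exp (p * x))"
proof -
  note [measurable] = ml_density_measurable[OF a]
  obtain C where C: "0 < C" "\<And>x. cmod (ml_density \<alpha> x) \<le> C * exp (- \<alpha> * \<bar>x\<bar>)"
    using ml_density_bound[OF a] by metis
  show ?thesis
  proof (rule Bochner_Integration.integrable_bound)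
    show "integrable lborel (\<lambda>x. C * exp (- (\<alpha> - p) * \<bar>x\<bar>))" 
      using integrable_exp_abs[of "\<alpha> - p"] p by simp
    show "AE x in lborel. norm (cmod (ml_density \<alpha> x) * exp (p * x)) \<le> norm (C * exp (- (\<alpha> - p) * \<bar>x\<bar>))"
    proof (rule AE_I2)
      fix x :: real
      have "cmod (ml_density \<alpha> x) * exp (p * x) \<le> (C * exp (- \<alpha> * \<bar>x\<bar>)) * exp (p * \<bar>x\<bar>)"
        using p C by (intro mult_mono) (auto intro: mult_left_mono)
      also have "\<dots> = C * exp (- (\<alpha> - p) * \<bar>x\<bar>)" by (simp add: exp_add[symmetric] algebra_simps)
      finally show "norm (cmod (ml_density \<alpha> x) * exp (p * x)) \<le> norm (C * exp (- (\<alpha> - p) * \<bar>x\<bar>))"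
        using C(1) by simp
    qed
  qed measurable
qed

lemma ml_density_integrable:
  assumes a: "0 < \<alpha>" "\<alpha> \<le> 1"
  shows "integrable lborel (ml_density \<alpha>)"
proof -
  have [measurable]: "ml_density \<alpha> \<in> borel_measurable borel" by (rule ml_density_measurable[OF a])
  show ?thesis using ml_density_weighted_integrable[OF a, of 0] a by (simp add: integrable_norm_iff)
qed

lemma ml_remainder_integrable:
  assumes a: "0 < \<alpha>" "\<alpha> \<le> 1" and t: "0 \<le> t"
  shows "integrable lborel (\<lambda>x. ml_density \<alpha> x * of_real (exp (- (t * exp x))))"
proof (rule Bochner_Integration.integrable_bound[OF ml_density_integrable[OF a]])
  note [measurable] = ml_density_measurable[OF a]
  show "(\<lambda>x. ml_density \<alpha> x * of_real (exp (- (t * exp x)))) \<in> borel_measurable lborel" by measurable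
  show "AE x in lborel. norm (ml_density \<alpha> x * of_real (exp (- (t * exp x)))) \<le> norm (ml_density \<alpha> x)"
    using t by (auto simp: norm_mult intro!: mult_left_le)
qed

lemma ml_remainder_bounded:
  assumes a: "0 < \<alpha>" "\<alpha> \<le> 1" and t: "0 \<le> t"
  shows "cmod (ml_remainder \<alpha> t) \<le> (\<integral>x. cmod (ml_density \<alpha> x) \<partial>lborel)"
  unfolding ml_remainder_def
proof (rule Bochner_Integration.integral_norm_bound_integral[OF ml_remainder_integrable[OF a t]])
  show "integrable lborel (\<lambda>x. cmod (ml_density \<alpha> x))" using ml_density_integrable[OF a] by simp
  show "cmod (ml_density \<alpha> x * of_real (exp (- (t * exp x)))) \<le> cmod (ml_density \<alpha> x)" for x
    using t by (auto simp: norm_mult intro!: mult_left_le)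
qed

lemma ml_remainder_continuous:
  assumes a: "0 < \<alpha>" "\<alpha> \<le> 1"
  shows "continuous_on {0<..} (ml_remainder \<alpha>)"
proof (rule continuous_on_sequentiallyI)
  fix u :: "nat \<Rightarrow> real" and t assume u: "\<forall>n. u n \<in> {0<..}" "t \<in> {0<..}" "u \<longlonglongrightarrow> t"
  note [measurable] = ml_density_measurable[OF a]
  show "(\<lambda>n. ml_remainder \<alpha> (u n)) \<longlonglongrightarrow> ml_remainder \<alpha> t"
    unfolding ml_remainder_def
  proof (rule integral_dominated_convergence[where w="\<lambda>x. cmod (ml_density \<alpha> x)"])
    show "integrable lborel (\<lambda>x. cmod (ml_density \<alpha> x))" using ml_density_integrable[OF a] by simp
    show "AE x in lborel. (\<lambda>n. ml_density \<alpha> x * of_real (exp (- (u n * exp x)))) \<longlonglongrightarrow> ml_density \<alpha> x * of_real (exp (- (t * exp x)))"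
      using u(3) by (auto intro!: tendsto_intros)
    show "AE x in lborel. norm (ml_density \<alpha> x * of_real (exp (- (u n * exp x)))) \<le> cmod (ml_density \<alpha> x)" for n
      using u(1) by (auto simp: norm_mult less_imp_le intro!: mult_left_le)
  qed measurable
qed

lemma ml_remainder_laplace:
  assumes a: "0 < \<alpha>" "\<alpha> \<le> 1" and s: "0 < s"
  shows "has_bochner_integral lborel (\<lambda>t. indicator {0<..} t *\<^sub>R (exp (- complex_of_real (s * t)) * ml_remainder \<alpha> t))
    (\<integral>x. ml_density \<alpha> x / of_real (exp x + s) \<partial>lborel)"
proof -
  note [measurable] = ml_density_measurable[OF a]
  let ?w = "\<lambda>t. indicator {0<..} t *\<^sub>R exp (- (s * t)) :: real"
  let ?F = "\<lambda>t x. complex_of_real (?w t) * (ml_density \<alpha> x * of_real (exp (- (t * exp x))))"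
  have g: "has_bochner_integral lborel (\<lambda>t. indicator {0<..} t *\<^sub>R exp (- (r * t))) (1 / r)" if "0 < r" for r :: real
  proof -
    have e: "(\<lambda>t::real. indicator {0<..} t *\<^sub>R (t powr 0 * exp (- (r * t)))) = (\<lambda>t. indicator {0<..} t *\<^sub>R exp (- (r * t)))"
      by (auto simp: indicator_def)
    show ?thesis using has_bochner_integral_Gamma[of 0 r] that unfolding e by simp
  qed
  have iw: "integrable lborel (\<lambda>t. complex_of_real (?w t))"
    using g[OF s] unfolding has_bochner_integral_iff by (intro integrable_of_real) blast
  have int: "integrable (lborel \<Otimes>\<^sub>M lborel) (\<lambda>(t, x). ?F t x)"
  proof (rule Bochner_Integration.integrable_bound[OF integrable_pair_product[OF iw ml_density_integrable[OF a]]])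
    show "AE p in lborel \<Otimes>\<^sub>M lborel. norm (case p of (t, x) \<Rightarrow> ?F t x) \<le> norm (case p of (t, x) \<Rightarrow> complex_of_real (?w t) * ml_density \<alpha> x)"
      by (rule AE_I2) (auto simp: norm_mult indicator_def intro!: mult_left_le)
  qed measurable
  have inner: "(\<integral>x. ?F t x \<partial>lborel) = indicator {0<..} t *\<^sub>R (exp (- complex_of_real (s * t)) * ml_remainder \<alpha> t)" for t
  proof -
    have e: "exp (- complex_of_real (s * t)) = complex_of_real (exp (- (s * t)))"
      by (metis exp_of_real of_real_minus)
    show ?thesis unfolding integral_mult_right_zero ml_remainder_def[symmetric] e by (simp add: scaleR_conv_of_real)
  qed
  have "integrable lborel (\<lambda>t. \<integral>x. ?F t x \<partial>lborel)"
    using lborel_pair.integrable_fst'[OF int] by simp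
  moreover have "(\<integral>t. (\<integral>x. ?F t x \<partial>lborel) \<partial>lborel) = (\<integral>x. ml_density \<alpha> x / of_real (exp x + s) \<partial>lborel)"
  proof -
    have "(\<integral>t. (\<integral>x. ?F t x \<partial>lborel) \<partial>lborel) = (\<integral>x. (\<integral>t. ?F t x \<partial>lborel) \<partial>lborel)"
      by (rule lborel_pair.Fubini_integral[OF int, symmetric])
    also have "\<dots> = (\<integral>x. ml_density \<alpha> x / of_real (exp x + s) \<partial>lborel)"
    proof (rule Bochner_Integration.integral_cong[OF refl])
      fix x
      have p: "0 < exp x + s" using s by (simp add: add_pos_pos)
      have F: "(\<lambda>t. ?F t x) = (\<lambda>t. ml_density \<alpha> x * complex_of_real (indicator {0<..} t *\<^sub>R exp (- ((exp x + s) * t))))"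
        by (auto simp: indicator_def exp_add[symmetric] algebra_simps simp flip: of_real_mult)
      have "(\<integral>t. ?F t x \<partial>lborel) = ml_density \<alpha> x * complex_of_real (1 / (exp x + s))"
        unfolding F by (intro has_bochner_integral_integral_eq has_bochner_integral_mult_right has_bochner_integral_of_real g p)
      then show "(\<integral>t. ?F t x \<partial>lborel) = ml_density \<alpha> x / of_real (exp x + s)" by simp
    qed
    finally show ?thesis .
  qed
  ultimately show ?thesis unfolding has_bochner_integral_iff inner by blast
qed

text \<open>Both sides are continuous on the positive axis, and by \<open>stieltjes_identity\<close> they have the
  same Laplace transform at every \<open>s > 1\<close>.\<close>

theorem mittag_leffler_decomposition:
  assumes a: "0 < \<alpha>" "\<alpha> \<le> 1" and t: "0 < t"
  shows "mittag_leffler \<alpha> 1 ((- \<i>) powr of_real \<alpha> * of_real (t powr \<alpha>))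
    = exp (- (\<i> * of_real t)) / of_real \<alpha> + ml_remainder \<alpha> t"
proof -
  let ?l = "(- \<i>) powr of_real \<alpha>"
  let ?y = "\<lambda>t. mittag_leffler \<alpha> 1 (?l * of_real (t powr \<alpha>))"
  let ?g = "\<lambda>t. ?y t - exp (- (\<i> * of_real t)) / of_real \<alpha> - ml_remainder \<alpha> t"
  have "?g t = 0"
  proof (rule laplace_unique[OF _ _ t])
    have "continuous_on {0<..} ?y"
      by (rule continuous_on_compose2[OF mittag_leffler_continuous(1)[OF a(1), of UNIV]])
        (auto intro!: continuous_intros)
    then show "continuous_on {0<..} ?g"
      using a by (intro continuous_intros ml_remainder_continuous) auto
    fix n :: nat assume n: "2 \<le> n"
    then have s: "1 < real n" by simp
    let ?L = "\<lambda>f t. indicator {0<..} t *\<^sub>R (exp (- complex_of_real (real n * t)) * f t)"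
    have 1: "has_bochner_integral lborel (?L ?y) (of_real (real n powr (\<alpha> - 1)) / (of_real (real n powr \<alpha>) - ?l))"
      by (rule mittag_leffler_laplace) (use a s in auto)
    \<comment> \<open>The transform of \<open>exp (-\<i> t)\<close> is the case \<open>\<alpha> = 1\<close> of the same lemma.\<close>
    have "has_bochner_integral lborel (?L (\<lambda>t. mittag_leffler 1 1 (- \<i> * complex_of_real (t powr 1))))
       (of_real (real n powr (1 - 1)) / (of_real (real n powr 1) - (- \<i>)))"
      by (rule mittag_leffler_laplace) (use s in auto)
    moreover have e: "?L (\<lambda>t. mittag_leffler 1 1 (- \<i> * complex_of_real (t powr 1))) = ?L (\<lambda>t. exp (- (\<i> * of_real t)))"
      by (auto simp: mittag_leffler_one indicator_def fun_eq_iff)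
    ultimately have 2: "has_bochner_integral lborel (?L (\<lambda>t. exp (- (\<i> * of_real t)))) (1 / (of_real (real n) + \<i>))"
      using s unfolding e by simp
    have 3: "has_bochner_integral lborel (?L (ml_remainder \<alpha>)) (\<integral>x. ml_density \<alpha> x / of_real (exp x + real n) \<partial>lborel)"
      by (rule ml_remainder_laplace) (use a s in auto)
    have 4: "has_bochner_integral lborel (\<lambda>t. 1 / of_real \<alpha> * ?L (\<lambda>t. exp (- (\<i> * of_real t))) t) (1 / of_real \<alpha> * (1 / (of_real (real n) + \<i>)))"
      by (rule has_bochner_integral_mult_right) (rule 2)
    have v: "of_real (real n powr (\<alpha> - 1)) / (of_real (real n powr \<alpha>) - ?l) - 1 / of_real \<alpha> * (1 / (of_real (real n) + \<i>)) - (\<integral>x. ml_density \<alpha> x / of_real (exp x + real n) \<partial>lborel) = 0"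
      using stieltjes_identity[OF a s] by simp
    have f: "?L ?y t - 1 / of_real \<alpha> * ?L (\<lambda>t. exp (- (\<i> * of_real t))) t - ?L (ml_remainder \<alpha>) t = ?L ?g t" for t
      by (simp add: indicator_def algebra_simps)
    from has_bochner_integral_diff[OF has_bochner_integral_diff[OF 1 4] 3]
    show "has_bochner_integral lborel (?L ?g) 0" unfolding f v .
  qed
  then show ?thesis by (simp add: algebra_simps)
qed

lemma mult_exp_minus_bound:
  fixes u p :: real
  assumes "0 < u" "0 \<le> p" "p \<le> 1"
  shows "u * exp (- u) \<le> min 1 (u powr p)"
proof -
  have e: "u \<le> exp u" using exp_ge_add_one_self[of u] by linarith
  then have 1: "u * exp (- u) \<le> 1" by (simp add: exp_minus divide_inverse[symmetric])
  moreover have "u * exp (- u) \<le> u powr p"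
  proof (cases "u \<le> 1")
    case True
    have "u * exp (- u) \<le> u * 1" using assms by (intro mult_left_mono) auto
    also have "u * 1 = u powr 1" using assms by simp
    also have "\<dots> \<le> u powr p" using True assms by (intro powr_mono') auto
    finally show ?thesis .
  next
    case False
    then have "1 \<le> u powr p" using assms by (intro ge_one_powr_ge_zero) auto
    then show ?thesis using 1 by linarith
  qed
  ultimately show ?thesis by simp
qed

text \<open>A bound for the derivative of the remainder, phrased for increments to avoid differentiating
  under the integral. The two bounds for \<open>u * exp (-u)\<close> at \<open>u = t * exp x\<close> leave the weights \<open>1\<close>
  and \<open>exp (\<alpha> * x / 2)\<close>, both integrable against the density.\<close>

lemma ml_remainder_increment:
  assumes a: "0 < \<alpha>" "\<alpha> \<le> 1"
  obtains C where "0 \<le> C" "\<And>t h. 0 < t \<Longrightarrow> 0 < h \<Longrightarrow>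
    cmod (ml_remainder \<alpha> (t + h) - ml_remainder \<alpha> t) \<le> h / t * (C * min 1 (t powr (\<alpha> / 2)))"
proof -
  note [measurable] = ml_density_measurable[OF a]
  define W where "W = (\<lambda>x. cmod (ml_density \<alpha> x) * exp (0 * x) + cmod (ml_density \<alpha> x) * exp (\<alpha> / 2 * x))"
  have W: "integrable lborel W" unfolding W_def
    by (intro Bochner_Integration.integrable_add ml_density_weighted_integrable a) (use a in auto)
  have W0: "0 \<le> W x" for x by (simp add: W_def)
  define C where "C = (\<integral>x. W x \<partial>lborel)"
  have "0 \<le> C" unfolding C_def using W0 by (intro integral_nonneg_AE) auto
  moreover have "cmod (ml_remainder \<alpha> (t + h) - ml_remainder \<alpha> t) \<le> h / t * (C * min 1 (t powr (\<alpha> / 2)))"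
    if t: "0 < t" and h: "0 < h" for t h
  proof -
    let ?k = "ml_density \<alpha>"
    let ?E = "\<lambda>t x. ?k x * of_real (exp (- (t * exp x)))"
    have i: "integrable lborel (?E t)" "integrable lborel (?E (t + h))"
      using ml_remainder_integrable[OF a] t h by auto
    have "ml_remainder \<alpha> (t + h) - ml_remainder \<alpha> t = (\<integral>x. ?E (t + h) x - ?E t x \<partial>lborel)"
      unfolding ml_remainder_def using i by simp
    also have "cmod \<dots> \<le> (\<integral>x. h / t * min 1 (t powr (\<alpha> / 2)) * W x \<partial>lborel)"
    proof (rule Bochner_Integration.integral_norm_bound_integral)
      fix x
      define u where "u = t * exp x"
      have u: "0 < u" using t by (simp add: u_def)
      have "?E (t + h) x - ?E t x = ?k x * of_real (exp (- ((t + h) * exp x)) - exp (- u))"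
        by (simp add: u_def algebra_simps)
      then have "cmod (?E (t + h) x - ?E t x) = cmod (?k x) * \<bar>exp (- ((t + h) * exp x)) - exp (- u)\<bar>"
        by (simp only: norm_mult norm_of_real)
      also have "exp (- ((t + h) * exp x)) - exp (- u) = - (exp (- u) * (1 - exp (- (h * exp x))))"
        by (simp add: u_def exp_add[symmetric] algebra_simps)
      also have "\<bar>\<dots>\<bar> = exp (- u) * (1 - exp (- (h * exp x)))"
        using h by (simp add: abs_mult)
      also have "cmod (?k x) * \<dots> \<le> cmod (?k x) * (exp (- u) * (h * exp x))"
        using exp_ge_add_one_self[of "- (h * exp x)"] by (intro mult_left_mono) auto
      also have "\<dots> = cmod (?k x) * (h / t * (u * exp (- u)))"
        using t by (simp add: u_def)
      also have "\<dots> \<le> cmod (?k x) * (h / t * min 1 (u powr (\<alpha> / 2)))"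
        using mult_exp_minus_bound[OF u, of "\<alpha> / 2"] a t h by (intro mult_left_mono) auto
      also have "u powr (\<alpha> / 2) = t powr (\<alpha> / 2) * exp (\<alpha> / 2 * x)"
        using t by (simp add: u_def powr_mult exp_powr_real mult.commute)
      also have "cmod (?k x) * (h / t * min 1 (t powr (\<alpha> / 2) * exp (\<alpha> / 2 * x)))
          \<le> cmod (?k x) * (h / t * (min 1 (t powr (\<alpha> / 2)) * (1 + exp (\<alpha> / 2 * x))))"
      proof (intro mult_left_mono)
        have "min 1 (A * B) \<le> min 1 A * (1 + B)" if "0 \<le> A" "0 \<le> B" for A B :: real
          using that by (auto simp: min_def algebra_simps)
        then show "min 1 (t powr (\<alpha> / 2) * exp (\<alpha> / 2 * x)) \<le> min 1 (t powr (\<alpha> / 2)) * (1 + exp (\<alpha> / 2 * x))"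
          by simp
      qed (use t h in auto)
      also have "\<dots> = h / t * min 1 (t powr (\<alpha> / 2)) * W x"
        by (simp add: W_def algebra_simps)
      finally show "cmod (?E (t + h) x - ?E t x) \<le> h / t * min 1 (t powr (\<alpha> / 2)) * W x" .
    qed (use i W in auto)
    also have "\<dots> = h / t * (C * min 1 (t powr (\<alpha> / 2)))" by (simp add: C_def)
    finally show ?thesis .
  qed
  ultimately show ?thesis using that by blast
qed

text \<open>As \<open>z' t = \<alpha> * z t / t\<close>, the product of the derivative of the Mittag-Leffler function with
  \<open>z t\<close> is \<open>t / \<alpha>\<close> times the \<open>t\<close>-derivative of the function in \<open>mittag_leffler_decomposition\<close>.\<close>

theorem mittag_leffler_asymptotics:
  assumes a: "0 < \<alpha>" "\<alpha> \<le> 1"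
  defines "z \<equiv> \<lambda>t. (- \<i>) powr of_real \<alpha> * complex_of_real (t powr \<alpha>)"
  obtains C where "0 \<le> C"
    "\<And>t. 0 < t \<Longrightarrow> cmod (mittag_leffler \<alpha> 1 (z t)) \<le> C"
    "\<And>t. 0 < t \<Longrightarrow> cmod (deriv (mittag_leffler \<alpha> 1) (z t) * z t + \<i> / of_real (\<alpha>\<^sup>2) * of_real t * exp (- (\<i> * of_real t)))
       \<le> C * min 1 (t powr (\<alpha> / 2))"
proof -
  let ?E = "mittag_leffler \<alpha> 1" and ?e = "\<lambda>t. exp (- (\<i> * complex_of_real t))"
  define K where "K = (\<integral>x. cmod (ml_density \<alpha> x) \<partial>lborel)"
  have K: "0 \<le> K" by (simp add: K_def)
  obtain C where C: "0 \<le> C" "\<And>t h. 0 < t \<Longrightarrow> 0 < h \<Longrightarrow>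
    cmod (ml_remainder \<alpha> (t + h) - ml_remainder \<alpha> t) \<le> h / t * (C * min 1 (t powr (\<alpha> / 2)))"
    using ml_remainder_increment[OF a] by metis
  have D: "?E (z t) = ?e t / of_real \<alpha> + ml_remainder \<alpha> t" if "0 < t" for t
    unfolding z_def by (rule mittag_leffler_decomposition[OF a that])
  define C' where "C' = 1 / \<alpha> + K + C / \<alpha>"
  have b1: "cmod (?E (z t)) \<le> C'" if t: "0 < t" for t
  proof -
    have "cmod (?E (z t)) \<le> cmod (?e t / of_real \<alpha>) + cmod (ml_remainder \<alpha> t)"
      unfolding D[OF t] by (rule norm_triangle_ineq)
    also have "\<dots> \<le> 1 / \<alpha> + K"
      using ml_remainder_bounded[OF a, of t] t a by (simp add: norm_divide K_def)
    finally show ?thesis using C(1) a by (simp add: C'_def add_increasing2)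
  qed
  have b2: "cmod (deriv ?E (z t) * z t + \<i> / of_real (\<alpha>\<^sup>2) * of_real t * ?e t) \<le> C' * min 1 (t powr (\<alpha> / 2))" if t: "0 < t" for t
  proof -
    define y' where "y' = deriv ?E (z t) * ((- \<i>) powr of_real \<alpha> * of_real (\<alpha> * t powr (\<alpha> - 1)))"
    have zd: "(z has_vector_derivative (- \<i>) powr of_real \<alpha> * of_real (\<alpha> * t powr (\<alpha> - 1))) (at t)"
      unfolding z_def
      by (intro has_vector_derivative_mult_right has_vector_derivative_of_real)
         (use t in \<open>auto intro!: derivative_eq_intros simp: has_real_derivative_iff_has_vector_derivative[symmetric]\<close>)
    have yd: "((\<lambda>t. ?E (z t)) has_vector_derivative y') (at t)"
      using field_vector_diff_chain_at[OF zd mittag_leffler_deriv[OF a(1)]] unfolding y'_def o_def by (simp add: mult.commute)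
    have "(?e has_vector_derivative (- \<i> * ?e t)) (at t)"
      by (rule has_vector_derivative_real_field) (auto intro!: derivative_eq_intros)
    from has_vector_derivative_divide[OF this, of "of_real \<alpha>"]
    have ed: "((\<lambda>t. ?e t / of_real \<alpha>) has_vector_derivative (- \<i> * ?e t / of_real \<alpha>)) (at t)" .
    have "((\<lambda>t. ?E (z t) - ?e t / of_real \<alpha>) has_vector_derivative (y' - (- \<i> * ?e t / of_real \<alpha>))) (at t)"
      by (rule has_vector_derivative_diff[OF yd ed])
    then have rd: "(ml_remainder \<alpha> has_vector_derivative (y' - (- \<i> * ?e t / of_real \<alpha>))) (at t)"
      by (rule has_vector_derivative_transform_within_open[where S="{0<..}"]) (use t D in auto)
    have h0: "(\<lambda>n. 1 / real (Suc n)) \<longlonglongrightarrow> 0" by real_asymp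
    have "(\<lambda>n. (ml_remainder \<alpha> (t + 1 / real (Suc n)) - ml_remainder \<alpha> t) / complex_of_real (1 / real (Suc n))) \<longlonglongrightarrow> y' - (- \<i> * ?e t / of_real \<alpha>)"
      by (rule vector_derivative_difference_quotient[OF rd h0]) simp
    then have "(\<lambda>n. cmod ((ml_remainder \<alpha> (t + 1 / real (Suc n)) - ml_remainder \<alpha> t) / complex_of_real (1 / real (Suc n)))) \<longlonglongrightarrow> cmod (y' - (- \<i> * ?e t / of_real \<alpha>))"
      by (rule tendsto_norm)
    then have rb: "cmod (y' - (- \<i> * ?e t / of_real \<alpha>)) \<le> C * min 1 (t powr (\<alpha> / 2)) / t"
    proof (rule tendsto_upperbound)
      show "\<forall>\<^sub>F n in sequentially. cmod ((ml_remainder \<alpha> (t + 1 / real (Suc n)) - ml_remainder \<alpha> t) / complex_of_real (1 / real (Suc n))) \<le> C * min 1 (t powr (\<alpha> / 2)) / t"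
      proof (rule always_eventually, rule allI)
        fix n
        let ?h = "1 / real (Suc n)"
        have h: "0 < ?h" by simp
        have "cmod ((ml_remainder \<alpha> (t + ?h) - ml_remainder \<alpha> t) / complex_of_real ?h) = cmod (ml_remainder \<alpha> (t + ?h) - ml_remainder \<alpha> t) / ?h"
          by (simp only: norm_divide norm_of_real abs_of_pos[OF h])
        also have "\<dots> \<le> (?h / t * (C * min 1 (t powr (\<alpha> / 2)))) / ?h"
          by (rule divide_right_mono[OF C(2)[OF t h]]) simp
        also have "\<dots> = C * min 1 (t powr (\<alpha> / 2)) / t" by simp
        finally show "cmod ((ml_remainder \<alpha> (t + ?h) - ml_remainder \<alpha> t) / complex_of_real ?h) \<le> C * min 1 (t powr (\<alpha> / 2)) / t" .
      qed
    qed simp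
    have "deriv ?E (z t) * z t + \<i> / of_real (\<alpha>\<^sup>2) * of_real t * ?e t = of_real (t / \<alpha>) * (y' - (- \<i> * ?e t / of_real \<alpha>))"
    proof -
      have "t powr \<alpha> = t / \<alpha> * (\<alpha> * t powr (\<alpha> - 1))" using t a by (simp add: powr_diff)
      then have "z t = of_real (t / \<alpha>) * ((- \<i>) powr of_real \<alpha> * of_real (\<alpha> * t powr (\<alpha> - 1)))"
        unfolding z_def by (metis mult.left_commute of_real_mult)
      then have "deriv ?E (z t) * z t = of_real (t / \<alpha>) * y'" unfolding y'_def by (simp only: mult.left_commute)
      then show ?thesis using a by (simp add: power2_eq_square field_simps)
    qed
    then have "cmod (deriv ?E (z t) * z t + \<i> / of_real (\<alpha>\<^sup>2) * of_real t * ?e t) = t / \<alpha> * cmod (y' - (- \<i> * ?e t / of_real \<alpha>))"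
      using t a by (simp only: norm_mult norm_of_real) simp
    also have "\<dots> \<le> t / \<alpha> * (C * min 1 (t powr (\<alpha> / 2)) / t)"
      using t a by (intro mult_left_mono rb) auto
    also have "\<dots> = C / \<alpha> * min 1 (t powr (\<alpha> / 2))" using t by simp
    also have "\<dots> \<le> C' * min 1 (t powr (\<alpha> / 2))"
      using K a by (intro mult_right_mono) (auto simp: C'_def)
    finally show ?thesis .
  qed
  have "0 \<le> C'" using K C(1) a by (simp add: C'_def)
  with b1 b2 show ?thesis using that by blast
qed

section \<open>The mean square displacement\<close>

lemma L2norm_square: "(L2norm f)\<^sup>2 = (\<integral>x. (cmod (f x))\<^sup>2 \<partial>lborel)"
  unfolding L2norm_def by (simp add: integral_nonneg_AE)

lemma norm_square_perturbation:
  "\<bar>(cmod (a + b))\<^sup>2 - (cmod a)\<^sup>2\<bar> \<le> 2 * cmod a * cmod b + (cmod b)\<^sup>2"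
proof -
  have "\<bar>cmod (a + b) - cmod a\<bar> \<le> cmod b"
    using norm_triangle_ineq3[of "a + b" a] by simp
  moreover have "cmod (a + b) + cmod a \<le> 2 * cmod a + cmod b"
    using norm_triangle_ineq[of a b] by simp
  ultimately have "\<bar>cmod (a + b) - cmod a\<bar> * (cmod (a + b) + cmod a) \<le> cmod b * (2 * cmod a + cmod b)"
    by (intro mult_mono) auto
  moreover have "(cmod (a + b))\<^sup>2 - (cmod a)\<^sup>2 = (cmod (a + b) - cmod a) * (cmod (a + b) + cmod a)"
    by (simp add: power2_eq_square algebra_simps)
  then have "\<bar>(cmod (a + b))\<^sup>2 - (cmod a)\<^sup>2\<bar> = \<bar>cmod (a + b) - cmod a\<bar> * (cmod (a + b) + cmod a)"
    by (simp only: abs_mult) simp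
  ultimately show ?thesis by (simp add: power2_eq_square algebra_simps)
qed

lemma multiplier_has_derivative:
  fixes v :: "'a::euclidean_space \<Rightarrow> complex" and c :: complex and T :: real
  assumes a: "0 < \<alpha>" and v: "v differentiable (at \<xi>)"
  defines "E \<equiv> mittag_leffler \<alpha> 1" and "z \<equiv> \<lambda>\<xi>. c * complex_of_real ((norm \<xi>)\<^sup>2 * T)"
  shows "((\<lambda>\<xi>. E (z \<xi>) * v \<xi>) has_derivative (\<lambda>h. E (z \<xi>) * frechet_derivative v (at \<xi>) h
     + deriv E (z \<xi>) * (c * complex_of_real (2 * (\<xi> \<bullet> h) * T)) * v \<xi>)) (at \<xi>)"
proof -
  have "((\<lambda>\<xi>. (norm \<xi>)\<^sup>2 * T) has_derivative (\<lambda>h. 2 * (\<xi> \<bullet> h) * T)) (at \<xi>)"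
    unfolding power2_norm_eq_inner
    by (auto intro!: derivative_eq_intros simp: inner_commute)
  then have "(z has_derivative (\<lambda>h. c * complex_of_real (2 * (\<xi> \<bullet> h) * T))) (at \<xi>)"
    unfolding z_def by (intro has_derivative_mult_right has_derivative_of_real)
  moreover have "(E has_derivative (*) (deriv E (z \<xi>))) (at (z \<xi>))"
    unfolding E_def by (rule has_field_derivative_imp_has_derivative[OF mittag_leffler_deriv[OF a]])
  ultimately have "((\<lambda>\<xi>. E (z \<xi>)) has_derivative (\<lambda>h. deriv E (z \<xi>) * (c * complex_of_real (2 * (\<xi> \<bullet> h) * T)))) (at \<xi>)"
    by (rule has_derivative_compose)
  from has_derivative_mult[OF this v[unfolded frechet_derivative_works]] show ?thesis .
qed

text \<open>The derivative at \<open>\<xi>\<close> along \<open>b\<close> of the Mittag-Leffler multiplier times a function, where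
  \<open>v\<close> and \<open>w\<close> stand for the value and the derivative of that function.\<close>

definition gradient_component :: "real \<Rightarrow> real \<Rightarrow> 'a::euclidean_space \<Rightarrow> 'a \<Rightarrow> complex \<Rightarrow> complex \<Rightarrow> complex" where
  "gradient_component \<alpha> t b \<xi> v w =
     mittag_leffler \<alpha> 1 ((- \<i>) powr of_real \<alpha> * complex_of_real ((norm \<xi>)\<^sup>2 * t powr \<alpha>)) * w
     + deriv (mittag_leffler \<alpha> 1) ((- \<i>) powr of_real \<alpha> * complex_of_real ((norm \<xi>)\<^sup>2 * t powr \<alpha>)) *
       ((- \<i>) powr of_real \<alpha> * complex_of_real (2 * (\<xi> \<bullet> b) * t powr \<alpha>)) * v"

lemma multiplier_partial_derivative:
  fixes v :: "'a::euclidean_space \<Rightarrow> complex"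
  assumes "0 < \<alpha>" and "v differentiable (at \<xi>)"
  shows "frechet_derivative (\<lambda>\<xi>. mittag_leffler \<alpha> 1 ((- \<i>) powr of_real \<alpha> * complex_of_real ((norm \<xi>)\<^sup>2 * t powr \<alpha>)) * v \<xi>) (at \<xi>) b
    = gradient_component \<alpha> t b \<xi> (v \<xi>) (frechet_derivative v (at \<xi>) b)"
  unfolding gradient_component_def
  by (rule arg_cong[where f="\<lambda>D. D b", OF frechet_derivative_at[OF multiplier_has_derivative[OF assms], symmetric]])

text \<open>Split the component as \<open>A + B\<close> with \<open>A\<close> coming from the oscillation. Then \<open>cmod A\<close> is at most
  a multiple of \<open>t * norm \<xi> powr ((2 - \<alpha>) / \<alpha>) * cmod v\<close>, and the remainder part of \<open>B\<close> is at
  most a multiple of \<open>cmod v / norm \<xi>\<close> and also of \<open>t powr (\<alpha> / 2) * cmod v\<close>. The first bound is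
  used in the cross term, where the weight of \<open>A\<close> absorbs \<open>1 / norm \<xi>\<close>; the second is used in
  the square of \<open>B\<close>, where \<open>1 / (norm \<xi>)^2\<close> need not be integrable.\<close>

lemma gradient_component_estimate:
  assumes a: "0 < \<alpha>" "\<alpha> \<le> 1"
  obtains C where "0 \<le> C" "\<And>(\<xi>::'a::euclidean_space) b t (v::complex) (w::complex).
    \<xi> \<noteq> 0 \<Longrightarrow> b \<in> Basis \<Longrightarrow> 0 < t \<Longrightarrow>
    \<bar>(cmod (gradient_component \<alpha> t b \<xi> v w))\<^sup>2
      - 4 / \<alpha> ^ 4 * t\<^sup>2 * ((\<xi> \<bullet> b)\<^sup>2 / (norm \<xi>)\<^sup>2) * (norm \<xi> powr ((2 - \<alpha>) / \<alpha>) * cmod v)\<^sup>2\<bar>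
    \<le> max 1 t * (C * (norm \<xi> powr (2 / \<alpha> - 2) * (cmod v)\<^sup>2 + (norm \<xi> powr ((2 - \<alpha>) / \<alpha>) * cmod v)\<^sup>2 + (cmod v)\<^sup>2 + (cmod w)\<^sup>2))"
proof -
  let ?l = "(- \<i>) powr of_real \<alpha>"
  let ?E = "mittag_leffler \<alpha> 1"
  obtain K where K: "0 \<le> K"
    "\<And>t. 0 < t \<Longrightarrow> cmod (?E (?l * complex_of_real (t powr \<alpha>))) \<le> K"
    "\<And>t. 0 < t \<Longrightarrow> cmod (deriv ?E (?l * complex_of_real (t powr \<alpha>)) * (?l * complex_of_real (t powr \<alpha>)) + \<i> / of_real (\<alpha>\<^sup>2) * of_real t * exp (- (\<i> * of_real t)))
       \<le> K * min 1 (t powr (\<alpha> / 2))"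
    using mittag_leffler_asymptotics[OF a] by metis
  define C where "C = 8 * K / \<alpha>\<^sup>2 + 8 * K\<^sup>2"
  have C: "0 \<le> C" using K(1) by (simp add: C_def)
  have main: "\<bar>(cmod (gradient_component \<alpha> t b \<xi> v w))\<^sup>2
      - 4 / \<alpha> ^ 4 * t\<^sup>2 * ((\<xi> \<bullet> b)\<^sup>2 / (norm \<xi>)\<^sup>2) * (norm \<xi> powr ((2 - \<alpha>) / \<alpha>) * cmod v)\<^sup>2\<bar>
    \<le> max 1 t * (C * (norm \<xi> powr (2 / \<alpha> - 2) * (cmod v)\<^sup>2 + (norm \<xi> powr ((2 - \<alpha>) / \<alpha>) * cmod v)\<^sup>2 + (cmod v)\<^sup>2 + (cmod w)\<^sup>2))"
    if \<xi>: "\<xi> \<noteq> 0" and b: "b \<in> Basis" and t: "0 < t" for \<xi> b :: 'a and t and v w :: complex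
  proof -
    define r where "r = norm \<xi>"
    have r: "0 < r" using \<xi> by (simp add: r_def)
    \<comment> \<open>The time scale at which frequency \<open>\<xi>\<close> oscillates.\<close>
    define \<tau> where "\<tau> = r powr (2 / \<alpha>) * t"
    have \<tau>: "0 < \<tau>" using r t by (simp add: \<tau>_def)
    have \<tau>\<alpha>: "\<tau> powr \<alpha> = r\<^sup>2 * t powr \<alpha>" using r t a by (simp add: \<tau>_def powr_mult powr_powr powr_numeral)
    have \<tau>2: "\<tau> powr (\<alpha> / 2) = r * t powr (\<alpha> / 2)" using r t a by (simp add: \<tau>_def powr_mult powr_powr)
    define W where "W = r powr ((2 - \<alpha>) / \<alpha>)"
    define X where "X = r powr (2 / \<alpha> - 2)"
    have \<tau>W: "\<tau> = r * (t * W)"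
    proof -
      have "(2 - \<alpha>) / \<alpha> = 2 / \<alpha> - 1" using a by (simp add: diff_divide_distrib)
      then show ?thesis using r by (simp add: \<tau>_def W_def powr_diff)
    qed
    have WX: "W = r * X"
    proof -
      have e: "(2 - \<alpha>) / \<alpha> = 1 + (2 / \<alpha> - 2)" using a by (simp add: diff_divide_distrib)
      show ?thesis unfolding W_def X_def e powr_add using r by simp
    qed
    have W0: "0 \<le> W" and X0: "0 \<le> X" by (auto simp: W_def X_def)
    define z where "z = ?l * complex_of_real (r\<^sup>2 * t powr \<alpha>)"
    define P where "P = deriv ?E z * z + \<i> / of_real (\<alpha>\<^sup>2) * of_real \<tau> * exp (- (\<i> * of_real \<tau>))"
    have Ez: "cmod (?E z) \<le> K" using K(2)[OF \<tau>] by (simp only: z_def \<tau>\<alpha>)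
    have P: "cmod P \<le> K * min 1 (r * t powr (\<alpha> / 2))" using K(3)[OF \<tau>] by (simp only: P_def z_def \<tau>\<alpha> \<tau>2)
    define \<kappa> where "\<kappa> = 2 * (\<xi> \<bullet> b) / r\<^sup>2"
    have xb: "\<bar>\<xi> \<bullet> b\<bar> \<le> r" using Basis_le_norm[OF b] by (simp add: r_def)
    have \<kappa>: "\<bar>\<kappa>\<bar> \<le> 2 / r"
    proof -
      have "\<bar>\<kappa>\<bar> = 2 * \<bar>\<xi> \<bullet> b\<bar> / r\<^sup>2" by (simp add: \<kappa>_def abs_mult)
      also have "\<dots> \<le> 2 * r / r\<^sup>2" using xb by (intro divide_right_mono mult_left_mono) auto
      also have "\<dots> = 2 / r" using r by (simp add: power2_eq_square)
      finally show ?thesis .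
    qed
    define A where "A = of_real \<kappa> * (- (\<i> / of_real (\<alpha>\<^sup>2) * of_real \<tau> * exp (- (\<i> * of_real \<tau>)))) * v"
    define B where "B = of_real \<kappa> * P * v + ?E z * w"
    have "?E z * w + deriv ?E z * (?l * complex_of_real (2 * (\<xi> \<bullet> b) * t powr \<alpha>)) * v = A + B"
    proof -
      have "2 * (\<xi> \<bullet> b) * t powr \<alpha> = \<kappa> * (r\<^sup>2 * t powr \<alpha>)" using r by (simp add: \<kappa>_def)
      then have "?l * complex_of_real (2 * (\<xi> \<bullet> b) * t powr \<alpha>) = of_real \<kappa> * z"
        unfolding z_def by (simp only: of_real_mult mult.left_commute)
      then show ?thesis unfolding A_def B_def P_def by (simp add: algebra_simps)
    qed
    then have AB: "gradient_component \<alpha> t b \<xi> v w = A + B"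
      unfolding gradient_component_def z_def r_def .
    have nA: "cmod A = \<bar>\<kappa>\<bar> * (\<tau> / \<alpha>\<^sup>2) * cmod v"
      using \<tau> unfolding A_def norm_mult norm_minus_cancel norm_divide norm_of_real by simp
    have A2: "(cmod A)\<^sup>2 = 4 / \<alpha> ^ 4 * t\<^sup>2 * ((\<xi> \<bullet> b)\<^sup>2 / r\<^sup>2) * (W * cmod v)\<^sup>2"
    proof -
      have "(cmod A)\<^sup>2 = \<kappa>\<^sup>2 * (\<tau>\<^sup>2 / \<alpha> ^ 4) * (cmod v)\<^sup>2"
        unfolding nA by (simp add: power_mult_distrib power_divide)
      also have "\<dots> = 4 / \<alpha> ^ 4 * t\<^sup>2 * ((\<xi> \<bullet> b)\<^sup>2 / r\<^sup>2) * (W * cmod v)\<^sup>2"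
        using r by (simp add: \<kappa>_def \<tau>W power_mult_distrib power_divide power2_eq_square) (simp add: mult_ac)
      finally show ?thesis .
    qed
    have Ab: "cmod A \<le> 2 / \<alpha>\<^sup>2 * t * W * cmod v"
    proof -
      have "cmod A \<le> 2 / r * (\<tau> / \<alpha>\<^sup>2) * cmod v"
        unfolding nA using \<kappa> \<tau> by (intro mult_right_mono) auto
      also have "\<dots> = 2 / \<alpha>\<^sup>2 * t * W * cmod v" using r by (simp add: \<tau>W)
      finally show ?thesis .
    qed
    define M where "M = max 1 t"
    have M: "1 \<le> M" "t \<le> M" by (auto simp: M_def)
    have tM: "t powr \<alpha> \<le> M"
    proof (cases "t \<le> 1")
      case True
      then have "t powr \<alpha> \<le> 1" using t a by (intro powr_le1) auto
      then show ?thesis using M by linarith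
    next
      case False
      then have "t powr \<alpha> \<le> t powr 1" using a by (intro powr_mono) auto
      then show ?thesis using M t by simp
    qed
    \<comment> \<open>The smaller of the two bounds \<open>1 / r\<close> and \<open>t powr (\<alpha> / 2)\<close>.\<close>
    define m where "m = min 1 (r * t powr (\<alpha> / 2)) / r"
    have m0: "0 \<le> m" using r by (simp add: m_def)
    have m1: "m \<le> 1 / r" using r by (simp add: m_def divide_right_mono)
    have m2: "m \<le> t powr (\<alpha> / 2)" using r by (simp add: m_def divide_le_eq mult.commute)
    have msq: "m\<^sup>2 \<le> M"
    proof -
      have "m\<^sup>2 \<le> (t powr (\<alpha> / 2))\<^sup>2" using m0 m2 by (intro power_mono)
      also have "\<dots> = t powr \<alpha>" using t by (simp add: power2_eq_square powr_add[symmetric])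
      finally show ?thesis using tM by simp
    qed
    have Bb: "cmod B \<le> K * (2 * m * cmod v + cmod w)"
    proof -
      have "cmod B \<le> \<bar>\<kappa>\<bar> * cmod P * cmod v + cmod (?E z) * cmod w"
        unfolding B_def by (rule order_trans[OF norm_triangle_ineq]) (simp add: norm_mult)
      also have "\<dots> \<le> 2 / r * (K * min 1 (r * t powr (\<alpha> / 2))) * cmod v + K * cmod w"
        using r K(1) by (intro add_mono mult_mono \<kappa> P Ez) auto
      also have "\<dots> = K * (2 * m * cmod v + cmod w)" by (simp add: m_def algebra_simps)
      finally show ?thesis .
    qed
    have amgm: "x * y \<le> x\<^sup>2 + y\<^sup>2" for x y :: real
      using sum_squares_bound[of x y] zero_le_power2[of x] zero_le_power2[of y] by argo
    have s1: "2 * cmod A * cmod B \<le> M * (8 * K / \<alpha>\<^sup>2 * (X * (cmod v)\<^sup>2 + (W * cmod v)\<^sup>2 + (cmod w)\<^sup>2))"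
    proof -
      have "2 * cmod A * cmod B \<le> 2 * (2 / \<alpha>\<^sup>2 * t * W * cmod v) * (K * (2 * m * cmod v + cmod w))"
        using W0 t K(1) m0 by (intro mult_mono mult_left_mono Ab Bb) auto
      also have "\<dots> = t * (4 * K / \<alpha>\<^sup>2 * (2 * (W * m) * (cmod v)\<^sup>2 + (W * cmod v) * cmod w))"
        by (simp add: algebra_simps power2_eq_square add_divide_distrib)
      also have "\<dots> \<le> M * (4 * K / \<alpha>\<^sup>2 * (2 * X * (cmod v)\<^sup>2 + ((W * cmod v)\<^sup>2 + (cmod w)\<^sup>2)))"
      proof (intro mult_mono mult_left_mono add_mono mult_right_mono M amgm)
        have "W * m \<le> W * (1 / r)" using m1 W0 by (rule mult_left_mono)
        then show "W * m \<le> X" using r by (simp add: WX)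
      qed (use K(1) M X0 W0 m0 t in auto)
      also have "\<dots> \<le> M * (8 * K / \<alpha>\<^sup>2 * (X * (cmod v)\<^sup>2 + (W * cmod v)\<^sup>2 + (cmod w)\<^sup>2))"
      proof (rule mult_left_mono)
        have e: "8 * K / \<alpha>\<^sup>2 * y = 4 * K / \<alpha>\<^sup>2 * (2 * y)" for y by simp
        show "4 * K / \<alpha>\<^sup>2 * (2 * X * (cmod v)\<^sup>2 + ((W * cmod v)\<^sup>2 + (cmod w)\<^sup>2)) \<le> 8 * K / \<alpha>\<^sup>2 * (X * (cmod v)\<^sup>2 + (W * cmod v)\<^sup>2 + (cmod w)\<^sup>2)"
          unfolding e using K(1) by (intro mult_left_mono) auto
      qed (use M in simp)
      finally show ?thesis .
    qed
    have s2: "(cmod B)\<^sup>2 \<le> M * (8 * K\<^sup>2 * ((cmod v)\<^sup>2 + (cmod w)\<^sup>2))"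
    proof -
      have "(cmod B)\<^sup>2 \<le> (K * (2 * m * cmod v + cmod w))\<^sup>2" by (rule power_mono[OF Bb]) simp
      also have "\<dots> = K\<^sup>2 * (2 * m * cmod v + cmod w)\<^sup>2" by (simp add: power_mult_distrib)
      also have "\<dots> \<le> K\<^sup>2 * (2 * ((2 * m * cmod v)\<^sup>2 + (cmod w)\<^sup>2))"
        using sum_squares_bound[of "2 * m * cmod v" "cmod w"] by (intro mult_left_mono) (auto simp: power2_sum)
      also have "\<dots> = K\<^sup>2 * (8 * m\<^sup>2 * (cmod v)\<^sup>2 + 2 * (cmod w)\<^sup>2)" by (simp add: power_mult_distrib)
      also have "\<dots> \<le> K\<^sup>2 * (8 * M * (cmod v)\<^sup>2 + 8 * M * (cmod w)\<^sup>2)"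
        using M msq by (intro mult_left_mono add_mono mult_right_mono) auto
      also have "\<dots> = M * (8 * K\<^sup>2 * ((cmod v)\<^sup>2 + (cmod w)\<^sup>2))" by (simp add: algebra_simps)
      finally show ?thesis .
    qed
    have "\<bar>(cmod (A + B))\<^sup>2 - (cmod A)\<^sup>2\<bar> \<le> M * (8 * K / \<alpha>\<^sup>2 * (X * (cmod v)\<^sup>2 + (W * cmod v)\<^sup>2 + (cmod w)\<^sup>2)) + M * (8 * K\<^sup>2 * ((cmod v)\<^sup>2 + (cmod w)\<^sup>2))"
      using norm_square_perturbation[of A B] s1 s2 by linarith
    also have "\<dots> = M * (8 * K / \<alpha>\<^sup>2 * (X * (cmod v)\<^sup>2 + (W * cmod v)\<^sup>2 + (cmod w)\<^sup>2) + 8 * K\<^sup>2 * ((cmod v)\<^sup>2 + (cmod w)\<^sup>2))"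
      by (simp add: distrib_left)
    also have "\<dots> \<le> M * (8 * K / \<alpha>\<^sup>2 * (X * (cmod v)\<^sup>2 + (W * cmod v)\<^sup>2 + (cmod v)\<^sup>2 + (cmod w)\<^sup>2) + 8 * K\<^sup>2 * (X * (cmod v)\<^sup>2 + (W * cmod v)\<^sup>2 + (cmod v)\<^sup>2 + (cmod w)\<^sup>2))"
    proof (rule mult_left_mono, rule add_mono)
      have X: "0 \<le> X * (cmod v)\<^sup>2" using X0 by simp
      show "8 * K / \<alpha>\<^sup>2 * (X * (cmod v)\<^sup>2 + (W * cmod v)\<^sup>2 + (cmod w)\<^sup>2) \<le> 8 * K / \<alpha>\<^sup>2 * (X * (cmod v)\<^sup>2 + (W * cmod v)\<^sup>2 + (cmod v)\<^sup>2 + (cmod w)\<^sup>2)"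
        using K(1) by (intro mult_left_mono) auto
      show "8 * K\<^sup>2 * ((cmod v)\<^sup>2 + (cmod w)\<^sup>2) \<le> 8 * K\<^sup>2 * (X * (cmod v)\<^sup>2 + (W * cmod v)\<^sup>2 + (cmod v)\<^sup>2 + (cmod w)\<^sup>2)"
        using X by (intro mult_left_mono) auto
    qed (use M in simp)
    also have "\<dots> = M * (C * (X * (cmod v)\<^sup>2 + (W * cmod v)\<^sup>2 + (cmod v)\<^sup>2 + (cmod w)\<^sup>2))"
      by (simp only: C_def distrib_right)
    finally show ?thesis
      unfolding AB A2 M_def r_def W_def X_def .
  qed
  show ?thesis by (rule that[OF C]) (rule main)
qed

lemma continuous_AE_zero:
  fixes v :: "'a::euclidean_space \<Rightarrow> complex"
  assumes v: "continuous_on UNIV v" and z: "AE x in lborel. v x = 0"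
  shows "v x = 0"
proof (rule ccontr)
  assume "v x \<noteq> 0"
  let ?S = "{x. v x \<noteq> 0}"
  have o: "open ?S" by (rule open_Collect_neq[OF v continuous_on_const])
  then have "?S \<in> sets lborel" by simp
  then have "?S \<in> null_sets lborel" using z by (subst AE_iff_null_sets) auto
  then have "negligible ?S" by (simp add: negligible_iff_null_sets null_sets_completionI)
  then show False using open_not_negligible[OF o] \<open>v x \<noteq> 0\<close> by auto
qed

lemma weighted_fourier_positive:
  fixes u0 :: "'a::euclidean_space \<Rightarrow> complex"
  assumes a: "0 < \<alpha>" "\<alpha> \<le> 1" and u0: "u0 \<in> schwartz" "u0 \<noteq> (\<lambda>x. 0)"
  shows "weighted_u0_hat \<alpha> u0 \<in> L2" "0 < C_const \<alpha> u0"
proof -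
  have vc: "continuous_on UNIV (fourier u0)" by (rule fourier_continuous[OF u0(1)])
  have [measurable]: "fourier u0 \<in> borel_measurable borel" by (rule borel_measurable_continuous_onI[OF vc])
  have rd: "rapidly_decreasing (\<lambda>\<xi>. fourier u0 \<xi> * fourier u0 \<xi>)"
    by (intro rapidly_decreasing_mult fourier_rapidly_decreasing u0)
  have e: "(cmod (weighted_u0_hat \<alpha> u0 \<xi>))\<^sup>2 = norm \<xi> powr (2 * ((2 - \<alpha>) / \<alpha>)) * cmod (fourier u0 \<xi> * fourier u0 \<xi>)" for \<xi>
    by (simp add: weighted_u0_hat_def norm_mult power_mult_distrib power2_eq_square powr_add[symmetric])
  have i: "integrable lborel (\<lambda>\<xi>. (cmod (weighted_u0_hat \<alpha> u0 \<xi>))\<^sup>2)"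
    unfolding e by (rule rapidly_decreasing_integrable[OF rd]) (use a in auto)
  then show "weighted_u0_hat \<alpha> u0 \<in> L2" unfolding L2_def weighted_u0_hat_def[abs_def] by simp
  let ?I = "\<integral>\<xi>. (cmod (weighted_u0_hat \<alpha> u0 \<xi>))\<^sup>2 \<partial>lborel"
  have "?I \<noteq> 0"
  proof
    assume "?I = 0"
    then have "AE \<xi> in lborel. (cmod (weighted_u0_hat \<alpha> u0 \<xi>))\<^sup>2 = 0"
      using integral_nonneg_eq_0_iff_AE[OF i] by simp
    then have "AE \<xi> in lborel. fourier u0 \<xi> = 0"
      using AE_lborel_singleton[of "0::'a"] by eventually_elim (simp add: weighted_u0_hat_def)
    then have "fourier u0 \<xi> = 0" for \<xi> using continuous_AE_zero[OF vc] by blast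
    then have "u0 = (\<lambda>x. 0)" using fourier_injective[OF u0(1)] by blast
    then show False using u0(2) by contradiction
  qed
  moreover have "0 \<le> ?I" by (simp add: integral_nonneg_AE)
  ultimately have "0 < ?I" by (metis less_le)
  then show "0 < C_const \<alpha> u0" using a unfolding C_const_def L2norm_square by simp
qed

text \<open>Integrate \<open>gradient_component_estimate\<close>: the leading terms sum over the basis to a
  multiple of the square of the weighted transform, since the squares of the direction cosines sum to one.\<close>

theorem mean_square_displacement_asymptotics:
  fixes u0 :: "'a::euclidean_space \<Rightarrow> complex"
  assumes a: "0 < \<alpha>" "\<alpha> \<le> 1" and u0: "u0 \<in> schwartz"
    and u: "\<And>t \<xi>. 0 < t \<Longrightarrow> fourier (u t) \<xi> = mittag_leffler \<alpha> 1 ((- \<i>) powr complex_of_real \<alpha> * complex_of_real ((norm \<xi>)\<^sup>2 * t powr \<alpha>)) * fourier u0 \<xi>"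
  shows "\<forall>t>0. finite_D2 u t" "(\<lambda>t. D2 u t - C_const \<alpha> u0 * t\<^sup>2) \<in> O[at_top](\<lambda>t. t)"
proof -
  let ?l = "(- \<i>) powr complex_of_real \<alpha>" and ?E = "mittag_leffler \<alpha> 1"
  define v where "v = fourier u0"
  define v' where "v' = (\<lambda>b \<xi>. frechet_derivative v (at \<xi>) b)"
  define D where "D = (\<lambda>t b \<xi>. frechet_derivative (fourier (u t)) (at \<xi>) b)"
  define W where "W = (\<lambda>\<xi>::'a. norm \<xi> powr ((2 - \<alpha>) / \<alpha>) * cmod (v \<xi>))"
  define main where "main = (\<lambda>t b \<xi>. 4 / \<alpha> ^ 4 * t\<^sup>2 * ((\<xi> \<bullet> b)\<^sup>2 / (norm \<xi>)\<^sup>2) * (W \<xi>)\<^sup>2)"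
  obtain C where C: "0 \<le> C" "\<And>(\<xi>::'a) b t v w. \<xi> \<noteq> 0 \<Longrightarrow> b \<in> Basis \<Longrightarrow> 0 < t \<Longrightarrow>
    \<bar>(cmod (gradient_component \<alpha> t b \<xi> v w))\<^sup>2
      - 4 / \<alpha> ^ 4 * t\<^sup>2 * ((\<xi> \<bullet> b)\<^sup>2 / (norm \<xi>)\<^sup>2) * (norm \<xi> powr ((2 - \<alpha>) / \<alpha>) * cmod v)\<^sup>2\<bar>
    \<le> max 1 t * (C * (norm \<xi> powr (2 / \<alpha> - 2) * (cmod v)\<^sup>2 + (norm \<xi> powr ((2 - \<alpha>) / \<alpha>) * cmod v)\<^sup>2 + (cmod v)\<^sup>2 + (cmod w)\<^sup>2))"
    using gradient_component_estimate[OF a, where 'a='a] by metis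
  define H where "H = (\<lambda>b \<xi>. C * (norm \<xi> powr (2 / \<alpha> - 2) * (cmod (v \<xi>))\<^sup>2 + (W \<xi>)\<^sup>2 + (cmod (v \<xi>))\<^sup>2 + (cmod (v' b \<xi>))\<^sup>2))"
  have vc: "continuous_on UNIV v" unfolding v_def by (rule fourier_continuous[OF u0])
  have [measurable]: "v \<in> borel_measurable borel" by (rule borel_measurable_continuous_onI[OF vc])
  have vd: "v differentiable (at \<xi>)" for \<xi> unfolding v_def by (rule fourier_differentiable[OF u0])
  have v'f: "v' b \<xi> = - \<i> * fourier (\<lambda>x. complex_of_real (x \<bullet> b) * u0 x) \<xi>" if "b \<in> Basis" for b \<xi>
    unfolding v'_def v_def by (rule frechet_derivative_fourier[OF u0 that])
  have v'c: "continuous_on UNIV (v' b)" if "b \<in> Basis" for b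
    using v'f[OF that] fourier_continuous[OF schwartz_coordinate_mult[OF u0 that]]
    by (simp add: continuous_on_cong[OF refl, of UNIV "v' b" "\<lambda>\<xi>. - \<i> * fourier (\<lambda>x. complex_of_real (x \<bullet> b) * u0 x) \<xi>"] continuous_intros)
  have v'm [measurable]: "v' b \<in> borel_measurable borel" if "b \<in> Basis" for b
    by (rule borel_measurable_continuous_onI[OF v'c[OF that]])
  have rv: "rapidly_decreasing v" unfolding v_def by (rule fourier_rapidly_decreasing[OF u0])
  have rv': "rapidly_decreasing (v' b)" if "b \<in> Basis" for b
    using fourier_rapidly_decreasing[OF schwartz_coordinate_mult[OF u0 that]] v'f[OF that]
    unfolding rapidly_decreasing_def by (simp add: norm_mult)
  have sq: "(cmod x)\<^sup>2 = cmod (x * x)" for x by (simp add: norm_mult power2_eq_square)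
  have iv: "integrable lborel (\<lambda>\<xi>. norm \<xi> powr p * (cmod (v \<xi>))\<^sup>2)" if "0 \<le> p" for p
    unfolding sq by (intro rapidly_decreasing_integrable rapidly_decreasing_mult rv that) measurable
  have W2: "(W \<xi>)\<^sup>2 = norm \<xi> powr (2 * ((2 - \<alpha>) / \<alpha>)) * (cmod (v \<xi>))\<^sup>2" for \<xi>
    by (simp add: W_def power_mult_distrib power2_eq_square powr_add[symmetric])
  have iW: "integrable lborel (\<lambda>\<xi>. (W \<xi>)\<^sup>2)" unfolding W2 by (rule iv) (use a in simp)
  have iv0: "integrable lborel (\<lambda>\<xi>. (cmod (v \<xi>))\<^sup>2)"
    unfolding sq by (intro rapidly_decreasing_integrable_unweighted rapidly_decreasing_mult rv) measurable
  have iv': "integrable lborel (\<lambda>\<xi>. (cmod (v' b \<xi>))\<^sup>2)" if b: "b \<in> Basis" for b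
  proof -
    note [measurable] = v'm[OF b]
    show ?thesis
      unfolding sq by (intro rapidly_decreasing_integrable_unweighted rapidly_decreasing_mult rv' b) measurable
  qed
  have iH: "integrable lborel (H b)" if "b \<in> Basis" for b
    unfolding H_def using a
    by (intro integrable_mult_right Bochner_Integration.integrable_add iv iW iv0 iv' that) (simp add: field_simps)
  have imain: "integrable lborel (main t b)" if "b \<in> Basis" for t b
  proof (rule Bochner_Integration.integrable_bound)
    show "integrable lborel (\<lambda>\<xi>. 4 / \<alpha> ^ 4 * t\<^sup>2 * (W \<xi>)\<^sup>2)" by (intro integrable_mult_right iW)
    show "main t b \<in> borel_measurable lborel" unfolding main_def W_def by measurable
    show "AE \<xi> in lborel. norm (main t b \<xi>) \<le> norm (4 / \<alpha> ^ 4 * t\<^sup>2 * (W \<xi>)\<^sup>2)"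
    proof (rule AE_I2)
      fix \<xi>
      have "\<bar>\<xi> \<bullet> b\<bar> \<le> norm \<xi>" by (rule Basis_le_norm[OF that])
      then have "(\<xi> \<bullet> b)\<^sup>2 \<le> (norm \<xi>)\<^sup>2" by (simp add: abs_le_square_iff[symmetric])
      then have "(\<xi> \<bullet> b)\<^sup>2 / (norm \<xi>)\<^sup>2 \<le> 1" by (simp add: divide_le_eq_1)
      then have "4 / \<alpha> ^ 4 * t\<^sup>2 * ((\<xi> \<bullet> b)\<^sup>2 / (norm \<xi>)\<^sup>2) * (W \<xi>)\<^sup>2 \<le> 4 / \<alpha> ^ 4 * t\<^sup>2 * 1 * (W \<xi>)\<^sup>2"
        using a by (intro mult_right_mono mult_left_mono) auto
      then show "norm (main t b \<xi>) \<le> norm (4 / \<alpha> ^ 4 * t\<^sup>2 * (W \<xi>)\<^sup>2)"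
        using a by (simp add: main_def abs_of_nonneg)
    qed
  qed
  have fu: "fourier (u t) = (\<lambda>\<xi>. ?E (?l * complex_of_real ((norm \<xi>)\<^sup>2 * t powr \<alpha>)) * v \<xi>)" if "0 < t" for t
    unfolding v_def using u[OF that] by blast
  have Df: "D t b \<xi> = gradient_component \<alpha> t b \<xi> (v \<xi>) (v' b \<xi>)" if "0 < t" for t b \<xi>
    unfolding D_def fu[OF that] v'_def by (rule multiplier_partial_derivative[OF a(1) vd])
  have Dm: "D t b \<in> borel_measurable borel" if t: "0 < t" and b: "b \<in> Basis" for t b
  proof (rule borel_measurable_continuous_onI)
    have zc: "continuous_on UNIV (\<lambda>\<xi>::'a. ?l * complex_of_real ((norm \<xi>)\<^sup>2 * t powr \<alpha>))"
      by (intro continuous_intros)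
    have "continuous_on UNIV (\<lambda>\<xi>. ?E (?l * complex_of_real ((norm \<xi>)\<^sup>2 * t powr \<alpha>)) * v' b \<xi>
     + deriv ?E (?l * complex_of_real ((norm \<xi>)\<^sup>2 * t powr \<alpha>)) * (?l * complex_of_real (2 * (\<xi> \<bullet> b) * t powr \<alpha>)) * v \<xi>)"
      by (intro continuous_intros vc v'c[OF b]
          continuous_on_compose2[OF mittag_leffler_continuous(1)[OF a(1), of UNIV] zc]
          continuous_on_compose2[OF mittag_leffler_continuous(2)[OF a(1), of UNIV] zc]) auto
    moreover have "D t b = (\<lambda>\<xi>. gradient_component \<alpha> t b \<xi> (v \<xi>) (v' b \<xi>))" using Df[OF t] by blast
    ultimately show "continuous_on UNIV (D t b)" unfolding gradient_component_def by simp
  qed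
  have err: "AE \<xi> in lborel. \<bar>(cmod (D t b \<xi>))\<^sup>2 - main t b \<xi>\<bar> \<le> max 1 t * H b \<xi>" if t: "0 < t" and b: "b \<in> Basis" for t b
    using AE_lborel_singleton[of "0::'a"]
  proof eventually_elim
    case (elim \<xi>)
    show ?case unfolding Df[OF t] main_def H_def W_def by (rule C(2)[OF elim b t])
  qed
  have ierr: "integrable lborel (\<lambda>\<xi>. (cmod (D t b \<xi>))\<^sup>2 - main t b \<xi>)" if t: "0 < t" and b: "b \<in> Basis" for t b
  proof (rule Bochner_Integration.integrable_bound[OF integrable_mult_right[OF iH[OF b], of "max 1 t"]])
    note [measurable] = Dm[OF t b] borel_measurable_integrable[OF imain[OF b, of t]]
    show "(\<lambda>\<xi>. (cmod (D t b \<xi>))\<^sup>2 - main t b \<xi>) \<in> borel_measurable lborel" by measurable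
    show "AE \<xi> in lborel. norm ((cmod (D t b \<xi>))\<^sup>2 - main t b \<xi>) \<le> norm (max 1 t * H b \<xi>)"
      using err[OF t b] by eventually_elim simp
  qed
  have iD: "integrable lborel (\<lambda>\<xi>. (cmod (D t b \<xi>))\<^sup>2)" if "0 < t" "b \<in> Basis" for t b
    using Bochner_Integration.integrable_add[OF ierr[OF that] imain[OF that(2), of t]] by simp
  show "\<forall>t>0. finite_D2 u t"
  proof (intro allI impI)
    fix t :: real assume t: "0 < t"
    have "fourier (u t) differentiable (at \<xi>)" for \<xi>
      unfolding fu[OF t] differentiable_def using multiplier_has_derivative[OF a(1) vd] by blast
    moreover have "D t b \<in> L2" if "b \<in> Basis" for b
      using Dm[OF t that] iD[OF t that] by (simp add: L2_def)
    ultimately show "finite_D2 u t" unfolding finite_D2_def D_def by blast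
  qed
  have sum_main: "(\<Sum>b\<in>Basis. \<integral>\<xi>. main t b \<xi> \<partial>lborel) = C_const \<alpha> u0 * t\<^sup>2" for t
  proof -
    have "(\<Sum>b\<in>Basis. \<integral>\<xi>. main t b \<xi> \<partial>lborel) = (\<integral>\<xi>. (\<Sum>b\<in>Basis. main t b \<xi>) \<partial>lborel)"
      by (rule Bochner_Integration.integral_sum[symmetric]) (rule imain)
    also have "\<dots> = (\<integral>\<xi>. 4 / \<alpha> ^ 4 * t\<^sup>2 * (W \<xi>)\<^sup>2 \<partial>lborel)"
    proof (rule integral_cong_AE)
      show "(\<lambda>\<xi>. \<Sum>b\<in>Basis. main t b \<xi>) \<in> borel_measurable lborel"
        by (intro borel_measurable_sum borel_measurable_integrable imain)
      show "(\<lambda>\<xi>. 4 / \<alpha> ^ 4 * t\<^sup>2 * (W \<xi>)\<^sup>2) \<in> borel_measurable lborel" unfolding W_def by measurable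
      show "AE \<xi> in lborel. (\<Sum>b\<in>Basis. main t b \<xi>) = 4 / \<alpha> ^ 4 * t\<^sup>2 * (W \<xi>)\<^sup>2"
        using AE_lborel_singleton[of "0::'a"]
      proof eventually_elim
        case (elim \<xi>)
        have "(\<Sum>b\<in>Basis. main t b \<xi>) = 4 / \<alpha> ^ 4 * t\<^sup>2 * ((\<Sum>b\<in>Basis. (\<xi> \<bullet> b)\<^sup>2) / (norm \<xi>)\<^sup>2) * (W \<xi>)\<^sup>2"
          unfolding main_def sum_divide_distrib sum_distrib_left sum_distrib_right ..
        then show ?case using elim unfolding norm_sq_Basis[symmetric] by simp
      qed
    qed
    also have "\<dots> = C_const \<alpha> u0 * t\<^sup>2"
      by (simp add: C_const_def L2norm_square weighted_u0_hat_def W_def v_def norm_mult)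
    finally show ?thesis .
  qed
  define c where "c = (\<Sum>b\<in>Basis. \<integral>\<xi>. H b \<xi> \<partial>lborel)"
  have "\<bar>D2 u t - C_const \<alpha> u0 * t\<^sup>2\<bar> \<le> c * \<bar>t\<bar>" if t: "1 \<le> t" for t
  proof -
    have t0: "0 < t" using t by simp
    have "D2 u t - C_const \<alpha> u0 * t\<^sup>2 = (\<Sum>b\<in>Basis. \<integral>\<xi>. (cmod (D t b \<xi>))\<^sup>2 - main t b \<xi> \<partial>lborel)"
      unfolding D2_def L2norm_square sum_main[symmetric] sum_subtractf[symmetric]
    proof (rule sum.cong[OF refl])
      fix b :: 'a assume b: "b \<in> Basis"
      show "(\<integral>\<xi>. (cmod (frechet_derivative (fourier (u t)) (at \<xi>) b))\<^sup>2 \<partial>lborel) - (\<integral>\<xi>. main t b \<xi> \<partial>lborel)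
         = (\<integral>\<xi>. (cmod (D t b \<xi>))\<^sup>2 - main t b \<xi> \<partial>lborel)"
        using Bochner_Integration.integral_diff[OF iD[OF t0 b] imain[OF b, of t]] unfolding D_def by simp
    qed
    also have "\<bar>\<dots>\<bar> \<le> (\<Sum>b\<in>Basis. \<bar>\<integral>\<xi>. (cmod (D t b \<xi>))\<^sup>2 - main t b \<xi> \<partial>lborel\<bar>)" by (rule sum_abs)
    also have "\<dots> \<le> (\<Sum>b\<in>Basis. t * (\<integral>\<xi>. H b \<xi> \<partial>lborel))"
    proof (rule sum_mono)
      fix b :: 'a assume b: "b \<in> Basis"
      have "\<bar>\<integral>\<xi>. (cmod (D t b \<xi>))\<^sup>2 - main t b \<xi> \<partial>lborel\<bar> \<le> (\<integral>\<xi>. \<bar>(cmod (D t b \<xi>))\<^sup>2 - main t b \<xi>\<bar> \<partial>lborel)"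
        by (rule integral_abs_bound)
      also have "\<dots> \<le> (\<integral>\<xi>. t * H b \<xi> \<partial>lborel)"
      proof (rule integral_mono_AE)
        show "integrable lborel (\<lambda>\<xi>. \<bar>(cmod (D t b \<xi>))\<^sup>2 - main t b \<xi>\<bar>)" by (rule integrable_abs[OF ierr[OF t0 b]])
        show "integrable lborel (\<lambda>\<xi>. t * H b \<xi>)" by (rule integrable_mult_right[OF iH[OF b]])
        show "AE \<xi> in lborel. \<bar>(cmod (D t b \<xi>))\<^sup>2 - main t b \<xi>\<bar> \<le> t * H b \<xi>"
          using err[OF t0 b] t by (simp add: max_def)
      qed
      finally show "\<bar>\<integral>\<xi>. (cmod (D t b \<xi>))\<^sup>2 - main t b \<xi> \<partial>lborel\<bar> \<le> t * (\<integral>\<xi>. H b \<xi> \<partial>lborel)" by simp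
    qed
    also have "\<dots> = c * \<bar>t\<bar>" using t by (simp add: c_def sum_distrib_left mult.commute)
    finally show ?thesis .
  qed
  then show "(\<lambda>t. D2 u t - C_const \<alpha> u0 * t\<^sup>2) \<in> O[at_top](\<lambda>t. t)"
    by (intro bigoI[of _ c] eventually_at_top_linorderI[of 1]) simp
qed

theorem mainTheorem2:
  fixes \<alpha> :: real
    and u0 :: "real ^ 'n \<Rightarrow> complex"
    and u :: "real \<Rightarrow> real ^ 'n \<Rightarrow> complex"
  assumes "0 < \<alpha>" and "\<alpha> \<le> 1"
    and "u0 \<in> schwartz" and "u0 \<noteq> (\<lambda>x. 0)"
    and "the_solution \<alpha> u0 u"
  shows "(\<forall>t>0. finite_D2 u t) \<and>
    weighted_u0_hat \<alpha> u0 \<in> L2 \<and> 0 < C_const \<alpha> u0 \<and>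
    (\<lambda>t. D2 u t - C_const \<alpha> u0 * t\<^sup>2) \<in> O[at_top](\<lambda>t. t)"
proof -
  have "fourier (u t) \<xi> = mittag_leffler \<alpha> 1 ((- \<i>) powr complex_of_real \<alpha> * complex_of_real ((norm \<xi>)\<^sup>2 * t powr \<alpha>)) * fourier u0 \<xi>"
    if "0 < t" for t \<xi>
    using assms(5) that unfolding the_solution_def by blast
  from mean_square_displacement_asymptotics[OF assms(1-3) this] weighted_fourier_positive[OF assms(1-4)]
  show ?thesis by blast
qed

end
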